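(* Let $\mathcal A$ be a (possibly nonunital) $C^*$-algebra, $\mathbb V$ an $\mathcal A$-module, $G$ a group, $X$ a nonempty $G$-space, $U:G\to\mathrm{GL}_{\mathcal A}(\mathbb V)$ a representation, and let $\alpha:G\times X\to\mathrm{Inv}_{\mathcal A}\cap\mathcal Z_{\mathcal A}$ and the 2-cocycle $\sigma:G\times G\to\mathcal U_{\mathcal A}\cap\mathcal Z_{\mathcal A}$ be such that $\alpha(e,x)=1_{\tilde{\mathcal A}}$ and $\alpha(gh,x)=\sigma(g,h)\alpha(h,x)\alpha(g,hx)$ for all $g,h\in G$, $x\in X$. Let $K$ be a positive $(X,\alpha,U)$-covariant kernel. Then there is a Hilbert $\mathcal A$-module $(\mathbb M,\langle\cdot|\cdot\rangle)$, a map $R:X\to\mathrm{Lin}_{\mathcal A}(\mathbb V;\mathbb M)$ and a map $\tilde U:G\to\mathcal U_{\mathcal A}(\mathbb M)$ with $\tilde U(e)=I_{\mathbb M}$ and $\tilde U(g)\tilde U(h)=\sigma(g,h).\tilde U(gh)$ for all $g,h\in G$, such that (i) $K_{x,y}(v,w)=\langle R(x)v|R(y)w\rangle$ for all $x,y\in X$ and $v,w\in\mathbb V$; (ii) $\mathrm{lin}_{\mathbb C}\{R(x)v\mid x\in X,\ v\in\mathbb V\}$ is dense in $\mathbb M$; (iii) $R(x)U(g)=\alpha(g,g^{-1}x).\tilde U(g)R(g^{-1}x)$ for all $x\in X$ and $g\in G$. If $(\mathbb M',R',\tilde U')$ is another such triple satisfying (i)--(iii), then there is a unitary $W\in\mathrm{Lin}_{\mathcal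 A}(\mathbb M;\mathbb M')$ such that $WR(x)=R'(x)$ for all $x\in X$ and $W\tilde U(g)=\tilde U'(g)W$ for all $g\in G$. Conversely, if $(\mathbb M,\langle\cdot|\cdot\rangle)$ is a Hilbert $\mathcal A$-module, $R:X\to\mathrm{Lin}_{\mathcal A}(\mathbb V;\mathbb M)$ is a map that is not identically zero, and $\tilde U:G\to\mathcal U_{\mathcal A}(\mathbb M)$ satisfies $\tilde U(e)=I_{\mathbb M}$, $\tilde U(g)\tilde U(h)=\sigma(g,h).\tilde U(gh)$ for all $g,h\in G$, and (iii) holds, then the formula in (i) defines a positive $(X,\alpha,U)$-covariant kernel.
   Context: For a nonunital $C^*$-algebra $\mathcal A$, $\tilde{\mathcal A}$ is its unitalization; if $\mathcal A$ is unital, $\tilde{\mathcal A}=\mathcal A$. $\mathcal U_{\mathcal A}$, $\mathrm{Inv}_{\mathcal A}$, $\mathcal Z_{\mathcal A}$ denote the unitary group, the group of invertible elements and the center of $\tilde{\mathcal A}$. An $\mathcal A$-module is a complex vector space with a (compatible) right $\mathcal A$-module structure; no inner product is assumed. If $\mathcal A$ is nonunital, $\mathcal A$-modules are also regarded as $\tilde{\mathcal A}$-modules in the obvious way. $S_{\mathcal A}(\mathbb V)$ is the set of $\mathcal A$-sesquilinear forms $s:\mathbb V\times\mathbb V\to\mathcal A$: $s$ is linear in the second and conjugate linear in the first argument, $s(u,va)=s(u,v)a$, $s(ua,v)=a^*s(u,v)$. $\mathrm{Lin}_{\mathcal A}(\mathbb V;\mathbb W)$ is the set of ($\mathbb C$-linear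 and) $\mathcal A$-linear maps, $\mathrm{GL}_{\mathcal A}(\mathbb V)$ the group of $\mathcal A$-linear bijections of $\mathbb V$. For central $a$, $a.$ denotes right multiplication, $a.v=va$. A Hilbert $\mathcal A$-module is an $\mathcal A$-module with an $\mathcal A$-valued inner product (a positive definite $\mathcal A$-sesquilinear form), complete in the norm $\|v\|=\|\langle v|v\rangle\|^{1/2}$; $\mathcal U_{\mathcal A}(\mathbb M)$ is the group of unitary (adjointable, $B^*=B^{-1}$) $\mathcal A$-linear maps on $\mathbb M$; a unitary between two Hilbert modules is a surjective inner-product-preserving $\mathcal A$-linear map. A representation $U:G\to\mathrm{GL}_{\mathcal A}(\mathbb V)$ is a group homomorphism. A 2-cocycle $\sigma$ satisfies $\sigma(e,g)=1_{\tilde{\mathcal A}}=\sigma(g,e)$ and $\sigma(g,hk)\sigma(h,k)=\sigma(gh,k)\sigma(g,h)$. A $G$-space is a set with a left action of $G$. A positive $(X,\alpha,U)$-covariant kernel is a non-zero map $K:X\times X\to S_{\mathcal A}(\mathbb V)$, $(x,y)\mapsto K_{x,y}$, with $\sum_{j,k=1}^nK_{x_j,x_k}(v_j,v_k)\ge0$ for all $n\in\mathbb N$, $x_j\in X$, $v_j\in\mathbb V$, and $K_{gx,gy}(v,w)=\alpha(g,x)^*K_{x,y}\big(U(g^{-1})v,U(g^{-1})w\big)\alpha(g,y)$ for all $g\in G$, $x,y\in X$, $v,w\in\mathbb V$. *)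

theory Defs
  imports "HOL-Analysis.Analysis" "HOL-Algebra.Module" "HOL-Algebra.Group_Action"
begin

section \<open>C*-algebras\<close>

text \<open>Neither a unit nor \<open>0 \<noteq> 1\<close> is assumed.\<close>

class cstar_algebra = real_normed_algebra + banach +
  fixes scaleC :: "complex \<Rightarrow> 'a \<Rightarrow> 'a"
    and star :: "'a \<Rightarrow> 'a"
  assumes scaleC_add_right: "scaleC c (a + b) = scaleC c a + scaleC c b"
    and scaleC_add_left: "scaleC (c + d) a = scaleC c a + scaleC d a"
    and scaleC_scaleC: "scaleC c (scaleC d a) = scaleC (c * d) a"
    and scaleR_eq_scaleC: "scaleR r a = scaleC (complex_of_real r) a"
    and scaleC_mult_left: "scaleC c a * b = scaleC c (a * b)"
    and scaleC_mult_right: "a * scaleC c b = scaleC c (a * b)"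
    and norm_scaleC: "norm (scaleC c a) = cmod c * norm a"
    and star_add: "star (a + b) = star a + star b"
    and star_scaleC: "star (scaleC c a) = scaleC (cnj c) (star a)"
    and star_mult: "star (a * b) = star b * star a"
    and star_star: "star (star a) = a"
    and norm_star_mult_self: "norm (star a * a) = (norm a)\<^sup>2"

definition cstar_positive :: "'a::cstar_algebra \<Rightarrow> bool" where
  "cstar_positive a \<longleftrightarrow> (\<exists>b. a = star b * b)"

definition is_algebra_unit :: "'a::cstar_algebra \<Rightarrow> bool" where
  "is_algebra_unit u \<longleftrightarrow> (\<forall>a. u * a = a \<and> a * u = a)"

text \<open>
  The algebra \<open>A\<^sup>~\<close>: for nonunital \<open>A\<close> it is \<open>A \<times> \<complex>\<close> with the pair \<open>(a, c)\<close> standing for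
  \<open>a + c 1\<close>; for unital \<open>A\<close> it is \<open>A\<close> itself, in the guise of \<open>A \<times> {0}\<close>. In both cases
  \<open>a \<mapsto> (a, 0)\<close> is the inclusion of \<open>A\<close>.
\<close>

definition unitization :: "('a::cstar_algebra \<times> complex) ring" where
  "unitization =
    \<lparr>carrier = (if \<exists>u::'a. is_algebra_unit u then UNIV \<times> {0} else UNIV),
     mult = (\<lambda>(a, c) (b, d). (a * b + scaleC d a + scaleC c b, c * d)),
     one = (if \<exists>u::'a. is_algebra_unit u then (THE u. is_algebra_unit u, 0) else (0, 1)),
     zero = (0, 0),
     add = (\<lambda>(a, c) (b, d). (a + b, c + d))\<rparr>"

definition unitization_incl :: "'a::cstar_algebra \<Rightarrow> 'a \<times> complex" where
  "unitization_incl a = (a, 0)"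

definition unitization_star :: "'a::cstar_algebra \<times> complex \<Rightarrow> 'a \<times> complex" where
  "unitization_star = (\<lambda>(a, c). (star a, cnj c))"

definition unitary_elements :: "('a::cstar_algebra \<times> complex) set" where
  "unitary_elements = {u \<in> carrier unitization.
     unitization_star u \<otimes>\<^bsub>unitization\<^esub> u = \<one>\<^bsub>unitization\<^esub> \<and>
     u \<otimes>\<^bsub>unitization\<^esub> unitization_star u = \<one>\<^bsub>unitization\<^esub>}"

definition invertible_elements :: "('a::cstar_algebra \<times> complex) set" where
  "invertible_elements = Units unitization"

definition center :: "('a::cstar_algebra \<times> complex) set" where
  "center = {z \<in> carrier unitization. \<forall>a\<in>carrier unitization.
     z \<otimes>\<^bsub>unitization\<^esub> a = a \<otimes>\<^bsub>unitization\<^esub> z}"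


section \<open>Modules over C*-algebras\<close>

definition complex_ring :: "complex ring" where
  "complex_ring = \<lparr>carrier = UNIV, mult = (*), one = 1, zero = 0, add = (+)\<rparr>"

text \<open>
  As in the library record \<^typ>\<open>('a, 'b) module\<close>, the ring multiplication and unit fields of the
  records below play no role.
\<close>

record ('a, 'v) amodule = "(complex, 'v) module" +
  ract :: "'v \<Rightarrow> 'a \<Rightarrow> 'v" (infixl "\<cdot>\<index>" 70)

record ('a, 'v) hmodule = "('a, 'v) amodule" +
  inner_prod :: "'v \<Rightarrow> 'v \<Rightarrow> 'a"

locale cstar_module = Module.module complex_ring V
  for V :: "('a::cstar_algebra, 'v, 'more) amodule_scheme" (structure) +
  assumes ract_closed: "v \<in> carrier V \<Longrightarrow> v \<cdot> a \<in> carrier V"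
    and ract_add_left: "v \<in> carrier V \<Longrightarrow> w \<in> carrier V \<Longrightarrow> (v \<oplus> w) \<cdot> a = v \<cdot> a \<oplus> w \<cdot> a"
    and ract_add_right: "v \<in> carrier V \<Longrightarrow> v \<cdot> (a + b) = v \<cdot> a \<oplus> v \<cdot> b"
    and ract_mult: "v \<in> carrier V \<Longrightarrow> v \<cdot> (a * b) = v \<cdot> a \<cdot> b"
    and ract_smult_left: "v \<in> carrier V \<Longrightarrow> (c \<odot> v) \<cdot> a = c \<odot> (v \<cdot> a)"
    and ract_smult_right: "v \<in> carrier V \<Longrightarrow> v \<cdot> scaleC c a = c \<odot> (v \<cdot> a)"

text \<open>
  The right action of \<open>A\<^sup>~\<close>. For central \<open>a\<close>, \<open>uract M v a\<close> is the element written \<open>a.v\<close>.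
\<close>

definition uract ::
    "('a::cstar_algebra, 'v, 'more) amodule_scheme \<Rightarrow> 'v \<Rightarrow> 'a \<times> complex \<Rightarrow> 'v" where
  "uract V v = (\<lambda>(a, c). (v \<cdot>\<^bsub>V\<^esub> a) \<oplus>\<^bsub>V\<^esub> (c \<odot>\<^bsub>V\<^esub> v))"

definition Lin ::
    "('a::cstar_algebra, 'v, 'm1) amodule_scheme \<Rightarrow> ('a, 'w, 'm2) amodule_scheme \<Rightarrow>
     ('v \<Rightarrow> 'w) set" where
  "Lin V W = {f \<in> carrier V \<rightarrow> carrier W.
     (\<forall>v\<in>carrier V. \<forall>w\<in>carrier V. f (v \<oplus>\<^bsub>V\<^esub> w) = f v \<oplus>\<^bsub>W\<^esub> f w) \<and>
     (\<forall>c. \<forall>v\<in>carrier V. f (c \<odot>\<^bsub>V\<^esub> v) = c \<odot>\<^bsub>W\<^esub> f v) \<and>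
     (\<forall>a. \<forall>v\<in>carrier V. f (v \<cdot>\<^bsub>V\<^esub> a) = f v \<cdot>\<^bsub>W\<^esub> a)}"

definition GL :: "('a::cstar_algebra, 'v, 'more) amodule_scheme \<Rightarrow> ('v \<Rightarrow> 'v) monoid" where
  "GL V = (BijGroup (carrier V))\<lparr>carrier := Bij (carrier V) \<inter> Lin V V\<rparr>"

definition sesquilinear_forms ::
    "('a::cstar_algebra, 'v, 'more) amodule_scheme \<Rightarrow> ('v \<Rightarrow> 'v \<Rightarrow> 'a) set" where
  "sesquilinear_forms V = {s.
     (\<forall>u\<in>carrier V. \<forall>v\<in>carrier V. \<forall>w\<in>carrier V.
        s u (v \<oplus>\<^bsub>V\<^esub> w) = s u v + s u w \<and> s (u \<oplus>\<^bsub>V\<^esub> v) w = s u w + s v w) \<and>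
     (\<forall>u\<in>carrier V. \<forall>v\<in>carrier V. \<forall>c.
        s u (c \<odot>\<^bsub>V\<^esub> v) = scaleC c (s u v) \<and> s (c \<odot>\<^bsub>V\<^esub> u) v = scaleC (cnj c) (s u v)) \<and>
     (\<forall>u\<in>carrier V. \<forall>v\<in>carrier V. \<forall>a.
        s u (v \<cdot>\<^bsub>V\<^esub> a) = s u v * a \<and> s (u \<cdot>\<^bsub>V\<^esub> a) v = star a * s u v)}"


section \<open>Hilbert modules\<close>

definition hnorm :: "('a::cstar_algebra, 'v, 'more) hmodule_scheme \<Rightarrow> 'v \<Rightarrow> real" where
  "hnorm M v = sqrt (norm (inner_prod M v v))"

text \<open>The value \<open>0\<close> outside the carrier is needed because the library locale
  \<^locale>\<open>Metric_space\<close> requires symmetry and nonnegativity on the whole type.\<close>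

definition hdist :: "('a::cstar_algebra, 'v, 'more) hmodule_scheme \<Rightarrow> 'v \<Rightarrow> 'v \<Rightarrow> real" where
  "hdist M v w =
    (if v \<in> carrier M \<and> w \<in> carrier M then hnorm M (v \<ominus>\<^bsub>M\<^esub> w) else 0)"

locale hilbert_module = cstar_module M
  for M :: "('a::cstar_algebra, 'v, 'more) hmodule_scheme" (structure) +
  assumes inner_sesquilinear: "inner_prod M \<in> sesquilinear_forms M"
    and inner_positive: "v \<in> carrier M \<Longrightarrow> cstar_positive (inner_prod M v v)"
    and inner_definite: "v \<in> carrier M \<Longrightarrow> inner_prod M v v = 0 \<Longrightarrow> v = \<zero>"
    and complete: "Metric_space.mcomplete (carrier M) (hdist M)"

definition unitary_operators ::
    "('a::cstar_algebra, 'v, 'more) hmodule_scheme \<Rightarrow> ('v \<Rightarrow> 'v) set" where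
  "unitary_operators M = {B \<in> Lin M M. \<exists>C \<in> carrier M \<rightarrow> carrier M.
     (\<forall>v\<in>carrier M. \<forall>w\<in>carrier M. inner_prod M (B v) w = inner_prod M v (C w)) \<and>
     (\<forall>v\<in>carrier M. C (B v) = v \<and> B (C v) = v)}"

definition unitary_between ::
    "('a::cstar_algebra, 'v, 'm1) hmodule_scheme \<Rightarrow> ('a, 'w, 'm2) hmodule_scheme \<Rightarrow>
     ('v \<Rightarrow> 'w) set" where
  "unitary_between M N = {W \<in> Lin M N. W ` carrier M = carrier N \<and>
     (\<forall>v\<in>carrier M. \<forall>w\<in>carrier M. inner_prod N (W v) (W w) = inner_prod M v w)}"

definition lin_span ::
    "('a::cstar_algebra, 'v, 'more) amodule_scheme \<Rightarrow> 'v set \<Rightarrow> 'v set" where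
  "lin_span V S = (\<lambda>H. submodule H complex_ring V) hull S"

definition hdense :: "('a::cstar_algebra, 'v, 'more) hmodule_scheme \<Rightarrow> 'v set \<Rightarrow> bool" where
  "hdense M S \<longleftrightarrow> Metric_space.mtopology (carrier M) (hdist M) closure_of S = carrier M"


section \<open>Covariant kernels and their dilations\<close>

definition two_cocycle ::
    "('g, 'more) monoid_scheme \<Rightarrow> ('g \<Rightarrow> 'g \<Rightarrow> 'a::cstar_algebra \<times> complex) \<Rightarrow> bool" where
  "two_cocycle G \<sigma> \<longleftrightarrow>
     (\<forall>g\<in>carrier G. \<forall>h\<in>carrier G. \<sigma> g h \<in> unitary_elements \<inter> center) \<and>
     (\<forall>g\<in>carrier G. \<sigma> \<one>\<^bsub>G\<^esub> g = \<one>\<^bsub>unitization\<^esub> \<and> \<sigma> g \<one>\<^bsub>G\<^esub> = \<one>\<^bsub>unitization\<^esub>) \<and>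
     (\<forall>g\<in>carrier G. \<forall>h\<in>carrier G. \<forall>k\<in>carrier G.
        \<sigma> g (h \<otimes>\<^bsub>G\<^esub> k) \<otimes>\<^bsub>unitization\<^esub> \<sigma> h k = \<sigma> (g \<otimes>\<^bsub>G\<^esub> h) k \<otimes>\<^bsub>unitization\<^esub> \<sigma> g h)"

text \<open>Here and below, \<open>\<phi> g x\<close> is the action \<open>g x\<close> of \<open>g \<in> G\<close> on \<open>x \<in> X\<close>.\<close>

definition positive_covariant_kernel ::
    "('g, 'm1) monoid_scheme \<Rightarrow> 'x set \<Rightarrow> ('g \<Rightarrow> 'x \<Rightarrow> 'x) \<Rightarrow>
     ('a::cstar_algebra, 'v, 'm2) amodule_scheme \<Rightarrow> ('g \<Rightarrow> 'x \<Rightarrow> 'a \<times> complex) \<Rightarrow>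
     ('g \<Rightarrow> 'v \<Rightarrow> 'v) \<Rightarrow> ('x \<Rightarrow> 'x \<Rightarrow> 'v \<Rightarrow> 'v \<Rightarrow> 'a) \<Rightarrow> bool" where
  "positive_covariant_kernel G X \<phi> V \<alpha> U K \<longleftrightarrow>
     (\<forall>x\<in>X. \<forall>y\<in>X. K x y \<in> sesquilinear_forms V) \<and>
     (\<exists>x\<in>X. \<exists>y\<in>X. \<exists>v\<in>carrier V. \<exists>w\<in>carrier V. K x y v w \<noteq> 0) \<and>
     (\<forall>(n::nat) (x::nat \<Rightarrow> 'x) (v::nat \<Rightarrow> 'v).
        (\<forall>j<n. x j \<in> X \<and> v j \<in> carrier V) \<longrightarrow>
        cstar_positive (\<Sum>j<n. \<Sum>k<n. K (x j) (x k) (v j) (v k))) \<and>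
     (\<forall>g\<in>carrier G. \<forall>x\<in>X. \<forall>y\<in>X. \<forall>v\<in>carrier V. \<forall>w\<in>carrier V.
        unitization_incl (K (\<phi> g x) (\<phi> g y) v w) =
          unitization_star (\<alpha> g x) \<otimes>\<^bsub>unitization\<^esub>
          unitization_incl (K x y (U (inv\<^bsub>G\<^esub> g) v) (U (inv\<^bsub>G\<^esub> g) w)) \<otimes>\<^bsub>unitization\<^esub>
          \<alpha> g y)"

text \<open>The map \<open>T\<close> is the projective unitary representation of \<open>G\<close> on \<open>M\<close>; the last clause is
  the intertwining relation \<open>R(x) U(g) = \<alpha>(g, g\<^sup>-\<^sup>1 x). T(g) R(g\<^sup>-\<^sup>1 x)\<close>.\<close>

definition covariant_triple ::
    "('g, 'm1) monoid_scheme \<Rightarrow> 'x set \<Rightarrow> ('g \<Rightarrow> 'x \<Rightarrow> 'x) \<Rightarrow>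
     ('a::cstar_algebra, 'v, 'm2) amodule_scheme \<Rightarrow> ('g \<Rightarrow> 'x \<Rightarrow> 'a \<times> complex) \<Rightarrow>
     ('g \<Rightarrow> 'g \<Rightarrow> 'a \<times> complex) \<Rightarrow> ('g \<Rightarrow> 'v \<Rightarrow> 'v) \<Rightarrow>
     ('a, 'w, 'm3) hmodule_scheme \<Rightarrow> ('x \<Rightarrow> 'v \<Rightarrow> 'w) \<Rightarrow> ('g \<Rightarrow> 'w \<Rightarrow> 'w) \<Rightarrow> bool" where
  "covariant_triple G X \<phi> V \<alpha> \<sigma> U M R T \<longleftrightarrow>
     hilbert_module M \<and>
     (\<forall>x\<in>X. R x \<in> Lin V M) \<and>
     (\<forall>g\<in>carrier G. T g \<in> unitary_operators M) \<and>
     (\<forall>m\<in>carrier M. T \<one>\<^bsub>G\<^esub> m = m) \<and>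
     (\<forall>g\<in>carrier G. \<forall>h\<in>carrier G. \<forall>m\<in>carrier M.
        T g (T h m) = uract M (T (g \<otimes>\<^bsub>G\<^esub> h) m) (\<sigma> g h)) \<and>
     (\<forall>x\<in>X. \<forall>g\<in>carrier G. \<forall>v\<in>carrier V.
        R x (U g v) =
          uract M (T g (R (\<phi> (inv\<^bsub>G\<^esub> g) x) v)) (\<alpha> g (\<phi> (inv\<^bsub>G\<^esub> g) x)))"

definition minimal_dilation ::
    "('g, 'm1) monoid_scheme \<Rightarrow> 'x set \<Rightarrow> ('g \<Rightarrow> 'x \<Rightarrow> 'x) \<Rightarrow>
     ('a::cstar_algebra, 'v, 'm2) amodule_scheme \<Rightarrow> ('g \<Rightarrow> 'x \<Rightarrow> 'a \<times> complex) \<Rightarrow>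
     ('g \<Rightarrow> 'g \<Rightarrow> 'a \<times> complex) \<Rightarrow> ('g \<Rightarrow> 'v \<Rightarrow> 'v) \<Rightarrow>
     ('x \<Rightarrow> 'x \<Rightarrow> 'v \<Rightarrow> 'v \<Rightarrow> 'a) \<Rightarrow>
     ('a, 'w, 'm3) hmodule_scheme \<Rightarrow> ('x \<Rightarrow> 'v \<Rightarrow> 'w) \<Rightarrow> ('g \<Rightarrow> 'w \<Rightarrow> 'w) \<Rightarrow> bool" where
  "minimal_dilation G X \<phi> V \<alpha> \<sigma> U K M R T \<longleftrightarrow>
     covariant_triple G X \<phi> V \<alpha> \<sigma> U M R T \<and>
     (\<forall>x\<in>X. \<forall>y\<in>X. \<forall>v\<in>carrier V. \<forall>w\<in>carrier V.
        K x y v w = inner_prod M (R x v) (R y w)) \<and>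
     hdense M (lin_span M {R x v | x v. x \<in> X \<and> v \<in> carrier V})"

text \<open>
  Since types cannot be quantified existentially, the existence of a minimal dilation has to be
  asserted on a fixed type. The type \<^typ>\<open>'x \<Rightarrow> 'v \<Rightarrow> 'a\<close> is large enough: the module of any minimal
  dilation \<open>(M, R, T)\<close> embeds into it by \<open>m \<mapsto> (\<lambda>x v. inner_prod M (R x v) m)\<close>.
\<close>

end

theory Submission
  imports Defs
begin

text \<open>
  The first part of the theorem is a Kolmogorov decomposition. Formal sums of pairs \<open>(x, v)\<close>,
  realised as lists, carry the form that is \<open>K x y v w\<close> on the pairs \<open>(x, v)\<close> and \<open>(y, w)\<close>;
  positivity of the kernel makes it a semi-inner product. The module \<open>M\<close> is the separated
  completion, with \<open>R x v\<close> the class of \<open>(x, v)\<close>. An element \<open>m\<close> is identified with the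
  function \<open>f x v = \<langle>R x v, m\<rangle>\<close> of its coordinates. So \<open>M\<close> consists of the functions that are
  pointwise limits of the coordinates of Cauchy sequences of formal sums, and its inner product is a
  limit of values of the form. This is well defined because a Cauchy sequence that tends to zero
  weakly tends to zero in norm (lemma \<open>weakly_null_imp_null\<close>).

  The group acts on coordinates by \<open>(T g f)(g x)(U(g) v) = \<alpha>(g, x)* f(x)(v)\<close>, the only choice
  compatible with the intertwining relation. On formal sums this is the translation
  \<open>(x, v) \<mapsto> (g x, (U(g) v) \<alpha>(g, x)\<^sup>-\<^sup>1)\<close>, and covariance of the kernel says that the translation
  preserves the form (lemma \<open>form_translate\<close>). The identity for \<open>\<alpha>\<close>, and \<open>\<sigma>\<close> being unitary
  and central, give \<open>T(g) T(h) = \<sigma>(g, h).T(g h)\<close>, hence also surjectivity of \<open>T(g)\<close>.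

  For uniqueness, taking coordinates maps every minimal dilation unitarily onto the same module of
  functions, and \<open>W\<close> is the composition of two such maps. It intertwines the representations since
  \<open>\<langle>R(g x) U(g) v, T(g) m\<rangle> = \<alpha>(g, x)* \<langle>R(x) v, m\<rangle>\<close> expresses the coordinates of \<open>T(g) m\<close> by
  those of \<open>m\<close>. The converse is this identity for \<open>m = R(y) w\<close>, together with the observation
  that the double sum in the definition of positivity is the inner product of a vector with itself.

  What makes this work over an arbitrary C*-algebra is the Cauchy-Schwarz inequality
  (lemma \<open>norm_B_le\<close>), and that a limit of positive elements is positive. Both rest on the
  order structure: the elements \<open>b* b\<close> form a closed convex cone on which the norm is monotone.
  This is derived from the axioms without spectral theory. In a unital algebra, positivity of
  a self-adjoint \<open>h\<close> is taken to mean \<open>\<parallel>t - h\<parallel> \<le> t\<close> for some \<open>t \<ge> 0\<close>, a condition that is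
  evidently convex; such elements have square roots, given by the binomial series of
  \<open>sqrt (1 - x)\<close>. Conversely, elements \<open>b* b\<close> are positive in this sense
  (lemma \<open>star_mult_self_nonneg\<close>). The general case follows by adjoining a unit.
\<close>

section \<open>Elementary facts on C*-algebras\<close>

declare star_star [simp]

lemma star_zero [simp]: "star (0::'a::cstar_algebra) = 0"
  using star_add[of "0::'a" 0] by simp

lemma star_minus [simp]: "star (- a) = - star (a::'a::cstar_algebra)"
  using star_add[of a "-a"] by (simp add: add_eq_0_iff)

lemma star_diff: "star (a - b) = star a - star (b::'a::cstar_algebra)"
  using star_add[of a "-b"] by simp

lemma star_scaleR: "star (r *\<^sub>R a) = r *\<^sub>R star (a::'a::cstar_algebra)"
  by (simp add: scaleR_eq_scaleC star_scaleC)

lemma norm_star [simp]: "norm (star a) = norm (a::'a::cstar_algebra)"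
proof -
  have le: "norm b \<le> norm (star b)" for b :: 'a
  proof (cases "b = 0")
    case False
    have "norm b * norm b \<le> norm (star b) * norm b"
      using norm_star_mult_self[of b] norm_mult_ineq[of "star b" b]
      by (simp add: power2_eq_square)
    then show ?thesis using False by simp
  qed simp
  show ?thesis using le[of a] le[of "star a"] by simp
qed

lemma bounded_linear_star: "bounded_linear (star :: 'a::cstar_algebra \<Rightarrow> 'a)"
  by (rule bounded_linear_intro[where K=1]) (auto simp: star_add star_scaleR)

lemma star_mult_self_eq_zero: "star a * a = 0 \<Longrightarrow> a = (0::'a::cstar_algebra)"
  using norm_star_mult_self[of a] by simp

lemma selfadjoint_square_norm: "star a = a \<Longrightarrow> norm (a * a) = (norm (a::'a::cstar_algebra))\<^sup>2"
  using norm_star_mult_self[of a] by simp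

lemma scaleC_one [simp]: "scaleC 1 a = (a::'a::cstar_algebra)"
  using scaleR_eq_scaleC[of 1 a] by simp

lemma scaleC_zero_left [simp]: "scaleC 0 a = (0::'a::cstar_algebra)"
  using scaleR_eq_scaleC[of 0 a] by simp

lemma scaleC_zero_right [simp]: "scaleC c (0::'a::cstar_algebra) = 0"
  using scaleC_add_right[of c 0 "0::'a"] by simp

lemma scaleC_minus_right [simp]: "scaleC c (- a) = - scaleC c (a::'a::cstar_algebra)"
  using scaleC_add_right[of c a "- a"] by (simp add: add_eq_0_iff)

lemma scaleC_minus_left [simp]: "scaleC (- c) a = - scaleC c (a::'a::cstar_algebra)"
  using scaleC_add_left[of c "- c" a] by (simp add: add_eq_0_iff)

lemma scaleC_diff_right: "scaleC c (a - b) = scaleC c a - scaleC c (b::'a::cstar_algebra)"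
  using scaleC_add_right[of c a "- b"] by simp

lemma scaleC_scaleR: "scaleC c (r *\<^sub>R a) = r *\<^sub>R scaleC c (a::'a::cstar_algebra)"
  by (simp add: scaleR_eq_scaleC scaleC_scaleC mult.commute)

lemma bounded_linear_scaleC: "bounded_linear (scaleC c :: 'a::cstar_algebra \<Rightarrow> 'a)"
  by (rule bounded_linear_intro[where K="cmod c"])
    (auto simp: scaleC_add_right scaleC_scaleR norm_scaleC)

lemma star_one [simp]: "star (1::'a::{cstar_algebra,real_normed_algebra_1}) = 1"
  by (metis mult.left_neutral mult.right_neutral star_mult star_star)

lemma star_of_real [simp]: "star (of_real r) = (of_real r::'a::{cstar_algebra,real_normed_algebra_1})"
  by (simp add: of_real_def star_scaleR)

lemma star_power: "star (a ^ n) = star a ^ n" for a :: "'a::{cstar_algebra,real_normed_algebra_1}"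
  by (induction n) (auto simp: star_mult power_commutes)

section \<open>Square roots in unital C*-algebras\<close>

text \<open>
  The Taylor coefficients of \<open>sqrt (1 - z)\<close>.
\<close>

definition sqrt_coeff :: "nat \<Rightarrow> real" where
  "sqrt_coeff n = (1/2 gchoose n) * (-1) ^ n"

lemma sqrt_coeff_0 [simp]: "sqrt_coeff 0 = 1"
  by (simp add: sqrt_coeff_def)

text \<open>
  These are the Taylor coefficients of \<open>1 / sqrt (1 - z)\<close>. They are the partial sums of those of
  \<open>sqrt (1 - z)\<close>, since dividing a power series by \<open>1 - z\<close> sums its coefficients.
\<close>

lemma inverse_sqrt_coeff_nonneg: "(-1) ^ n * ((-1/2 :: real) gchoose n) \<ge> 0"
proof -
  have "(-1) ^ n * ((-1/2 :: real) gchoose n) = ((-1) ^ n * (-1) ^ n) * pochhammer (1/2) n / fact n"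
    by (simp add: gbinomial_pochhammer del: power_minus power_add)
  also have "\<dots> = pochhammer (1/2) n / fact n"
    by (simp flip: power_mult_distrib)
  also have "\<dots> \<ge> 0" by (simp add: pochhammer_nonneg)
  finally show ?thesis .
qed

lemma sqrt_coeff_Suc_nonpos: "sqrt_coeff (Suc n) \<le> 0"
proof -
  have "(1/2 gchoose Suc n :: real) = (1/2) * ((-1/2) gchoose n) / real (Suc n)"
    using gbinomial_absorption[of n "1/2::real"] by (simp add: field_simps)
  then have "sqrt_coeff (Suc n) = - (1/2) * ((-1) ^ n * ((-1/2) gchoose n)) / real (Suc n)"
    by (simp add: sqrt_coeff_def)
  then show ?thesis using inverse_sqrt_coeff_nonneg[of n]
    by (simp add: divide_nonpos_pos mult_nonpos_nonneg del: of_nat_Suc)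
qed

text \<open>
  All coefficients of \<open>sqrt (1 - z)\<close> but the first are nonpositive, so this sum is \<open>1\<close> minus a
  partial sum of the coefficients, and the partial sums are nonnegative. The bound gives absolute
  convergence of the series at every \<open>x\<close> with \<open>norm x \<le> 1\<close>, and it keeps the square root within
  distance \<open>1\<close> of the unit.
\<close>

lemma sum_abs_sqrt_coeff_le: "(\<Sum>k<n. \<bar>sqrt_coeff (Suc k)\<bar>) \<le> 1"
proof -
  have "(\<Sum>k\<le>n. sqrt_coeff k) \<ge> 0"
    using inverse_sqrt_coeff_nonneg[of n] gbinomial_sum_lower_neg[of "1/2::real" n]
    by (simp add: sqrt_coeff_def)
  moreover have "(\<Sum>k\<le>n. sqrt_coeff k) = 1 + (\<Sum>k<n. sqrt_coeff (Suc k))"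
    by (simp add: sum.atMost_shift)
  moreover have "(\<Sum>k<n. \<bar>sqrt_coeff (Suc k)\<bar>) = - (\<Sum>k<n. sqrt_coeff (Suc k))"
    unfolding sum_negf[symmetric] by (rule sum.cong) (auto simp: abs_of_nonpos sqrt_coeff_Suc_nonpos)
  ultimately show ?thesis by simp
qed

text \<open>
  The Cauchy square of the series is \<open>1 - z\<close>, by Vandermonde's identity.
\<close>

lemma sqrt_coeff_convolution:
  "(\<Sum>i\<le>n. sqrt_coeff i * sqrt_coeff (n - i)) = (if n = 0 then 1 else if n = 1 then -1 else 0)"
proof -
  have "(\<Sum>i\<le>n. sqrt_coeff i * sqrt_coeff (n - i))
      = (-1) ^ n * (\<Sum>i\<le>n. (1/2 gchoose i) * (1/2 gchoose (n - i)))"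
    unfolding sqrt_coeff_def sum_distrib_left
    by (rule sum.cong) (auto simp: power_add[symmetric])
  also have "(\<Sum>i\<le>n. (1/2 gchoose i) * (1/2 gchoose (n - i))) = (1 gchoose n :: real)"
    using gbinomial_Vandermonde[of "1/2::real" "1/2" n] by (simp add: atMost_atLeast0)
  also have "(1 gchoose n :: real) = of_nat (1 choose n)"
    using binomial_gbinomial[of 1 n, where ?'a = real] by simp
  finally show ?thesis
    by (cases n; cases "n - 1") auto
qed

text \<open>
  The square root is the sum of the binomial series at \<open>x\<close>. As a limit of real polynomials in \<open>x\<close>
  it is self-adjoint and commutes with whatever commutes with \<open>x\<close>; the bound on \<open>1 - y\<close> will
  say that the root is again positive.
\<close>

lemma sqrt_one_minus:
  fixes x :: "'a::{cstar_algebra,real_normed_algebra_1}"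
  assumes sa: "star x = x" and le: "norm x \<le> 1"
  obtains y where "star y = y" "y * y = 1 - x" "norm (1 - y) \<le> 1"
    "\<And>z. z * x = x * z \<Longrightarrow> z * y = y * z"
proof -
  define f where "f n = sqrt_coeff n *\<^sub>R x ^ n" for n
  have pow: "norm (x ^ n) \<le> 1" for n
    using norm_power_ineq[of x n] power_le_one[of "norm x" n] le by simp
  have fle: "norm (f (Suc n)) \<le> \<bar>sqrt_coeff (Suc n)\<bar>" for n
    using mult_left_mono[OF pow[of "Suc n"], of "\<bar>sqrt_coeff (Suc n)\<bar>"]
    by (simp add: f_def)
  have sumle: "(\<Sum>k<n. norm (f (Suc k))) \<le> 1" for n
    using sum_mono[of "{..<n}" "\<lambda>k. norm (f (Suc k))", OF fle] sum_abs_sqrt_coeff_le[of n] by force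
  have sum1: "summable (\<lambda>n. norm (f (Suc n)))"
    by (rule summableI_nonneg_bounded[where x=1]) (use sumle in auto)
  then have abs: "summable (\<lambda>n. norm (f n))"
    using summable_Suc_iff[of "\<lambda>n. norm (f n)"] by simp
  then have sm: "summable f" by (rule summable_norm_cancel)
  define y where "y = suminf f"
  have "star y = (\<Sum>n. star (f n))"
    unfolding y_def by (rule bounded_linear.suminf[OF bounded_linear_star sm])
  moreover have "star (f n) = f n" for n
    by (simp add: f_def star_scaleR star_power sa)
  ultimately have 1: "star y = y" by (simp add: y_def)
  have "(\<lambda>k. \<Sum>i\<le>k. f i * f (k - i)) sums (y * y)"
    unfolding y_def by (rule Cauchy_product_sums[OF abs abs])
  moreover have "(\<Sum>i\<le>k. f i * f (k - i)) = (if k = 0 then 1 else if k = 1 then - x else 0)" for k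
  proof -
    have "(\<Sum>i\<le>k. f i * f (k - i)) = (\<Sum>i\<le>k. sqrt_coeff i * sqrt_coeff (k - i)) *\<^sub>R x ^ k"
      unfolding scaleR_sum_left
      by (rule sum.cong) (auto simp: f_def power_add[symmetric])
    then show ?thesis by (simp add: sqrt_coeff_convolution)
  qed
  moreover have "(\<lambda>k. if k = 0 then 1 else if k = 1 then - x else 0) sums (1 - x)"
    using sums_finite[of "{0,1::nat}" "\<lambda>k. if k = 0 then 1 else if k = 1 then - x else 0"] by simp
  ultimately have 2: "y * y = 1 - x"
    using sums_unique2 by fastforce
  have "y - 1 = (\<Sum>n. f (Suc n))"
    unfolding y_def using suminf_split_head[OF sm] by (simp add: f_def)
  then have "norm (1 - y) = norm (\<Sum>n. f (Suc n))" by (metis norm_minus_commute)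
  also have "\<dots> \<le> (\<Sum>n. norm (f (Suc n)))" by (rule summable_norm[OF sum1])
  also have "\<dots> \<le> 1" by (rule suminf_le_const[OF sum1]) (use sumle in auto)
  finally have 3: "norm (1 - y) \<le> 1" .
  have 4: "z * y = y * z" if z: "z * x = x * z" for z
  proof -
    have "z * x ^ n = x ^ n * z" for n
      by (induction n) (auto simp: z mult.assoc, metis mult.assoc z)
    then have "z * f n = f n * z" for n by (simp add: f_def)
    then show ?thesis
      unfolding y_def using suminf_mult[OF sm, of z] suminf_mult2[OF sm, of z] by simp
  qed
  show ?thesis using that 1 2 3 4 by blast
qed

section \<open>The positive cone of a unital C*-algebra\<close>

text \<open>
  For self-adjoint \<open>h\<close> the inequality says that the spectrum of \<open>h\<close> lies in \<open>[0, 2 t]\<close>. In this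
  form positivity is visibly preserved by sums, and it needs no spectral theory. The elements
  \<open>star b * b\<close> are shown to satisfy it in the next section.
\<close>

definition nonneg :: "'a::{cstar_algebra,real_normed_algebra_1} \<Rightarrow> bool" where
  "nonneg h \<longleftrightarrow> star h = h \<and> (\<exists>t\<ge>0. norm (of_real t - h) \<le> t)"

lemma nonneg_star: "nonneg h \<Longrightarrow> star h = h"
  by (simp add: nonneg_def)

lemma of_real_commute: "of_real r * z = z * (of_real r :: 'a::real_algebra_1)"
  by (simp add: of_real_def)

text \<open>
  Up to the factor \<open>t\<close>, the element \<open>h\<close> is \<open>1 - x\<close> with \<open>norm x \<le> 1\<close>.
\<close>

lemma nonneg_sqrt:
  fixes h :: "'a::{cstar_algebra,real_normed_algebra_1}"
  assumes "nonneg h"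
  obtains y where "nonneg y" "y * y = h" "\<And>z. z * h = h * z \<Longrightarrow> z * y = y * z"
proof -
  obtain t where sa: "star h = h" and t: "t \<ge> 0" "norm (of_real t - h) \<le> t"
    using assms by (auto simp: nonneg_def)
  show ?thesis
  proof (cases "t = 0")
    case True
    then have "h = 0" using t by simp
    then show ?thesis using that[of 0] by (simp add: nonneg_def exI[of _ 0])
  next
    case False
    define x where "x = (1/t) *\<^sub>R (of_real t - h)"
    have "norm x \<le> 1" using t False by (simp add: x_def divide_simps)
    moreover have "star x = x" by (simp add: x_def star_scaleR star_diff sa)
    ultimately obtain y where y: "star y = y" "y * y = 1 - x" "norm (1 - y) \<le> 1"
      "\<And>z. z * x = x * z \<Longrightarrow> z * y = y * z"
      using sqrt_one_minus by metis
    have hx: "h = t *\<^sub>R (1 - x)" using False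
      by (simp add: x_def scaleR_diff_right of_real_def)
    define w where "w = sqrt t *\<^sub>R y"
    have "w * w = h" using t by (simp add: w_def y(2) hx)
    moreover have "z * w = w * z" if z: "z * h = h * z" for z
    proof -
      have "z * x = x * z"
        by (simp add: x_def algebra_simps z of_real_commute)
      then show ?thesis by (simp add: w_def y(4))
    qed
    moreover have "nonneg w"
    proof -
      have "of_real (sqrt t) - w = sqrt t *\<^sub>R (1 - y)"
        by (simp add: w_def of_real_def scaleR_diff_right)
      then have "norm (of_real (sqrt t) - w) \<le> sqrt t"
        using mult_left_mono[OF y(3), of "sqrt t"] t by simp
      moreover have "star w = w" by (simp add: w_def star_scaleR y(1))
      ultimately show ?thesis using t real_sqrt_ge_zero unfolding nonneg_def by blast
    qed
    ultimately show ?thesis using that by blast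
  qed
qed

text \<open>
  The element \<open>u = x + \<i> y\<close> satisfies \<open>star u * u = t\<close>, so its norm is \<open>sqrt \<bar>t\<bar>\<close>; and \<open>x\<close>
  is the real part of \<open>u\<close>.
\<close>

lemma norm_le_of_sum_squares:
  fixes x y :: "'a::{cstar_algebra,real_normed_algebra_1}"
  assumes "star x = x" "star y = y" "x * y = y * x" "x * x + y * y = of_real t"
  shows "norm (x * x) \<le> \<bar>t\<bar>"
proof -
  define u where "u = x + scaleC \<i> y"
  have su: "star u = x - scaleC \<i> y"
    by (simp add: u_def star_add star_scaleC assms)
  have "star u * u = of_real t"
    unfolding su using assms(3,4)
    by (simp add: u_def algebra_simps scaleC_mult_left scaleC_mult_right scaleC_scaleC
        scaleC_diff_right scaleC_add_right)
  then have nu: "(norm u)\<^sup>2 = \<bar>t\<bar>"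
    using norm_star_mult_self[of u] by simp
  have "2 *\<^sub>R x = u + star u"
    unfolding su by (simp add: u_def scaleR_2)
  then have "2 * norm x \<le> norm u + norm (star u)"
    using norm_triangle_ineq[of u "star u"] norm_scaleR[of 2 x] by simp
  then have "norm x \<le> norm u" by simp
  then have "(norm x)\<^sup>2 \<le> \<bar>t\<bar>" unfolding nu[symmetric] by (simp add: power_mono)
  then show ?thesis using selfadjoint_square_norm[OF assms(1)] by simp
qed

text \<open>
  The square roots \<open>x\<close> of \<open>h\<close> and \<open>y\<close> of \<open>t - h\<close> commute, and \<open>x\<^sup>2 + y\<^sup>2 = t\<close>.
\<close>

lemma nonneg_norm_le:
  fixes h :: "'a::{cstar_algebra,real_normed_algebra_1}"
  assumes "nonneg h" "nonneg (of_real t - h)"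
  shows "norm h \<le> \<bar>t\<bar>"
proof -
  obtain x where x: "nonneg x" "x * x = h"
    using nonneg_sqrt[OF assms(1)] by metis
  obtain y where y: "nonneg y" "y * y = of_real t - h"
    "\<And>z. z * (of_real t - h) = (of_real t - h) * z \<Longrightarrow> z * y = y * z"
    using nonneg_sqrt[OF assms(2)] by metis
  have "x * y = y * x"
    by (rule y(3)) (simp add: algebra_simps of_real_commute flip: x(2))
  then show ?thesis
    using norm_le_of_sum_squares[of x y t] x y(1,2) by (simp add: nonneg_star)
qed

lemma nonneg_norm_minus:
  fixes h :: "'a::{cstar_algebra,real_normed_algebra_1}"
  assumes "star h = h" "norm h \<le> t"
  shows "nonneg (of_real t - h)"
proof -
  have "t \<ge> 0" using assms(2) norm_ge_zero order_trans by blast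
  then show ?thesis using assms by (auto simp: nonneg_def star_diff)
qed

text \<open>
  For \<open>t = norm (x * x)\<close> the element \<open>t - x\<^sup>2\<close> has a square root \<open>y\<close> that commutes with \<open>x\<close>,
  and \<open>x\<^sup>2 + y\<^sup>2 = t\<close> bounds \<open>y\<^sup>2 = t - x\<^sup>2\<close>.
\<close>

lemma nonneg_square:
  fixes x :: "'a::{cstar_algebra,real_normed_algebra_1}"
  assumes "star x = x"
  shows "nonneg (x * x)"
proof -
  define t where "t = norm (x * x)"
  have sa: "star (x * x) = x * x" by (simp add: star_mult assms)
  have "nonneg (of_real t - x * x)" by (rule nonneg_norm_minus[OF sa]) (simp add: t_def)
  then obtain y where y: "nonneg y" "y * y = of_real t - x * x"
    "\<And>z. z * (of_real t - x * x) = (of_real t - x * x) * z \<Longrightarrow> z * y = y * z"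
    using nonneg_sqrt by metis
  have "x * y = y * x"
    by (rule y(3)) (simp add: algebra_simps of_real_commute)
  then have "norm (y * y) \<le> \<bar>t\<bar>"
    using norm_le_of_sum_squares[of y x t] y(2) by (simp add: assms nonneg_star[OF y(1)])
  then show ?thesis
    by (auto simp: nonneg_def sa y(2) t_def intro!: exI[of _ t])
qed

text \<open>
  The witness \<open>t\<close> can be taken to be \<open>norm h\<close>. Since both sides of the inequality are continuous
  in \<open>h\<close>, the positive cone is closed.
\<close>

lemma nonneg_iff_norm:
  fixes h :: "'a::{cstar_algebra,real_normed_algebra_1}"
  shows "nonneg h \<longleftrightarrow> star h = h \<and> norm (of_real (norm h) - h) \<le> norm h"
proof
  assume h: "nonneg h"
  then obtain x where x: "nonneg x" "x * x = h" using nonneg_sqrt by metis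
  obtain y where y: "nonneg y" "y * y = of_real (norm h) - h"
    "\<And>z. z * (of_real (norm h) - h) = (of_real (norm h) - h) * z \<Longrightarrow> z * y = y * z"
    using nonneg_sqrt nonneg_norm_minus[OF nonneg_star[OF h] order_refl] by metis
  have "x * y = y * x"
    by (rule y(3)) (simp add: algebra_simps of_real_commute flip: x(2))
  then have "norm (y * y) \<le> \<bar>norm h\<bar>"
    using norm_le_of_sum_squares[of y x "norm h"] x y(2) nonneg_star[OF x(1)] nonneg_star[OF y(1)]
    by simp
  then show "star h = h \<and> norm (of_real (norm h) - h) \<le> norm h"
    using h by (simp add: y(2) nonneg_star)
next
  assume "star h = h \<and> norm (of_real (norm h) - h) \<le> norm h"
  then show "nonneg h" using norm_ge_zero[of h] unfolding nonneg_def by blast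
qed

lemma nonneg_add:
  fixes h k :: "'a::{cstar_algebra,real_normed_algebra_1}"
  assumes "nonneg h" "nonneg k"
  shows "nonneg (h + k)"
proof -
  obtain s t where "s \<ge> 0" "norm (of_real s - h) \<le> s" "t \<ge> 0" "norm (of_real t - k) \<le> t"
    using assms by (auto simp: nonneg_def)
  moreover have "of_real (s + t) - (h + k) = (of_real s - h) + (of_real t - k)" by simp
  ultimately have "norm (of_real (s + t) - (h + k)) \<le> s + t"
    by (simp only: norm_triangle_mono)
  with \<open>s \<ge> 0\<close> \<open>t \<ge> 0\<close> have "\<exists>r\<ge>0. norm (of_real r - (h + k)) \<le> r"
    by (intro exI[of _ "s + t"]) auto
  then show ?thesis
    using assms by (auto simp: nonneg_def star_add)
qed

text \<open>
  The product is the square of the product of the square roots, which is self-adjoint because the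
  roots commute.
\<close>

lemma nonneg_mult:
  fixes h k :: "'a::{cstar_algebra,real_normed_algebra_1}"
  assumes "nonneg h" "nonneg k" "h * k = k * h"
  shows "nonneg (h * k)"
proof -
  obtain x where x: "nonneg x" "x * x = h" "\<And>z. z * h = h * z \<Longrightarrow> z * x = x * z"
    using nonneg_sqrt[OF assms(1)] by metis
  obtain y where y: "nonneg y" "y * y = k" "\<And>z. z * k = k * z \<Longrightarrow> z * y = y * z"
    using nonneg_sqrt[OF assms(2)] by metis
  have xy: "x * y = y * x"
    using x(3)[of y] y(3)[of h] assms(3) by simp
  have "(x * y) * (x * y) = h * k"
    by (metis xy x(2) y(2) mult.assoc)
  moreover have "star (x * y) = x * y"
    using xy by (simp add: star_mult nonneg_star[OF x(1)] nonneg_star[OF y(1)])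
  ultimately show ?thesis using nonneg_square[of "x * y"] by simp
qed

lemma nonneg_norm_mono:
  fixes h k :: "'a::{cstar_algebra,real_normed_algebra_1}"
  assumes "nonneg h" "nonneg (k - h)"
  shows "norm h \<le> norm k"
proof -
  have "nonneg k" using nonneg_add[OF assms] by simp
  then have "nonneg ((k - h) + (of_real (norm k) - k))"
    using nonneg_add[OF assms(2) nonneg_norm_minus[OF nonneg_star order_refl]] by blast
  then show ?thesis using nonneg_norm_le[OF assms(1), of "norm k"] by simp
qed

text \<open>
  If \<open>c = x + \<i> y\<close> with \<open>x\<close> and \<open>y\<close> self-adjoint, the sum is \<open>2 x\<^sup>2 + 2 y\<^sup>2\<close>.
\<close>

lemma star_mult_add_mult_star_nonneg:
  fixes c :: "'a::{cstar_algebra,real_normed_algebra_1}"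
  shows "nonneg (star c * c + c * star c)"
proof -
  define x where "x = (1/2) *\<^sub>R (c + star c)"
  define y where "y = scaleC (-\<i>/2) (c - star c)"
  have sx: "star x = x" by (simp add: x_def star_scaleR star_add add.commute)
  have "star y = scaleC (\<i>/2) (star c - c)" by (simp add: y_def star_scaleC star_diff)
  also have "\<dots> = y" by (simp add: y_def scaleC_diff_right)
  finally have sy: "star y = y" .
  have iy: "scaleC \<i> y = (1/2) *\<^sub>R (c - star c)"
    by (simp add: y_def scaleC_scaleC scaleR_eq_scaleC)
  have "x + scaleC \<i> y = (1/2) *\<^sub>R ((c + star c) + (c - star c))"
    unfolding iy x_def by (simp only: scaleR_right_distrib)
  also have "\<dots> = c" by simp
  finally have c: "c = x + scaleC \<i> y" by simp
  have sc: "star c = x - scaleC \<i> y"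
    unfolding c by (simp add: star_add star_scaleC sx sy)
  have "star c * c + c * star c = (x * x + x * x) + (y * y + y * y)"
    unfolding sc by (subst (1 2) c) (simp add: algebra_simps scaleC_mult_left scaleC_mult_right
        scaleC_scaleC scaleC_diff_right scaleC_add_right)
  then show ?thesis
    by (simp add: nonneg_add nonneg_square sx sy)
qed

section \<open>Elements of the form b* b are positive\<close>

text \<open>
  Write \<open>star c * c = - e\<close> and \<open>d = c * star c\<close>. By the preceding lemma \<open>d = (d - e) + e\<close> is
  positive. In spectral terms this is absurd because \<open>star c * c\<close> and \<open>c * star c\<close> have the same
  nonzero spectrum. The comparison is made here by an identity of polynomials:
  \<open>star c * (1 - d) ^ n * c = - (1 + e) ^ n * e\<close>. The left side has norm at most \<open>1\<close>, as
  \<open>norm (1 - d) \<le> 1\<close>, whereas \<open>(1 + e) ^ n * e\<close> dominates \<open>n e\<^sup>2\<close>, which has norm \<open>n\<close>; take \<open>n = 2\<close>.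
\<close>

lemma star_mult_nonpos_norm_one:
  fixes c :: "'a::{cstar_algebra,real_normed_algebra_1}"
  assumes "nonneg (- (star c * c))" "norm c = 1"
  shows False
proof -
  define e where "e = - (star c * c)"
  define d where "d = c * star c"
  have e: "nonneg e" using assms by (simp add: e_def)
  have "d = (star c * c + c * star c) + e" by (simp add: d_def e_def)
  then have d: "nonneg d" using nonneg_add[OF star_mult_add_mult_star_nonneg[of c] e] by simp
  have "norm d = 1" using norm_star_mult_self[of "star c"] assms(2) by (simp add: d_def)
  then have d1: "norm (1 - d) \<le> 1" using d by (auto simp: nonneg_iff_norm)
  define f where "f n = (1 + e) ^ n * e" for n
  have fc: "f n = - (star c * (1 - d) ^ n * c)" for n
  proof -
    have *: "star c * (1 - d) = (1 + e) * star c"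
      unfolding d_def e_def by (simp add: algebra_simps)
    have "star c * (1 - d) ^ n = (1 + e) ^ n * star c"
    proof (induction n)
      case (Suc n)
      have "star c * (1 - d) ^ Suc n = (star c * (1 - d)) * (1 - d) ^ n"
        by (simp add: mult.assoc)
      also have "\<dots> = (1 + e) * (star c * (1 - d) ^ n)" by (simp only: * mult.assoc)
      also have "\<dots> = (1 + e) ^ Suc n * star c" by (simp only: Suc power_Suc mult.assoc)
      finally show ?case .
    qed simp
    then show ?thesis by (simp add: f_def e_def mult.assoc)
  qed
  have f1: "norm (f n) \<le> 1" for n
  proof -
    have "norm (f n) \<le> norm (star c * (1 - d) ^ n) * norm c"
      unfolding fc norm_minus_cancel by (rule norm_mult_ineq)
    also have "\<dots> \<le> norm (star c) * norm ((1 - d) ^ n)"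
      using norm_mult_ineq[of "star c" "(1 - d) ^ n"] assms(2) by simp
    also have "\<dots> \<le> 1"
      using norm_power_ineq[of "1 - d" n] power_le_one[OF norm_ge_zero d1, of n] assms(2) by simp
    finally show ?thesis .
  qed
  have ef: "e * f n = f n * e" for n
  proof -
    have "e * (1 + e) ^ n = (1 + e) ^ n * e"
      by (rule power_commuting_commutes[symmetric]) (simp add: algebra_simps)
    then show ?thesis by (simp add: f_def mult.assoc[symmetric])
  qed
  have f_Suc: "f (Suc n) = f n + e * f n" for n
    by (simp add: f_def mult.assoc distrib_right)
  have inc: "nonneg (f n) \<and> nonneg (f n - e)" for n
  proof (induction n)
    case 0 show ?case by (simp add: f_def e) (simp add: nonneg_def exI[of _ 0])
  next
    case (Suc n)
    have *: "nonneg (e * f n)" by (rule nonneg_mult) (use e Suc ef in auto)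
    then have "nonneg (f n + e * f n)" "nonneg ((f n - e) + e * f n)"
      using Suc by (blast intro: nonneg_add)+
    then show ?case by (simp add: f_Suc algebra_simps)
  qed
  have grow: "nonneg (f n - of_nat n * (e * e))" for n
  proof (induction n)
    case 0 show ?case using inc[of 0] by simp
  next
    case (Suc n)
    have "nonneg (e * (f n - e))"
      by (rule nonneg_mult) (use e inc ef in \<open>auto simp: algebra_simps\<close>)
    then have "nonneg ((f n - of_nat n * (e * e)) + e * (f n - e))"
      using Suc nonneg_add by blast
    then show ?case by (simp add: f_Suc algebra_simps)
  qed
  have "norm (e * e) = 1"
    using selfadjoint_square_norm[OF nonneg_star[OF e]] norm_star_mult_self[of c] assms(2)
    by (simp add: e_def)
  moreover have "2 * norm (e * e) \<le> 1"
  proof -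
    have ee: "nonneg (e * e)" by (rule nonneg_square[OF nonneg_star[OF e]])
    have "nonneg (of_nat 2 * (e * e))" using nonneg_add[OF ee ee] by (simp add: mult_2 distrib_right)
    then have "norm (of_nat 2 * (e * e)) \<le> norm (f 2)"
      using grow[of 2] nonneg_norm_mono by blast
    moreover have "of_nat 2 * (e * e) = 2 *\<^sub>R (e * e)" by (simp add: scaleR_2 mult_2 distrib_right)
    ultimately show ?thesis using f1[of 2] by simp
  qed
  ultimately show False by simp
qed

lemma star_mult_nonpos_imp_zero:
  fixes c :: "'a::{cstar_algebra,real_normed_algebra_1}"
  assumes "nonneg (- (star c * c))"
  shows "c = 0"
proof (rule ccontr)
  assume c: "c \<noteq> 0"
  define r where "r = inverse (norm c)"
  obtain y where y: "nonneg y" "y * y = - (star c * c)" using nonneg_sqrt[OF assms] by metis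
  have "star (r *\<^sub>R y) = r *\<^sub>R y" by (simp add: star_scaleR nonneg_star[OF y(1)])
  then have "nonneg ((r *\<^sub>R y) * (r *\<^sub>R y))" by (rule nonneg_square)
  also have "(r *\<^sub>R y) * (r *\<^sub>R y) = - (star (r *\<^sub>R c) * (r *\<^sub>R c))" by (simp add: y(2) star_scaleR)
  finally show False
    using star_mult_nonpos_norm_one[of "r *\<^sub>R c"] c by (simp add: r_def)
qed

text \<open>
  For \<open>h = star b * b\<close> let \<open>p\<close> be the positive square root of \<open>h\<^sup>2\<close>, in other words \<open>\<bar>h\<bar>\<close>, and let
  \<open>m = p - h\<close>, twice the negative part of \<open>h\<close>. Then \<open>m h = - m p\<close>, so that
  \<open>star (b m) * (b m) = m h m = - m p m\<close> is negative. By the preceding lemma \<open>b m = 0\<close>, which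
  forces \<open>m = 0\<close> and \<open>h = p\<close>.
\<close>

lemma star_mult_self_nonneg:
  fixes b :: "'a::{cstar_algebra,real_normed_algebra_1}"
  shows "nonneg (star b * b)"
proof -
  define h where "h = star b * b"
  have sh: "star h = h" by (simp add: h_def star_mult)
  obtain p where p: "nonneg p" "p * p = h * h" "\<And>z. z * (h * h) = (h * h) * z \<Longrightarrow> z * p = p * z"
    using nonneg_sqrt[OF nonneg_square[OF sh]] by metis
  obtain q where q: "nonneg q" "q * q = p" "\<And>z. z * p = p * z \<Longrightarrow> z * q = q * z"
    using nonneg_sqrt[OF p(1)] by metis
  define m where "m = p - h"
  have hp: "h * p = p * h" by (rule p(3)) (simp add: mult.assoc)
  have sm: "star m = m" by (simp add: m_def star_diff sh nonneg_star[OF p(1)])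
  have mp: "m * p = p * m" by (simp add: m_def algebra_simps hp)
  have mq: "m * q = q * m" by (rule q(3)[OF mp])
  have "m * (p + h) = 0" by (simp add: m_def algebra_simps p(2) hp)
  then have mh: "m * h = - (m * p)" by (simp add: distrib_left add_eq_0_iff)
  have mm: "m * m = 2 *\<^sub>R (m * p)"
  proof -
    have "m * m = m * p - m * h" by (subst (2) m_def) (simp add: right_diff_distrib)
    then show ?thesis by (simp add: mh scaleR_2)
  qed
  have "star (b * m) * (b * m) = m * h * m" by (simp add: star_mult sm h_def mult.assoc)
  also have "\<dots> = - ((m * q) * (m * q))"
  proof -
    have "m * h * m = - (m * p * m)" by (simp add: mh)
    also have "m * p * m = (m * q) * (q * m)" by (simp only: q(2)[symmetric] mult.assoc)
    finally show ?thesis by (simp only: mq)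
  qed
  finally have "- (star (b * m) * (b * m)) = (m * q) * (m * q)" by simp
  moreover have "star (m * q) = m * q" using mq by (simp add: star_mult sm nonneg_star[OF q(1)])
  ultimately have "b * m = 0"
    using star_mult_nonpos_imp_zero[of "b * m"] nonneg_square[of "m * q"] by simp
  then have "h * m = 0" by (simp add: h_def mult.assoc)
  then have "m * h = 0" using sh sm by (metis star_mult star_zero)
  then have "m * m = 0" using mm mh by simp
  then have "m = 0" using star_mult_self_eq_zero[of m] sm by simp
  then have "h = p" by (simp add: m_def)
  then show ?thesis using p(1) by (simp add: h_def)
qed

section \<open>Adjoining a unit\<close>

text \<open>
  The pair \<open>(a, c)\<close> stands for \<open>a + c 1\<close>. The unit is adjoined whether or not the algebra already
  has one; having it as a type makes the results on unital algebras available.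
\<close>

datatype 'a unitz = Unitz (alg_part: 'a) (scal_part: complex)

lemma unitz_eq_iff: "x = y \<longleftrightarrow> alg_part x = alg_part y \<and> scal_part x = scal_part y"
  by (cases x; cases y) simp

definition lmul :: "'a::cstar_algebra unitz \<Rightarrow> 'a \<Rightarrow> 'a" where
  "lmul x b = alg_part x * b + scaleC (scal_part x) b"

lemma bounded_linear_lmul: "bounded_linear (lmul x)"
  unfolding lmul_def
  by (intro bounded_linear_add bounded_linear_mult_right bounded_linear_scaleC)

lemma scaleC_scaleR_left: "scaleC (r *\<^sub>R c) a = r *\<^sub>R scaleC c (a::'a::cstar_algebra)"
  by (simp add: scaleR_conv_of_real scaleR_eq_scaleC scaleC_scaleC)

instantiation unitz :: (cstar_algebra) real_algebra_1
begin

definition "0 = Unitz (0::'a) 0"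
definition "1 = Unitz (0::'a) 1"
definition "x + y = Unitz (alg_part x + alg_part y :: 'a) (scal_part x + scal_part y)"
definition "x - y = Unitz (alg_part x - alg_part y :: 'a) (scal_part x - scal_part y)"
definition "- x = Unitz (- alg_part x :: 'a) (- scal_part x)"
definition "x * y = Unitz (alg_part x * alg_part y + scaleC (scal_part y) (alg_part x)
    + scaleC (scal_part x) (alg_part y) :: 'a) (scal_part x * scal_part y)"
definition "r *\<^sub>R x = Unitz (r *\<^sub>R alg_part x :: 'a) (r *\<^sub>R scal_part x)"

instance
  by standard (auto simp: unitz_eq_iff zero_unitz_def one_unitz_def plus_unitz_def minus_unitz_def
      uminus_unitz_def times_unitz_def scaleR_unitz_def algebra_simps scaleC_add_left
      scaleC_add_right scaleC_mult_left scaleC_mult_right scaleC_scaleC scaleC_scaleR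
      scaleC_scaleR_left)

end

lemma unitz_sel [simp]:
  "alg_part 0 = 0" "scal_part 0 = 0" "alg_part 1 = 0" "scal_part 1 = 1"
  "alg_part (x + y) = alg_part x + alg_part y" "scal_part (x + y) = scal_part x + scal_part y"
  "alg_part (x - y) = alg_part x - alg_part y" "scal_part (x - y) = scal_part x - scal_part y"
  "alg_part (- x) = - alg_part x" "scal_part (- x) = - scal_part x"
  "alg_part (x * y) = alg_part x * alg_part y + scaleC (scal_part y) (alg_part x)
    + scaleC (scal_part x) (alg_part y)" "scal_part (x * y) = scal_part x * scal_part y"
  "alg_part (r *\<^sub>R x) = r *\<^sub>R alg_part x" "scal_part (r *\<^sub>R x) = r *\<^sub>R scal_part x"
  by (simp_all add: zero_unitz_def one_unitz_def plus_unitz_def minus_unitz_def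
      uminus_unitz_def times_unitz_def scaleR_unitz_def)

lemma lmul_mult: "lmul (x * y) = lmul x \<circ> lmul y"
  by (rule ext) (simp add: lmul_def algebra_simps scaleC_mult_left scaleC_mult_right scaleC_scaleC
      scaleC_add_right)

lemma lmul_add: "lmul (x + y) = (\<lambda>b. lmul x b + lmul y b)"
  by (rule ext) (simp add: lmul_def algebra_simps scaleC_add_left)

text \<open>
  Evaluation at \<open>star a\<close> recovers the norm of the algebra part \<open>a\<close>. Consequently the norm introduced
  below is complete and the inclusion of the algebra is isometric.
\<close>

lemma norm_alg_part_le: "norm (alg_part x) \<le> onorm (lmul x) + cmod (scal_part x)"
proof (cases "alg_part x = 0")
  case True
  then show ?thesis using onorm_pos_le[OF bounded_linear_lmul[of x]] by simp
next
  case False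
  define a where "a = alg_part x"
  have "norm a * norm a = norm (a * star a)"
    using norm_star_mult_self[of "star a"] by (simp add: power2_eq_square)
  also have "a * star a = lmul x (star a) - scaleC (scal_part x) (star a)"
    by (simp add: lmul_def a_def)
  also have "norm \<dots> \<le> norm (lmul x (star a)) + norm (scaleC (scal_part x) (star a))"
    by (rule norm_triangle_ineq4)
  also have "\<dots> \<le> (onorm (lmul x) + cmod (scal_part x)) * norm a"
    using onorm[OF bounded_linear_lmul, of x "star a"] by (simp add: norm_scaleC distrib_right)
  finally show ?thesis using False by (simp add: a_def)
qed

text \<open>
  If the algebra has a unit \<open>u\<close>, then \<open>1 - u\<close> acts on it as zero, and the operator norm is only a
  seminorm. Taking the maximum with the modulus of the scalar part yields a C*-norm in all cases.
\<close>

instantiation unitz :: (cstar_algebra) real_normed_algebra_1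
begin

definition "norm x = max (onorm (lmul (x::'a unitz))) (cmod (scal_part x))"
definition "dist x y = norm (x - y :: 'a unitz)"
definition "sgn x = inverse (norm x) *\<^sub>R (x :: 'a unitz)"
definition [code del]: "uniformity = (INF e\<in>{0<..}. principal {(x, y :: 'a unitz). dist x y < e})"
definition [code del]: "open U \<longleftrightarrow>
  (\<forall>x\<in>U. eventually (\<lambda>(x', y :: 'a unitz). x' = x \<longrightarrow> y \<in> U) uniformity)"

instance
proof
  fix x y :: "'a unitz" and r :: real
  show "dist x y = norm (x - y)" by (rule dist_unitz_def)
  show "sgn x = inverse (norm x) *\<^sub>R x" by (rule sgn_unitz_def)
  show "uniformity = (INF e\<in>{0<..}. principal {(x, y :: 'a unitz). dist x y < e})"
    by (rule uniformity_unitz_def)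
  show "open U \<longleftrightarrow> (\<forall>x\<in>U. eventually (\<lambda>(x', y). x' = x \<longrightarrow> y \<in> U) uniformity)"
    for U :: "'a unitz set" by (rule open_unitz_def)
  show "norm x = 0 \<longleftrightarrow> x = 0"
  proof
    assume *: "norm x = 0"
    have "cmod (scal_part x) \<le> norm x" "onorm (lmul x) \<le> norm x" by (simp_all add: norm_unitz_def)
    with * have "cmod (scal_part x) = 0" "onorm (lmul x) \<le> 0"
      using norm_ge_zero[of "scal_part x"] by linarith+
    moreover from this have "norm (alg_part x) = 0"
      using norm_alg_part_le[of x] norm_ge_zero[of "alg_part x"] by linarith
    ultimately show "x = 0" by (simp add: unitz_eq_iff)
  next
    assume "x = 0"
    moreover have "lmul 0 = (\<lambda>b. 0 :: 'a)" by (simp add: lmul_def fun_eq_iff)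
    ultimately show "norm x = 0" by (simp add: norm_unitz_def onorm_zero)
  qed
  show "norm (x + y) \<le> norm x + norm y"
    unfolding norm_unitz_def lmul_add
    using onorm_triangle[OF bounded_linear_lmul[of x] bounded_linear_lmul[of y]]
      norm_triangle_ineq[of "scal_part x" "scal_part y"]
    by (simp add: max_def)
  show "norm (r *\<^sub>R x) = \<bar>r\<bar> * norm x"
  proof -
    have "lmul (r *\<^sub>R x) = (\<lambda>b. r *\<^sub>R lmul x b)"
      by (rule ext) (simp add: lmul_def scaleC_scaleR_left scaleR_right_distrib)
    then show ?thesis
      by (simp add: norm_unitz_def onorm_scaleR[OF bounded_linear_lmul] max_mult_distrib_left)
  qed
  show "norm (x * y) \<le> norm x * norm y"
  proof -
    have "onorm (lmul (x * y)) \<le> onorm (lmul x) * onorm (lmul y)"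
      unfolding lmul_mult by (rule onorm_compose[OF bounded_linear_lmul bounded_linear_lmul])
    also have "\<dots> \<le> norm x * norm y"
      by (intro mult_mono) (auto simp: norm_unitz_def onorm_pos_le[OF bounded_linear_lmul] le_max_iff_disj)
    finally have "onorm (lmul (x * y)) \<le> norm x * norm y" .
    moreover have "cmod (scal_part (x * y)) \<le> norm x * norm y"
      unfolding unitz_sel norm_mult by (intro mult_mono) (auto simp: norm_unitz_def le_max_iff_disj)
    ultimately show ?thesis by (simp add: norm_unitz_def[of "x * y"])
  qed
  show "norm (1::'a unitz) = 1"
  proof -
    have "lmul 1 = (\<lambda>b :: 'a. b)" by (simp add: lmul_def fun_eq_iff)
    then show ?thesis using onorm_id_le by (simp add: norm_unitz_def max_def)
  qed
qed

end

lemma onorm_lmul_le: "onorm (lmul x) \<le> norm x"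
  and norm_scal_part_le: "cmod (scal_part x) \<le> norm x"
  by (simp_all add: norm_unitz_def)

lemma norm_unitz_le: "norm (x :: 'a::cstar_algebra unitz) \<le> norm (alg_part x) + cmod (scal_part x)"
proof -
  have "onorm (lmul x) \<le> norm (alg_part x) + cmod (scal_part x)"
  proof (rule onorm_bound)
    fix b
    have "norm (lmul x b) \<le> norm (alg_part x * b) + norm (scaleC (scal_part x) b)"
      unfolding lmul_def by (rule norm_triangle_ineq)
    also have "\<dots> \<le> (norm (alg_part x) + cmod (scal_part x)) * norm b"
      using norm_mult_ineq[of "alg_part x" b] by (simp add: norm_scaleC distrib_right)
    finally show "norm (lmul x b) \<le> (norm (alg_part x) + cmod (scal_part x)) * norm b" .
  qed simp
  then show ?thesis by (simp add: norm_unitz_def)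
qed

instance unitz :: (cstar_algebra) banach
proof
  fix X :: "nat \<Rightarrow> 'a unitz"
  assume X: "Cauchy X"
  have "Cauchy (\<lambda>n. scal_part (X n))"
  proof (rule CauchyI)
    fix e :: real assume "0 < e"
    then obtain N where N: "\<And>m n. m \<ge> N \<Longrightarrow> n \<ge> N \<Longrightarrow> norm (X m - X n) < e"
      using CauchyD[OF X] by blast
    have "norm (scal_part (X m) - scal_part (X n)) < e" if "m \<ge> N" "n \<ge> N" for m n
      using norm_scal_part_le[of "X m - X n"] N[OF that] by simp
    then show "\<exists>N. \<forall>m\<ge>N. \<forall>n\<ge>N. norm (scal_part (X m) - scal_part (X n)) < e" by blast
  qed
  then obtain c where c: "(\<lambda>n. scal_part (X n)) \<longlonglongrightarrow> c"
    using Cauchy_convergent convergent_def by blast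
  have "Cauchy (\<lambda>n. alg_part (X n))"
  proof (rule CauchyI)
    fix e :: real assume "0 < e"
    then obtain N where N: "\<And>m n. m \<ge> N \<Longrightarrow> n \<ge> N \<Longrightarrow> norm (X m - X n) < e / 2"
      using CauchyD[OF X, of "e/2"] by auto
    have "norm (alg_part x) \<le> 2 * norm x" for x :: "'a unitz"
      using norm_alg_part_le[of x] onorm_lmul_le[of x] norm_scal_part_le[of x] by simp
    then have "norm (alg_part (X m) - alg_part (X n)) < e" if "m \<ge> N" "n \<ge> N" for m n
      using N[OF that] by (fastforce simp flip: unitz_sel(7) intro: le_less_trans)
    then show "\<exists>N. \<forall>m\<ge>N. \<forall>n\<ge>N. norm (alg_part (X m) - alg_part (X n)) < e" by blast
  qed
  then obtain a where a: "(\<lambda>n. alg_part (X n)) \<longlonglongrightarrow> a"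
    using Cauchy_convergent convergent_def by blast
  have lim: "(\<lambda>n. norm (alg_part (X n) - a) + norm (scal_part (X n) - c)) \<longlonglongrightarrow> 0 + 0"
    by (intro tendsto_add) (use a c in \<open>simp_all add: LIM_zero_iff tendsto_norm_zero_iff\<close>)
  have "norm (X n - Unitz a c) \<le> norm (alg_part (X n) - a) + norm (scal_part (X n) - c)" for n
    using norm_unitz_le[of "X n - Unitz a c"] by simp
  then have "(\<lambda>n. X n - Unitz a c) \<longlonglongrightarrow> 0"
    by (intro Lim_null_comparison[OF _ lim[simplified]] always_eventually allI)
  then have "X \<longlonglongrightarrow> Unitz a c" by (simp add: LIM_zero_iff)
  then show "convergent X" by (auto simp: convergent_def)
qed

instantiation unitz :: (cstar_algebra) cstar_algebra
begin

definition "scaleC c x = Unitz (scaleC c (alg_part x) :: 'a) (c * scal_part x)"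
definition "star x = Unitz (star (alg_part x) :: 'a) (cnj (scal_part x))"

lemma unitz_star_sel: "alg_part (star x) = star (alg_part x :: 'a)" "scal_part (star x) = cnj (scal_part x)"
  by (simp_all add: star_unitz_def)

text \<open>
  The left multiplication \<open>L\<close> satisfies \<open>\<parallel>L x b\<parallel>\<^sup>2 = \<parallel>b* L (x* x) b\<parallel>\<close>.
\<close>

lemma norm_square_le_star_mult: "(norm x)\<^sup>2 \<le> norm (star x * x :: 'a unitz)"
proof -
  define k where "k = norm (star x * x)"
  have "norm (lmul x b) \<le> sqrt k * norm b" for b
  proof -
    have "(norm (lmul x b))\<^sup>2 = norm (star (lmul x b) * lmul x b)"
      by (simp add: norm_star_mult_self)
    also have "star (lmul x b) * lmul x b = star b * lmul (star x * x) b"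
      unfolding lmul_mult by (simp add: lmul_def unitz_star_sel star_add star_mult star_scaleC algebra_simps
          scaleC_mult_left scaleC_mult_right scaleC_scaleC scaleC_add_right)
    also have "norm \<dots> \<le> norm b * norm (lmul (star x * x) b)"
      using norm_mult_ineq[of "star b" "lmul (star x * x) b"] by simp
    also have "norm (lmul (star x * x) b) \<le> k * norm b"
      using onorm[OF bounded_linear_lmul, of "star x * x" b] onorm_lmul_le[of "star x * x"]
        mult_right_mono[of _ _ "norm b"] unfolding k_def by fastforce
    finally have "(norm (lmul x b))\<^sup>2 \<le> norm b * (k * norm b)" by (simp add: mult_left_mono)
    also have "\<dots> = k * (norm b)\<^sup>2" by (simp add: power2_eq_square)
    finally have "norm (lmul x b) \<le> sqrt (k * (norm b)\<^sup>2)" by (rule real_le_rsqrt)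
    then show ?thesis by (simp add: real_sqrt_mult)
  qed
  then have "onorm (lmul x) \<le> sqrt k" by (rule onorm_bound[rotated]) (simp add: k_def)
  moreover have "cmod (scal_part x) \<le> sqrt k"
    using norm_scal_part_le[of "star x * x"]
    by (intro real_le_rsqrt) (simp add: k_def unitz_star_sel norm_mult power2_eq_square)
  ultimately have "norm x \<le> sqrt k" by (simp add: norm_unitz_def)
  then have "(norm x)\<^sup>2 \<le> (sqrt k)\<^sup>2" by (rule power_mono) simp
  then show ?thesis by (simp add: k_def)
qed

instance
proof
  fix x y :: "'a unitz" and c d :: complex and r :: real
  show "norm (star x * x) = (norm x)\<^sup>2"
  proof (rule antisym[OF _ norm_square_le_star_mult])
    have "norm z \<le> norm (star z)" for z :: "'a unitz"
    proof (cases "z = 0")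
      case False
      have "norm z * norm z \<le> norm (star z) * norm z"
        using norm_square_le_star_mult[of z] norm_mult_ineq[of "star z" z] by (simp add: power2_eq_square)
      then show ?thesis using False by simp
    qed simp
    from this[of "star x"] have "norm (star x) \<le> norm x" by (simp add: star_unitz_def)
    then have "norm (star x) * norm x \<le> norm x * norm x" by (rule mult_right_mono) simp
    then show "norm (star x * x) \<le> (norm x)\<^sup>2"
      using norm_mult_ineq[of "star x" x] by (simp add: power2_eq_square)
  qed
  show "norm (scaleC c x) = cmod c * norm x"
  proof -
    have le: "norm (scaleC c z) \<le> cmod c * norm z" for c and z :: "'a unitz"
    proof -
      have "lmul (scaleC c z) b = scaleC c (lmul z b)" for b
        by (simp add: lmul_def scaleC_unitz_def scaleC_add_right scaleC_scaleC scaleC_mult_left)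
      then have "onorm (lmul (scaleC c z)) \<le> cmod c * onorm (lmul z)"
        by (intro onorm_bound)
          (auto simp: norm_scaleC mult.assoc onorm[OF bounded_linear_lmul] onorm_pos_le[OF bounded_linear_lmul]
            intro!: mult_left_mono)
      also have "\<dots> \<le> cmod c * norm z" by (simp add: onorm_lmul_le mult_left_mono)
      finally have "onorm (lmul (scaleC c z)) \<le> cmod c * norm z" .
      moreover have "cmod (scal_part (scaleC c z)) \<le> cmod c * norm z"
        by (simp add: scaleC_unitz_def norm_mult norm_scal_part_le mult_left_mono)
      ultimately show ?thesis by (simp add: norm_unitz_def[of "scaleC c z"])
    qed
    show ?thesis
    proof (cases "c = 0")
      case True
      then show ?thesis using le[of 0 x] by simp
    next
      case False
      have "scaleC (inverse c) (scaleC c x) = x"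
        using False by (simp add: unitz_eq_iff scaleC_unitz_def scaleC_scaleC)
      then have "norm x \<le> cmod (inverse c) * norm (scaleC c x)"
        using le[of "inverse c" "scaleC c x"] by simp
      then have "cmod c * norm x \<le> norm (scaleC c x)"
        using False by (simp add: norm_divide field_simps)
      then show ?thesis using le[of c x] by simp
    qed
  qed
  show "r *\<^sub>R x = scaleC (complex_of_real r) x"
    by (simp add: unitz_eq_iff scaleC_unitz_def scaleR_eq_scaleC[where ?'a = 'a] scaleR_conv_of_real[where ?'a = complex])
qed (auto simp: unitz_eq_iff unitz_star_sel scaleC_unitz_def scaleC_add_left scaleC_add_right scaleC_scaleC
    scaleC_mult_left scaleC_mult_right star_add star_mult star_scaleC algebra_simps)

end

section \<open>The positive cone of an arbitrary C*-algebra\<close>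

definition incl :: "'a::cstar_algebra \<Rightarrow> 'a unitz" where
  "incl a = Unitz a 0"

lemma incl_sel [simp]: "alg_part (incl a) = a" "scal_part (incl a) = 0"
  by (simp_all add: incl_def)

lemma incl_ops: "incl (a + b) = incl a + incl b" "incl (a - b) = incl a - incl b"
  "incl (r *\<^sub>R a) = r *\<^sub>R incl a" "incl (a * b) = incl a * incl b" "incl (star a) = star (incl a)"
  by (simp_all add: unitz_eq_iff unitz_star_sel)

lemma norm_incl [simp]: "norm (incl a) = norm a"
  using norm_unitz_le[of "incl a"] norm_alg_part_le[of "incl a"] onorm_lmul_le[of "incl a"]
  by simp

lemma tendsto_incl: "(f \<longlongrightarrow> a) F \<Longrightarrow> ((\<lambda>i. incl (f i)) \<longlongrightarrow> incl a) F"
  by (simp add: tendsto_iff dist_norm flip: incl_ops(2))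

text \<open>
  The scalar part is multiplicative, so a square root of an element with scalar part \<open>0\<close> has
  scalar part \<open>0\<close> as well. Hence the positive square root of \<open>incl a\<close> comes from the algebra itself.
\<close>

lemma cstar_positive_incl_iff: "cstar_positive a \<longleftrightarrow> nonneg (incl a)"
proof
  assume "cstar_positive a"
  then obtain b where "a = star b * b" by (auto simp: cstar_positive_def)
  then show "nonneg (incl a)" by (simp add: incl_ops star_mult_self_nonneg)
next
  assume "nonneg (incl a)"
  then obtain y where y: "nonneg y" "y * y = incl a" using nonneg_sqrt by metis
  then have "scal_part y * scal_part y = 0" by (metis unitz_sel(12) incl_sel(2))
  then have yb: "y = incl (alg_part y)" by (simp add: unitz_eq_iff)
  have "incl a = star y * y" by (simp add: y nonneg_star)
  then have "incl a = incl (star (alg_part y) * alg_part y)" by (simp add: incl_ops flip: yb)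
  then have "a = star (alg_part y) * alg_part y" by (metis incl_sel(1))
  then show "cstar_positive a" by (auto simp: cstar_positive_def)
qed

lemma cstar_positive_selfadjoint: "cstar_positive a \<Longrightarrow> star a = a"
  by (auto simp: cstar_positive_def star_mult)

lemma cstar_positive_add: "cstar_positive a \<Longrightarrow> cstar_positive b \<Longrightarrow> cstar_positive (a + b)"
  by (simp add: cstar_positive_incl_iff incl_ops nonneg_add)

lemma cstar_positive_norm_mono: "cstar_positive a \<Longrightarrow> cstar_positive (b - a) \<Longrightarrow> norm a \<le> norm b"
  using nonneg_norm_mono[of "incl a" "incl b"] by (simp add: cstar_positive_incl_iff incl_ops)

lemma cstar_positive_limit:
  assumes "\<And>n. cstar_positive (f n)" "f \<longlonglongrightarrow> a"
  shows "cstar_positive a"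
proof -
  have lim: "(\<lambda>n. incl (f n)) \<longlonglongrightarrow> incl a" by (rule tendsto_incl[OF assms(2)])
  have f: "star (incl (f n)) = incl (f n)" "norm (of_real (norm (incl (f n))) - incl (f n)) \<le> norm (incl (f n))" for n
    using assms(1)[of n] unfolding cstar_positive_incl_iff nonneg_iff_norm by blast+
  have "(\<lambda>n. star (incl (f n))) \<longlonglongrightarrow> star (incl a)"
    by (rule bounded_linear.tendsto[OF bounded_linear_star lim])
  then have "star (incl a) = incl a" using lim LIMSEQ_unique unfolding f(1) by blast
  moreover have "norm (of_real (norm (incl a)) - incl a) \<le> norm (incl a)"
  proof (rule LIMSEQ_le)
    show "(\<lambda>n. norm (of_real (norm (incl (f n))) - incl (f n)))
        \<longlonglongrightarrow> norm (of_real (norm (incl a)) - incl a)"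
      by (intro tendsto_norm tendsto_diff tendsto_of_real lim)
    show "(\<lambda>n. norm (incl (f n))) \<longlonglongrightarrow> norm (incl a)" by (intro tendsto_norm lim)
  qed (use f(2) in blast)
  ultimately show ?thesis by (simp only: cstar_positive_incl_iff nonneg_iff_norm)
qed

text \<open>
  The inequality \<open>a* h a \<le> r a* a\<close> for \<open>0 \<le> h \<le> r\<close>: with \<open>y\<^sup>2 = r - h\<close> the difference is
  \<open>(y a)* (y a)\<close>.
\<close>

lemma cstar_positive_sandwich:
  fixes a h :: "'a::cstar_algebra"
  assumes "cstar_positive h" "norm h \<le> r"
  shows "cstar_positive (r *\<^sub>R (star a * a) - star a * h * a)"
proof -
  have "nonneg (of_real r - incl h)"
    using nonneg_norm_minus[of "incl h" r] assms by (simp add: cstar_positive_incl_iff nonneg_star)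
  then obtain y where y: "nonneg y" "y * y = of_real r - incl h" using nonneg_sqrt by metis
  have "incl (r *\<^sub>R (star a * a) - star a * h * a) = star (incl a) * (of_real r - incl h) * incl a"
    by (simp add: incl_ops algebra_simps of_real_def)
  also have "\<dots> = star (y * incl a) * (y * incl a)"
    by (simp add: star_mult nonneg_star[OF y(1)] mult.assoc flip: y(2))
  finally show ?thesis by (simp add: cstar_positive_incl_iff star_mult_self_nonneg)
qed

section \<open>Algebra-valued semi-inner products\<close>

text \<open>
  Nothing is required of the operations except that the form respects them. The carrier may thus
  consist of formal sums, which do not form a module, as well as of the elements of a Hilbert module.
\<close>

locale semi_inner_product =
  fixes E :: "'e set" and add :: "'e \<Rightarrow> 'e \<Rightarrow> 'e" and smul :: "complex \<Rightarrow> 'e \<Rightarrow> 'e"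
    and act :: "'e \<Rightarrow> 'a::cstar_algebra \<Rightarrow> 'e" and B :: "'e \<Rightarrow> 'e \<Rightarrow> 'a"
  assumes add_in [simp]: "u \<in> E \<Longrightarrow> v \<in> E \<Longrightarrow> add u v \<in> E"
    and smul_in [simp]: "u \<in> E \<Longrightarrow> smul c u \<in> E"
    and act_in [simp]: "u \<in> E \<Longrightarrow> act u a \<in> E"
    and B_add_left: "u \<in> E \<Longrightarrow> v \<in> E \<Longrightarrow> w \<in> E \<Longrightarrow> B (add u v) w = B u w + B v w"
    and B_add_right: "u \<in> E \<Longrightarrow> v \<in> E \<Longrightarrow> w \<in> E \<Longrightarrow> B w (add u v) = B w u + B w v"
    and B_smul_left: "u \<in> E \<Longrightarrow> v \<in> E \<Longrightarrow> B (smul c u) v = scaleC (cnj c) (B u v)"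
    and B_smul_right: "u \<in> E \<Longrightarrow> v \<in> E \<Longrightarrow> B u (smul c v) = scaleC c (B u v)"
    and B_act_left: "u \<in> E \<Longrightarrow> v \<in> E \<Longrightarrow> B (act u a) v = star a * B u v"
    and B_act_right: "u \<in> E \<Longrightarrow> v \<in> E \<Longrightarrow> B u (act v a) = B u v * a"
    and B_positive: "u \<in> E \<Longrightarrow> cstar_positive (B u u)"
begin

text \<open>
  Polarization: \<open>B w w\<close> is self-adjoint for \<open>w = u + v\<close> and for \<open>w = u + \<i> v\<close>.
\<close>

lemma B_hermitian:
  assumes "u \<in> E" "v \<in> E"
  shows "star (B u v) = B v u"
proof -
  have sa: "star (B w w) = B w w" if "w \<in> E" for w
    using B_positive[OF that] by (rule cstar_positive_selfadjoint)
  have 1: "star (B u v) + star (B v u) = B u v + B v u"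
    using sa[of "add u v"] sa[OF assms(1)] sa[OF assms(2)] assms
    by (simp add: B_add_left B_add_right star_add algebra_simps)
  have "scaleC \<i> (star (B v u)) - scaleC \<i> (star (B u v)) = scaleC \<i> (B u v) - scaleC \<i> (B v u)"
    using sa[of "add u (smul \<i> v)"] sa[OF assms(1)] sa[OF assms(2)] assms
    by (simp add: B_add_left B_add_right B_smul_left B_smul_right star_add star_scaleC
        star_diff scaleC_scaleC scaleC_add_right scaleC_diff_right algebra_simps)
  then have "scaleC (-\<i>) (scaleC \<i> (star (B v u) - star (B u v)))
      = scaleC (-\<i>) (scaleC \<i> (B u v - B v u))"
    by (simp add: scaleC_diff_right)
  then have 2: "star (B v u) - star (B u v) = B u v - B v u" by (simp only: scaleC_scaleC) simp
  have "2 *\<^sub>R star (B u v) = (star (B u v) + star (B v u)) - (star (B v u) - star (B u v))"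
    by (simp add: scaleR_2)
  also have "\<dots> = 2 *\<^sub>R B v u" unfolding 1 2 by (simp add: scaleR_2)
  finally show ?thesis by simp
qed

definition seminorm :: "'e \<Rightarrow> real" where "seminorm u = sqrt (norm (B u u))"

lemma seminorm_nonneg [simp]: "seminorm u \<ge> 0" by (simp add: seminorm_def)

lemma seminorm_square: "(seminorm u)\<^sup>2 = norm (B u u)" by (simp add: seminorm_def)

text \<open>
  Evaluate the form at \<open>v - u x / r\<close> for \<open>x = B u v\<close>, and estimate \<open>x* B u u x \<le> r x* x\<close>; what
  remains is \<open>x* x / r \<le> B v v\<close>. The number \<open>r > 0\<close> replaces \<open>norm (B u u)\<close>, which may vanish.
\<close>

lemma Cauchy_Schwarz_aux:
  assumes "u \<in> E" "v \<in> E" "r > 0" "norm (B u u) \<le> r"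
  shows "(norm (B u v))\<^sup>2 \<le> r * norm (B v v)"
proof -
  define x where "x = B u v"
  define a where "a = (- (1/r)) *\<^sub>R x"
  have two_r: "(2/r) *\<^sub>R (star x * x) = (1/r) *\<^sub>R (star x * x) + (1/r) *\<^sub>R (star x * x)"
    by (simp flip: scaleR_add_left)
  have vu: "B v u = star x" using B_hermitian assms by (simp add: x_def)
  have "B (add (act u a) v) (add (act u a) v)
      = star a * B u u * a + (star a * x + star x * a + B v v)"
    using assms(1,2) by (simp add: B_add_left B_add_right B_act_left B_act_right vu
        algebra_simps flip: x_def)
  also have "star a * x + star x * a + B v v = B v v - (2/r) *\<^sub>R (star x * x)"
    by (simp add: a_def star_scaleR two_r)
  finally have 1: "cstar_positive (star a * B u u * a + (B v v - (2/r) *\<^sub>R (star x * x)))"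
    using B_positive[of "add (act u a) v"] assms(1,2) by simp
  have 2: "cstar_positive (r *\<^sub>R (star a * a) - star a * B u u * a)"
    using B_positive[OF assms(1)] assms(4) by (rule cstar_positive_sandwich)
  have "r *\<^sub>R (star a * a) = (1/r) *\<^sub>R (star x * x)"
    using assms(3) by (simp add: a_def star_scaleR)
  then have sum: "(star a * B u u * a + (B v v - (2/r) *\<^sub>R (star x * x)))
      + (r *\<^sub>R (star a * a) - star a * B u u * a) = B v v - (1/r) *\<^sub>R (star x * x)"
    by (simp add: two_r)
  then have 3: "cstar_positive (B v v - (1/r) *\<^sub>R (star x * x))"
    using cstar_positive_add[OF 1 2] by (simp only: sum)
  define s where "s = sqrt (1/r)"
  have "(1/r) *\<^sub>R (star x * x) = star (s *\<^sub>R x) * (s *\<^sub>R x)"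
    using assms(3) by (simp add: s_def star_scaleR)
  then have "cstar_positive ((1/r) *\<^sub>R (star x * x))" unfolding cstar_positive_def by blast
  then have "norm ((1/r) *\<^sub>R (star x * x)) \<le> norm (B v v)"
    using 3 by (rule cstar_positive_norm_mono)
  then show ?thesis using assms(3) by (simp add: norm_star_mult_self x_def field_simps)
qed

lemma norm_B_le:
  assumes "u \<in> E" "v \<in> E"
  shows "norm (B u v) \<le> seminorm u * seminorm v"
proof -
  have "(norm (B u v))\<^sup>2 \<le> norm (B u u) * norm (B v v)"
  proof (rule LIMSEQ_le_const)
    have "(\<lambda>n. (norm (B u u) + inverse (real (Suc n))) * norm (B v v))
        \<longlonglongrightarrow> (norm (B u u) + 0) * norm (B v v)"
      by (intro tendsto_intros LIMSEQ_inverse_real_of_nat)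
    then show "(\<lambda>n. (norm (B u u) + inverse (real (Suc n))) * norm (B v v))
        \<longlonglongrightarrow> norm (B u u) * norm (B v v)" by simp
    show "\<exists>N. \<forall>n\<ge>N. (norm (B u v))\<^sup>2 \<le> (norm (B u u) + inverse (real (Suc n))) * norm (B v v)"
      using assms by (auto intro!: Cauchy_Schwarz_aux add_nonneg_pos simp del: of_nat_Suc)
  qed
  then have "norm (B u v) \<le> sqrt (norm (B u u) * norm (B v v))" by (rule real_le_rsqrt)
  then show ?thesis by (simp add: seminorm_def real_sqrt_mult)
qed

lemma seminorm_add: "u \<in> E \<Longrightarrow> v \<in> E \<Longrightarrow> seminorm (add u v) \<le> seminorm u + seminorm v"
proof -
  assume uv: "u \<in> E" "v \<in> E"
  have "(seminorm (add u v))\<^sup>2 = norm ((B u u + B u v) + (B v u + B v v))"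
    using uv by (simp add: seminorm_square B_add_left B_add_right algebra_simps)
  also have "\<dots> \<le> (norm (B u u) + norm (B u v)) + (norm (B v u) + norm (B v v))"
    by (intro norm_triangle_mono norm_triangle_ineq)
  also have "\<dots> \<le> (seminorm u * seminorm u + seminorm u * seminorm v) + (seminorm v * seminorm u + seminorm v * seminorm v)"
    by (intro add_mono norm_B_le uv)
  also have "\<dots> = (seminorm u + seminorm v)\<^sup>2" by (simp add: power2_eq_square algebra_simps)
  finally show ?thesis by (rule power2_le_imp_le) simp
qed

lemma seminorm_smul: "u \<in> E \<Longrightarrow> seminorm (smul c u) = cmod c * seminorm u"
  by (simp add: seminorm_def B_smul_left B_smul_right scaleC_scaleC norm_scaleC norm_mult real_sqrt_mult)

lemma seminorm_act: "u \<in> E \<Longrightarrow> seminorm (act u a) \<le> seminorm u * norm a"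
proof -
  assume u: "u \<in> E"
  have "(seminorm (act u a))\<^sup>2 = norm (star a * (B u u * a))"
    using u by (simp add: seminorm_square B_act_left B_act_right mult.assoc)
  also have "\<dots> \<le> norm a * (norm (B u u) * norm a)"
    using norm_mult_ineq[of "star a" "B u u * a"] mult_left_mono[OF norm_mult_ineq[of "B u u" a], of "norm a"]
    by simp
  also have "\<dots> = (seminorm u * norm a)\<^sup>2" by (simp add: power_mult_distrib seminorm_square power2_eq_square[of "norm a"])
  finally show ?thesis by (rule power2_le_imp_le) simp
qed

text \<open>
  This takes the place of the module axioms: vectors that the form cannot distinguish have the same
  seminorm.
\<close>

lemma seminorm_cong:
  assumes "u \<in> E" "v \<in> E" "\<And>w. w \<in> E \<Longrightarrow> B u w = B v w"
  shows "seminorm u = seminorm v"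
proof -
  have "B u u = B v u" by (rule assms(3)[OF assms(1)])
  also have "\<dots> = star (B u v)" using B_hermitian assms(1,2) by simp
  also have "\<dots> = B v v" using assms(3)[OF assms(2)] B_hermitian[OF assms(2) assms(2)] by simp
  finally show ?thesis by (simp add: seminorm_def)
qed

definition diff :: "'e \<Rightarrow> 'e \<Rightarrow> 'e" where "diff u v = add u (smul (-1) v)"

lemma diff_in [simp]: "u \<in> E \<Longrightarrow> v \<in> E \<Longrightarrow> diff u v \<in> E"
  by (simp add: diff_def)

lemma B_diff_left: "u \<in> E \<Longrightarrow> v \<in> E \<Longrightarrow> w \<in> E \<Longrightarrow> B (diff u v) w = B u w - B v w"
  and B_diff_right: "u \<in> E \<Longrightarrow> v \<in> E \<Longrightarrow> w \<in> E \<Longrightarrow> B w (diff u v) = B w u - B w v"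
  by (simp_all add: diff_def B_add_left B_add_right B_smul_left B_smul_right)

lemma seminorm_diff_commute: "u \<in> E \<Longrightarrow> v \<in> E \<Longrightarrow> seminorm (diff u v) = seminorm (diff v u)"
proof -
  assume uv: "u \<in> E" "v \<in> E"
  have "seminorm (diff u v) = seminorm (smul (-1) (diff v u))"
    by (rule seminorm_cong) (use uv in \<open>simp_all add: B_diff_left B_smul_left\<close>)
  then show ?thesis using uv by (simp add: seminorm_smul)
qed

lemma seminorm_diff_triangle:
  assumes "u \<in> E" "v \<in> E" "w \<in> E"
  shows "seminorm (diff u w) \<le> seminorm (diff u v) + seminorm (diff v w)"
proof -
  have "seminorm (diff u w) = seminorm (add (diff u v) (diff v w))"
    by (rule seminorm_cong) (use assms in \<open>simp_all add: B_diff_left B_add_left\<close>)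
  then show ?thesis using seminorm_add assms by simp
qed

lemma seminorm_diff_abs:
  assumes "u \<in> E" "v \<in> E"
  shows "\<bar>seminorm u - seminorm v\<bar> \<le> seminorm (diff u v)"
proof -
  have *: "seminorm u \<le> seminorm v + seminorm (diff u v)" if "u \<in> E" "v \<in> E" for u v
  proof -
    have "seminorm u = seminorm (add v (diff u v))"
      by (rule seminorm_cong) (use that in \<open>simp_all add: B_diff_left B_add_left\<close>)
    then show ?thesis using seminorm_add that by simp
  qed
  from *[OF assms] *[OF assms(2,1)] seminorm_diff_commute[OF assms] show ?thesis by linarith
qed

definition cauchy :: "(nat \<Rightarrow> 'e) \<Rightarrow> bool" where
  "cauchy s \<longleftrightarrow> (\<forall>n. s n \<in> E) \<and> (\<forall>e>0. \<exists>N. \<forall>m\<ge>N. \<forall>n\<ge>N. seminorm (diff (s m) (s n)) < e)"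

lemma cauchy_in: "cauchy s \<Longrightarrow> s n \<in> E" by (simp add: cauchy_def)

lemma cauchyI:
  assumes "\<And>n. s n \<in> E" "\<And>e. e > 0 \<Longrightarrow> \<exists>N. \<forall>m\<ge>N. \<forall>n\<ge>N. seminorm (diff (s m) (s n)) < e"
  shows "cauchy s"
  using assms by (auto simp: cauchy_def)

lemma cauchyD:
  assumes "cauchy s" "e > 0"
  obtains N where "\<And>m n. m \<ge> N \<Longrightarrow> n \<ge> N \<Longrightarrow> seminorm (diff (s m) (s n)) < e"
  using assms unfolding cauchy_def by meson

lemma cauchy_bounded:
  assumes "cauchy s"
  obtains C where "C > 0" "\<And>n. seminorm (s n) \<le> C"
proof -
  have "Cauchy (\<lambda>n. seminorm (s n))"
  proof (rule CauchyI)
    fix e :: real assume "e > 0"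
    then obtain N where N: "\<And>m n. m \<ge> N \<Longrightarrow> n \<ge> N \<Longrightarrow> seminorm (diff (s m) (s n)) < e"
      using cauchyD[OF assms] by blast
    have "norm (seminorm (s m) - seminorm (s n)) < e" if "m \<ge> N" "n \<ge> N" for m n
      using seminorm_diff_abs[of "s m" "s n"] N[OF that] cauchy_in[OF assms] by simp
    then show "\<exists>N. \<forall>m\<ge>N. \<forall>n\<ge>N. norm (seminorm (s m) - seminorm (s n)) < e" by blast
  qed
  then have "Bseq (\<lambda>n. seminorm (s n))" by (rule Cauchy_Bseq)
  then obtain C where "C > 0" "\<And>n. norm (seminorm (s n)) \<le> C" by (auto simp: Bseq_def)
  then show ?thesis using that[of C] by auto
qed

lemma cauchy_by_dominated:
  assumes "cauchy s" "\<And>n. t n \<in> E" "C \<ge> 0"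
    and "\<And>m n. seminorm (diff (t m) (t n)) \<le> C * seminorm (diff (s m) (s n))"
  shows "cauchy t"
proof (rule cauchyI[OF assms(2)])
  fix e :: real assume e: "e > 0"
  then have "e / (C + 1) > 0" using assms(3) by simp
  then obtain N where N: "\<And>m n. m \<ge> N \<Longrightarrow> n \<ge> N \<Longrightarrow> seminorm (diff (s m) (s n)) < e / (C + 1)"
    using cauchyD[OF assms(1)] by blast
  have "seminorm (diff (t m) (t n)) < e" if "m \<ge> N" "n \<ge> N" for m n
  proof -
    have "seminorm (diff (t m) (t n)) \<le> (C + 1) * seminorm (diff (s m) (s n))"
      using assms(4)[of m n] seminorm_nonneg[of "diff (s m) (s n)"] unfolding distrib_right by linarith
    also have "\<dots> < (C + 1) * (e / (C + 1))"
      using N[OF that] assms(3) by (intro mult_strict_left_mono) auto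
    finally show ?thesis using assms(3) by simp
  qed
  then show "\<exists>N. \<forall>m\<ge>N. \<forall>n\<ge>N. seminorm (diff (t m) (t n)) < e" by blast
qed

lemma cauchy_smul:
  assumes "cauchy s" shows "cauchy (\<lambda>n. smul c (s n))"
proof (rule cauchy_by_dominated[OF assms])
  fix m n
  have "seminorm (diff (smul c (s m)) (smul c (s n))) = seminorm (smul c (diff (s m) (s n)))"
    by (rule seminorm_cong) (use cauchy_in[OF assms] in \<open>simp_all add: B_diff_left B_smul_left scaleC_diff_right\<close>)
  then show "seminorm (diff (smul c (s m)) (smul c (s n))) \<le> cmod c * seminorm (diff (s m) (s n))"
    using cauchy_in[OF assms] by (simp add: seminorm_smul)
qed (use cauchy_in[OF assms] in simp_all)

lemma cauchy_act:
  assumes "cauchy s" shows "cauchy (\<lambda>n. act (s n) a)"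
proof (rule cauchy_by_dominated[OF assms])
  fix m n
  have "seminorm (diff (act (s m) a) (act (s n) a)) = seminorm (act (diff (s m) (s n)) a)"
    by (rule seminorm_cong) (use cauchy_in[OF assms] in \<open>simp_all add: B_diff_left B_act_left algebra_simps\<close>)
  then show "seminorm (diff (act (s m) a) (act (s n) a)) \<le> norm a * seminorm (diff (s m) (s n))"
    using seminorm_act[of "diff (s m) (s n)" a] cauchy_in[OF assms] by (simp add: mult.commute)
qed (use cauchy_in[OF assms] in simp_all)

lemma cauchy_add:
  assumes s: "cauchy s" and t: "cauchy t" shows "cauchy (\<lambda>n. add (s n) (t n))"
proof (rule cauchyI)
  fix e :: real assume "e > 0"
  then have e2: "e / 2 > 0" by simp
  obtain N1 where N1: "\<And>m n. m \<ge> N1 \<Longrightarrow> n \<ge> N1 \<Longrightarrow> seminorm (diff (s m) (s n)) < e / 2"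
    using cauchyD[OF s e2] by blast
  obtain N2 where N2: "\<And>m n. m \<ge> N2 \<Longrightarrow> n \<ge> N2 \<Longrightarrow> seminorm (diff (t m) (t n)) < e / 2"
    using cauchyD[OF t e2] by blast
  note [simp] = cauchy_in[OF s] cauchy_in[OF t]
  have "seminorm (diff (add (s m) (t m)) (add (s n) (t n))) < e" if "m \<ge> max N1 N2" "n \<ge> max N1 N2" for m n
  proof -
    have "seminorm (diff (add (s m) (t m)) (add (s n) (t n))) = seminorm (add (diff (s m) (s n)) (diff (t m) (t n)))"
      by (rule seminorm_cong) (simp_all add: B_diff_left B_add_left)
    also have "\<dots> \<le> seminorm (diff (s m) (s n)) + seminorm (diff (t m) (t n))" by (rule seminorm_add) simp_all
    finally show ?thesis using N1[of m n] N2[of m n] that by simp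
  qed
  then show "\<exists>N. \<forall>m\<ge>N. \<forall>n\<ge>N. seminorm (diff (add (s m) (t m)) (add (s n) (t n))) < e" by blast
qed (simp add: cauchy_in[OF s] cauchy_in[OF t])

lemma cauchy_diff: "cauchy s \<Longrightarrow> cauchy t \<Longrightarrow> cauchy (\<lambda>n. diff (s n) (t n))"
  unfolding diff_def by (intro cauchy_add cauchy_smul)

lemma cauchy_const: "u \<in> E \<Longrightarrow> cauchy (\<lambda>_. u)"
proof (rule cauchyI)
  fix e :: real assume "u \<in> E" "e > 0"
  then have "seminorm (diff u u) = 0" by (simp add: seminorm_def B_diff_left)
  with \<open>e > 0\<close> show "\<exists>N. \<forall>m\<ge>N. \<forall>n\<ge>N. seminorm (diff u u) < e" by simp
qed

lemma norm_B_diff_le: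
  assumes "u \<in> E" "u' \<in> E" "v \<in> E" "v' \<in> E"
  shows "norm (B u v - B u' v') \<le> seminorm (diff u u') * seminorm v + seminorm u' * seminorm (diff v v')"
proof -
  have "B u v - B u' v' = B (diff u u') v + B u' (diff v v')"
    using assms by (simp add: B_diff_left B_diff_right)
  then show ?thesis
    using norm_triangle_mono[OF norm_B_le[of "diff u u'" v] norm_B_le[of u' "diff v v'"]] assms by simp
qed

lemma convergent_B:
  assumes s: "cauchy s" and t: "cauchy t" shows "convergent (\<lambda>n. B (s n) (t n))"
proof -
  obtain C where C: "C > 0" "\<And>n. seminorm (s n) \<le> C" using cauchy_bounded[OF s] by blast
  obtain D where D: "D > 0" "\<And>n. seminorm (t n) \<le> D" using cauchy_bounded[OF t] by blast
  have "Cauchy (\<lambda>n. B (s n) (t n))"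
  proof (rule CauchyI)
    fix e :: real assume e: "e > 0"
    obtain N1 where N1: "\<And>m n. m \<ge> N1 \<Longrightarrow> n \<ge> N1 \<Longrightarrow> seminorm (diff (s m) (s n)) < e / (2 * D)"
      using cauchyD[OF s, of "e / (2 * D)"] e D(1) by auto
    obtain N2 where N2: "\<And>m n. m \<ge> N2 \<Longrightarrow> n \<ge> N2 \<Longrightarrow> seminorm (diff (t m) (t n)) < e / (2 * C)"
      using cauchyD[OF t, of "e / (2 * C)"] e C(1) by auto
    have "norm (B (s m) (t m) - B (s n) (t n)) < e" if mn: "m \<ge> max N1 N2" "n \<ge> max N1 N2" for m n
    proof -
      have "norm (B (s m) (t m) - B (s n) (t n))
          \<le> seminorm (diff (s m) (s n)) * seminorm (t m) + seminorm (s n) * seminorm (diff (t m) (t n))"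
        by (rule norm_B_diff_le) (simp_all add: cauchy_in[OF s] cauchy_in[OF t])
      also have "\<dots> \<le> seminorm (diff (s m) (s n)) * D + C * seminorm (diff (t m) (t n))"
        by (intro add_mono mult_mono C D) (use C(1) in simp_all)
      also have "\<dots> < e / (2 * D) * D + C * (e / (2 * C))"
        using N1[of m n] N2[of m n] mn C(1) D(1)
        by (intro add_strict_mono mult_strict_right_mono mult_strict_left_mono) auto
      also have "\<dots> = e" using C(1) D(1) by simp
      finally show ?thesis .
    qed
    then show "\<exists>N. \<forall>m\<ge>N. \<forall>n\<ge>N. norm (B (s m) (t m) - B (s n) (t n)) < e" by blast
  qed
  then show ?thesis by (rule Cauchy_convergent)
qed

text \<open>
  The estimate \<open>\<parallel>B (s n) (s n)\<parallel> \<le> \<parallel>B (s n) (s m)\<parallel> + \<parallel>s n\<parallel> \<parallel>s n - s m\<parallel>\<close>, in which \<open>m\<close> tends to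
  infinity for fixed \<open>n\<close>. This is what allows elements of a completion to be identified with
  their inner products against a fixed family of vectors.
\<close>

lemma weakly_null_imp_null:
  assumes s: "cauchy s" and weak: "\<And>u. u \<in> E \<Longrightarrow> (\<lambda>n. B u (s n)) \<longlonglongrightarrow> 0"
  shows "(\<lambda>n. seminorm (s n)) \<longlonglongrightarrow> 0"
proof -
  obtain C where C: "C > 0" "\<And>n. seminorm (s n) \<le> C" using cauchy_bounded[OF s] by blast
  have "(\<lambda>n. B (s n) (s n)) \<longlonglongrightarrow> 0"
  proof (rule LIMSEQ_I)
    fix e :: real assume e: "e > 0"
    obtain N where N: "\<And>m n. m \<ge> N \<Longrightarrow> n \<ge> N \<Longrightarrow> seminorm (diff (s m) (s n)) < e / (2 * C)"
      using cauchyD[OF s, of "e / (2 * C)"] e C(1) by auto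
    have "norm (B (s n) (s n)) \<le> e / 2" if n: "n \<ge> N" for n
    proof (rule LIMSEQ_le_const[of "\<lambda>m. norm (B (s n) (s m)) + e / 2"])
      have "(\<lambda>m. norm (B (s n) (s m)) + e / 2) \<longlonglongrightarrow> norm (0::'a) + e / 2"
        by (intro tendsto_intros weak cauchy_in[OF s])
      then show "(\<lambda>m. norm (B (s n) (s m)) + e / 2) \<longlonglongrightarrow> e / 2" by simp
      have "norm (B (s n) (s n)) \<le> norm (B (s n) (s m)) + e / 2" if m: "m \<ge> N" for m
      proof -
        have "B (s n) (s n) = B (s n) (s m) + B (s n) (diff (s n) (s m))"
          by (simp add: B_diff_right cauchy_in[OF s])
        then have "norm (B (s n) (s n)) \<le> norm (B (s n) (s m)) + norm (B (s n) (diff (s n) (s m)))"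
          by (metis norm_triangle_ineq)
        also have "norm (B (s n) (diff (s n) (s m))) \<le> seminorm (s n) * seminorm (diff (s n) (s m))"
          by (rule norm_B_le) (simp_all add: cauchy_in[OF s])
        also have "\<dots> \<le> C * (e / (2 * C))"
          by (intro mult_mono C less_imp_le[OF N[OF n m]]) (use C(1) in simp_all)
        also have "\<dots> = e / 2" using C(1) by simp
        finally show ?thesis by simp
      qed
      then show "\<exists>M. \<forall>m\<ge>M. norm (B (s n) (s n)) \<le> norm (B (s n) (s m)) + e / 2" by blast
    qed
    then show "\<exists>N. \<forall>n\<ge>N. norm (B (s n) (s n) - 0) < e"
      using e by (intro exI[of _ N]) force
  qed
  then have "(\<lambda>n. sqrt (norm (B (s n) (s n)))) \<longlonglongrightarrow> sqrt (norm (0::'a))"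
    by (intro tendsto_intros)
  then show ?thesis by (simp add: seminorm_def)
qed

lemma B_limit_cong:
  assumes s: "cauchy s" "cauchy s'" "(\<lambda>n. seminorm (diff (s n) (s' n))) \<longlonglongrightarrow> 0"
    and t: "cauchy t" "cauchy t'" "(\<lambda>n. seminorm (diff (t n) (t' n))) \<longlonglongrightarrow> 0"
    and lim: "(\<lambda>n. B (s' n) (t' n)) \<longlonglongrightarrow> l"
  shows "(\<lambda>n. B (s n) (t n)) \<longlonglongrightarrow> l"
proof -
  obtain C where C: "C > 0" "\<And>n. seminorm (s' n) \<le> C" using cauchy_bounded[OF s(2)] by blast
  obtain D where D: "D > 0" "\<And>n. seminorm (t n) \<le> D" using cauchy_bounded[OF t(1)] by blast
  have "norm (B (s n) (t n) - B (s' n) (t' n)) \<le> seminorm (diff (s n) (s' n)) * D + C * seminorm (diff (t n) (t' n))" for n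
  proof -
    have "norm (B (s n) (t n) - B (s' n) (t' n))
        \<le> seminorm (diff (s n) (s' n)) * seminorm (t n) + seminorm (s' n) * seminorm (diff (t n) (t' n))"
      by (rule norm_B_diff_le) (use s t in \<open>simp_all add: cauchy_in\<close>)
    also have "\<dots> \<le> seminorm (diff (s n) (s' n)) * D + C * seminorm (diff (t n) (t' n))"
      by (intro add_mono mult_mono C D) (use C(1) in simp_all)
    finally show ?thesis .
  qed
  moreover have "(\<lambda>n. seminorm (diff (s n) (s' n)) * D + C * seminorm (diff (t n) (t' n))) \<longlonglongrightarrow> 0 * D + C * 0"
    by (intro tendsto_intros s t)
  ultimately have "(\<lambda>n. B (s n) (t n) - B (s' n) (t' n)) \<longlonglongrightarrow> 0"
    using Lim_null_comparison[OF always_eventually[OF allI]] by force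
  then have "(\<lambda>n. (B (s n) (t n) - B (s' n) (t' n)) + B (s' n) (t' n)) \<longlonglongrightarrow> 0 + l"
    by (intro tendsto_add lim)
  then show ?thesis by simp
qed

end

section \<open>The metric of a pre-Hilbert module\<close>

text \<open>
  Completeness is a property of the metric, so the metric axioms are derived without it.
\<close>

locale pre_hilbert_module = cstar_module M
  for M :: "('a::cstar_algebra, 'v, 'more) hmodule_scheme" (structure) +
  assumes inner_sesquilinear: "inner_prod M \<in> sesquilinear_forms M"
    and inner_positive: "v \<in> carrier M \<Longrightarrow> cstar_positive (inner_prod M v v)"
    and inner_definite: "v \<in> carrier M \<Longrightarrow> inner_prod M v v = 0 \<Longrightarrow> v = \<zero>"

lemma complex_ring_sel [simp]: "carrier complex_ring = UNIV" "\<one>\<^bsub>complex_ring\<^esub> = 1" "\<zero>\<^bsub>complex_ring\<^esub> = 0"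
  "x \<oplus>\<^bsub>complex_ring\<^esub> y = x + y" "x \<otimes>\<^bsub>complex_ring\<^esub> y = x * y"
  by (simp_all add: complex_ring_def)

lemma cring_complex_ring: "cring complex_ring"
proof (rule cringI)
  show "abelian_group complex_ring"
    by (rule abelian_groupI) (auto simp: algebra_simps intro!: exI[of _ "- _"] add.left_inverse)
  show "Group.comm_monoid complex_ring"
    by (rule comm_monoidI) (auto simp: algebra_simps)
qed (auto simp: algebra_simps)

context cstar_module
begin

lemma minus_eq_zero_iff: "v \<in> carrier V \<Longrightarrow> w \<in> carrier V \<Longrightarrow> v \<ominus> w = \<zero> \<longleftrightarrow> v = w"
proof
  assume vw: "v \<in> carrier V" "w \<in> carrier V" "v \<ominus> w = \<zero>"
  have "v = (v \<ominus> w) \<oplus> w" using vw(1,2) by (simp add: M.minus_eq M.a_assoc M.l_neg)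
  then show "v = w" using vw by simp
qed (simp add: M.minus_eq M.r_neg)

lemma smult_minus_one: "v \<in> carrier V \<Longrightarrow> (-1) \<odot> v = \<ominus> v"
proof -
  assume v: "v \<in> carrier V"
  have "(-1) \<odot> v \<oplus> v = ((-1) \<oplus>\<^bsub>complex_ring\<^esub> 1) \<odot> v"
    using smult_l_distr[of "-1" 1 v] smult_one[OF v] v by simp
  also have "\<dots> = \<zero>" using smult_l_null[OF v] by simp
  finally show ?thesis using v by (simp add: M.minus_equality)
qed

end

context pre_hilbert_module
begin

sublocale semi_inner_product "carrier M" "add M" "smult M" "ract M" "inner_prod M"
  using inner_sesquilinear inner_positive
  by unfold_locales (auto simp: sesquilinear_forms_def ract_closed)

lemma hnorm_eq_seminorm: "hnorm M v = seminorm v"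
  by (simp add: hnorm_def seminorm_def)

lemma diff_eq_minus: "v \<in> carrier M \<Longrightarrow> w \<in> carrier M \<Longrightarrow> diff v w = v \<ominus> w"
  by (simp add: diff_def a_minus_def smult_minus_one)

lemma hdist_eq: "v \<in> carrier M \<Longrightarrow> w \<in> carrier M \<Longrightarrow> hdist M v w = seminorm (diff v w)"
  by (simp add: hdist_def hnorm_eq_seminorm diff_eq_minus)

lemma seminorm_eq_0_iff: "v \<in> carrier M \<Longrightarrow> seminorm v = 0 \<longleftrightarrow> v = \<zero>"
proof
  assume v: "v \<in> carrier M" "v = \<zero>"
  have "\<zero> = 0 \<odot> \<zero>" by simp
  then have "seminorm \<zero> = 0" using seminorm_smul[of \<zero> 0] by simp
  then show "seminorm v = 0" using v by simp
qed (simp add: seminorm_def inner_definite)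

lemma metric_space: "Metric_space (carrier M) (hdist M)"
proof
  fix x y z
  show "0 \<le> hdist M x y" by (simp add: hdist_def hnorm_eq_seminorm)
  show "hdist M x y = hdist M y x"
    by (cases "x \<in> carrier M \<and> y \<in> carrier M") (auto simp: hdist_eq seminorm_diff_commute, auto simp: hdist_def)
  assume xy: "x \<in> carrier M" "y \<in> carrier M"
  then show "hdist M x y = 0 \<longleftrightarrow> x = y"
    by (simp add: hdist_eq seminorm_eq_0_iff diff_eq_minus minus_eq_zero_iff)
  assume "z \<in> carrier M"
  then show "hdist M x z \<le> hdist M x y + hdist M y z"
    using xy by (simp add: hdist_eq seminorm_diff_triangle)
qed

lemma inner_zero [simp]:
  assumes "m \<in> carrier M"
  shows "inner_prod M \<zero> m = 0" "inner_prod M m \<zero> = 0"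
proof -
  have "\<zero> = 0 \<odot> \<zero>" by simp
  then show "inner_prod M \<zero> m = 0" "inner_prod M m \<zero> = 0"
    using B_smul_left[of \<zero> m 0] B_smul_right[of m \<zero> 0] assms by simp_all
qed

lemma inner_eq_imp_eq:
  assumes "m \<in> carrier M" "n \<in> carrier M" "\<And>w. w \<in> carrier M \<Longrightarrow> inner_prod M w m = inner_prod M w n"
  shows "m = n"
proof -
  have "inner_prod M (diff m n) (diff m n) = 0"
    using assms by (simp add: B_diff_right)
  then have "seminorm (diff m n) = 0" by (simp add: seminorm_def)
  then show ?thesis using assms(1,2) by (simp add: seminorm_eq_0_iff diff_eq_minus minus_eq_zero_iff)
qed

end

lemma hilbert_module_iff:
  "hilbert_module M \<longleftrightarrow> pre_hilbert_module M \<and> Metric_space.mcomplete (carrier M) (hdist M)"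
  by (auto simp: hilbert_module_def pre_hilbert_module_def hilbert_module_axioms_def
      pre_hilbert_module_axioms_def)

lemma Lin_closed: "f \<in> Lin V W \<Longrightarrow> v \<in> carrier V \<Longrightarrow> f v \<in> carrier W"
  by (auto simp: Lin_def)

section \<open>The Kolmogorov decomposition of a positive kernel\<close>

text \<open>
  A list of pairs \<open>(x, v)\<close> stands for the formal sum of the vectors \<open>R x v\<close> that are to be constructed,
  and the kernel prescribes the inner products of such sums.
\<close>

locale positive_kernel = cstar_module V
  for V :: "('a::cstar_algebra, 'v, 'more) amodule_scheme" (structure) +
  fixes X :: "'x set" and K :: "'x \<Rightarrow> 'x \<Rightarrow> 'v \<Rightarrow> 'v \<Rightarrow> 'a"
  assumes K_sesquilinear: "x \<in> X \<Longrightarrow> y \<in> X \<Longrightarrow> K x y \<in> sesquilinear_forms V"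
    and K_positive: "(\<And>j. j < (n::nat) \<Longrightarrow> xs j \<in> X \<and> vs j \<in> carrier V) \<Longrightarrow>
      cstar_positive (\<Sum>j<n. \<Sum>k<n. K (xs j) (xs k) (vs j) (vs k))"
begin

definition combs :: "('x \<times> 'v) list set" where "combs = lists (X \<times> carrier V)"

definition form :: "('x \<times> 'v) list \<Rightarrow> ('x \<times> 'v) list \<Rightarrow> 'a" where
  "form L N = (\<Sum>(x, v)\<leftarrow>L. \<Sum>(y, w)\<leftarrow>N. K x y v w)"

definition smul_comb :: "complex \<Rightarrow> ('x \<times> 'v) list \<Rightarrow> ('x \<times> 'v) list" where
  "smul_comb c = map (\<lambda>(x, v). (x, c \<odot> v))"

definition act_comb :: "('x \<times> 'v) list \<Rightarrow> 'a \<Rightarrow> ('x \<times> 'v) list" where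
  "act_comb L a = map (\<lambda>(x, v). (x, v \<cdot> a)) L"

lemma combs_Nil [simp]: "[] \<in> combs" by (simp add: combs_def)

lemma combs_Cons [simp]: "(x, v) # L \<in> combs \<longleftrightarrow> x \<in> X \<and> v \<in> carrier V \<and> L \<in> combs"
  by (auto simp: combs_def)

lemma form_Nil [simp]: "form [] N = 0" "form L [] = 0"
  by (simp_all add: form_def case_prod_unfold)

lemma form_Cons_left: "form (p # L) N = form [p] N + form L N"
  by (simp add: form_def)

lemma form_append_left: "form (L @ L') N = form L N + form L' N"
  by (simp add: form_def)

lemma form_append_right: "form L (N @ N') = form L N + form L N'"
  by (simp add: form_def case_prod_unfold sum_list_addf)

lemma form_Cons_right: "form L (p # N) = form L [p] + form L N"
  using form_append_right[of L "[p]" N] by simp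

lemma form_single [simp]: "form [(x, v)] [(y, w)] = K x y v w"
  by (simp add: form_def)

lemma combs_induct [consumes 1, case_names Nil Cons]:
  assumes "L \<in> combs" "P []"
    "\<And>x v L. x \<in> X \<Longrightarrow> v \<in> carrier V \<Longrightarrow> L \<in> combs \<Longrightarrow> P L \<Longrightarrow> P ((x, v) # L)"
  shows "P L"
  using assms(1)
proof (induction L)
  case (Cons p L)
  then show ?case using assms(3) by (cases p) auto
qed (rule assms(2))

lemma K_smul:
  assumes "x \<in> X" "y \<in> X" "v \<in> carrier V" "w \<in> carrier V"
  shows "K x y v (c \<odot> w) = scaleC c (K x y v w)" "K x y (c \<odot> v) w = scaleC (cnj c) (K x y v w)"
    "K x y v (w \<cdot> a) = K x y v w * a" "K x y (v \<cdot> a) w = star a * K x y v w"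
  using K_sesquilinear[OF assms(1,2)] assms(3,4) by (auto simp: sesquilinear_forms_def)

lemma form_ops_single_right:
  assumes "L \<in> combs" "y \<in> X" "w \<in> carrier V"
  shows "form L [(y, c \<odot> w)] = scaleC c (form L [(y, w)])" "form L [(y, w \<cdot> a)] = form L [(y, w)] * a"
  using assms(1)
proof (induction L rule: combs_induct)
  case (Cons x v L)
  { case 1 show ?case
      using Cons assms by (subst (1 2) form_Cons_left) (simp add: K_smul scaleC_add_right) }
  { case 2 show ?case
      using Cons assms by (subst (1 2) form_Cons_left) (simp add: K_smul distrib_right) }
qed simp_all

lemma form_ops_single_left:
  assumes "L \<in> combs" "y \<in> X" "w \<in> carrier V"
  shows "form [(y, c \<odot> w)] L = scaleC (cnj c) (form [(y, w)] L)" "form [(y, w \<cdot> a)] L = star a * form [(y, w)] L"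
  using assms(1)
proof (induction L rule: combs_induct)
  case (Cons x v L)
  { case 1 show ?case
      using Cons assms by (subst (1 2) form_Cons_right) (simp add: K_smul scaleC_add_right) }
  { case 2 show ?case
      using Cons assms by (subst (1 2) form_Cons_right) (simp add: K_smul distrib_left) }
qed simp_all

lemma smul_comb_simps [simp]:
  "smul_comb c [] = []" "smul_comb c ((x, v) # L) = (x, c \<odot> v) # smul_comb c L"
  by (simp_all add: smul_comb_def)

lemma act_comb_simps [simp]:
  "act_comb [] a = []" "act_comb ((x, v) # L) a = (x, v \<cdot> a) # act_comb L a"
  by (simp_all add: act_comb_def)

lemma form_ops_right:
  assumes "L \<in> combs" "N \<in> combs"
  shows "form L (smul_comb c N) = scaleC c (form L N)" "form L (act_comb N a) = form L N * a"
  using assms(2)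
proof (induction N rule: combs_induct)
  case (Cons x v N)
  { case 1 show ?case
      unfolding smul_comb_simps using Cons assms
      by (subst (1 2) form_Cons_right) (simp add: form_ops_single_right scaleC_add_right) }
  { case 2 show ?case
      unfolding act_comb_simps using Cons assms
      by (subst (1 2) form_Cons_right) (simp add: form_ops_single_right distrib_right) }
qed simp_all

lemma form_ops_left:
  assumes "L \<in> combs" "N \<in> combs"
  shows "form (smul_comb c L) N = scaleC (cnj c) (form L N)" "form (act_comb L a) N = star a * form L N"
  using assms(1)
proof (induction L rule: combs_induct)
  case (Cons x v L)
  { case 1 show ?case
      unfolding smul_comb_simps using Cons assms
      by (subst (1 2) form_Cons_left) (simp add: form_ops_single_left scaleC_add_right) }
  { case 2 show ?case
      unfolding act_comb_simps using Cons assms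
      by (subst (1 2) form_Cons_left) (simp add: form_ops_single_left distrib_left) }
qed simp_all

lemma form_positive:
  assumes "L \<in> combs"
  shows "cstar_positive (form L L)"
proof -
  have "form L L = (\<Sum>j<length L. \<Sum>k<length L.
      K (fst (L ! j)) (fst (L ! k)) (snd (L ! j)) (snd (L ! k)))"
    by (simp add: form_def sum_list_sum_nth case_prod_unfold atLeast0LessThan)
  moreover have "fst (L ! j) \<in> X \<and> snd (L ! j) \<in> carrier V" if "j < length L" for j
    using assms nth_mem[OF that] by (auto simp: combs_def mem_Times_iff)
  ultimately show ?thesis
    using K_positive[of "length L" "\<lambda>j. fst (L ! j)" "\<lambda>j. snd (L ! j)"] by simp
qed

lemma ops_in_combs:
  assumes "L \<in> combs" shows "smul_comb c L \<in> combs" "act_comb L a \<in> combs"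
  using assms by (induction L rule: combs_induct) (simp_all add: ract_closed)

sublocale semi_inner_product combs append smul_comb act_comb form
  by unfold_locales
    (auto simp: ops_in_combs form_append_left form_append_right form_ops_left form_ops_right
      form_positive, auto simp: combs_def)

text \<open>
  The function \<open>f\<close> consists of the coordinates \<open>f x v = \<langle>R x v, m\<rangle>\<close> of the limit \<open>m\<close> of the sequence of
  formal sums \<open>s\<close>. The value \<open>0\<close> elsewhere makes \<open>f\<close> determined by these coordinates.
\<close>

definition represents :: "(nat \<Rightarrow> ('x \<times> 'v) list) \<Rightarrow> ('x \<Rightarrow> 'v \<Rightarrow> 'a) \<Rightarrow> bool" where
  "represents s f \<longleftrightarrow> cauchy s \<and>
    (\<forall>x\<in>X. \<forall>v\<in>carrier V. (\<lambda>n. form [(x, v)] (s n)) \<longlonglongrightarrow> f x v) \<and>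
    (\<forall>x v. x \<notin> X \<or> v \<notin> carrier V \<longrightarrow> f x v = 0)"

lemma representsD:
  assumes "represents s f"
  shows "cauchy s" "x \<in> X \<Longrightarrow> v \<in> carrier V \<Longrightarrow> (\<lambda>n. form [(x, v)] (s n)) \<longlonglongrightarrow> f x v"
    "x \<notin> X \<Longrightarrow> f x v = 0" "v \<notin> carrier V \<Longrightarrow> f x v = 0" "s n \<in> combs"
  using assms cauchy_in by (auto simp: represents_def)

text \<open>
  Coordinates determine the limit: the difference of the sequences is weakly null.
\<close>

lemma represents_same_imp_null:
  assumes s: "represents s f" and t: "represents t f"
  shows "(\<lambda>n. seminorm (diff (s n) (t n))) \<longlonglongrightarrow> 0"
proof (rule weakly_null_imp_null)
  show "cauchy (\<lambda>n. diff (s n) (t n))"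
    by (intro cauchy_diff representsD(1)[OF s] representsD(1)[OF t])
  fix u assume "u \<in> combs"
  then show "(\<lambda>n. form u (diff (s n) (t n))) \<longlonglongrightarrow> 0"
  proof (induction u rule: combs_induct)
    case (Cons x v u)
    have "(\<lambda>n. form [(x, v)] (s n) - form [(x, v)] (t n)) \<longlonglongrightarrow> f x v - f x v"
      by (intro tendsto_diff representsD(2)[OF s] representsD(2)[OF t] Cons)
    then have "(\<lambda>n. form [(x, v)] (diff (s n) (t n)) + form u (diff (s n) (t n))) \<longlonglongrightarrow> 0 + 0"
      using Cons by (intro tendsto_add)
        (simp_all add: B_diff_right representsD(5)[OF s] representsD(5)[OF t])
    then show ?case by (subst form_Cons_left) simp
  qed simp
qed

definition inner :: "('x \<Rightarrow> 'v \<Rightarrow> 'a) \<Rightarrow> ('x \<Rightarrow> 'v \<Rightarrow> 'a) \<Rightarrow> 'a" where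
  "inner f g = lim (\<lambda>n. form ((SOME s. represents s f) n) ((SOME s. represents s g) n))"

text \<open>
  The chosen sequences can be replaced by any others that represent the same functions.
\<close>

lemma form_tendsto_inner:
  assumes s: "represents s f" and t: "represents t g"
  shows "(\<lambda>n. form (s n) (t n)) \<longlonglongrightarrow> inner f g"
proof -
  define s' where "s' = (SOME s. represents s f)"
  define t' where "t' = (SOME s. represents s g)"
  have s': "represents s' f" unfolding s'_def by (rule someI[where P = "\<lambda>s. represents s f", OF s])
  have t': "represents t' g" unfolding t'_def by (rule someI[where P = "\<lambda>s. represents s g", OF t])
  have "convergent (\<lambda>n. form (s' n) (t' n))"
    by (intro convergent_B representsD(1)[OF s'] representsD(1)[OF t'])
  then have "(\<lambda>n. form (s' n) (t' n)) \<longlonglongrightarrow> inner f g"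
    by (simp add: inner_def convergent_LIMSEQ_iff s'_def t'_def)
  then show ?thesis
    by (rule B_limit_cong[OF representsD(1)[OF s] representsD(1)[OF s'] represents_same_imp_null[OF s s']
        representsD(1)[OF t] representsD(1)[OF t'] represents_same_imp_null[OF t t']])
qed

text \<open>
  The separated completion of the formal sums. Each element is given by its coordinates, so the module
  operations are pointwise and no quotient has to be formed.
\<close>

definition H :: "('a, 'x \<Rightarrow> 'v \<Rightarrow> 'a) hmodule" where
  "H = \<lparr>carrier = {f. \<exists>s. represents s f}, mult = undefined, one = undefined,
    zero = (\<lambda>_ _. 0), add = (\<lambda>f g x v. f x v + g x v), smult = (\<lambda>c f x v. scaleC c (f x v)),
    ract = (\<lambda>f a x v. f x v * a), inner_prod = inner\<rparr>"

lemma H_sel: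
  "carrier H = {f. \<exists>s. represents s f}" "\<zero>\<^bsub>H\<^esub> = (\<lambda>_ _. 0)" "f \<oplus>\<^bsub>H\<^esub> g = (\<lambda>x v. f x v + g x v)"
  "c \<odot>\<^bsub>H\<^esub> f = (\<lambda>x v. scaleC c (f x v))" "f \<cdot>\<^bsub>H\<^esub> a = (\<lambda>x v. f x v * a)" "inner_prod H = inner"
  by (simp_all add: H_def)

lemma represents_in: "represents s f \<Longrightarrow> f \<in> carrier H"
  by (auto simp: H_sel)

lemma represents_zero: "represents (\<lambda>_. []) \<zero>\<^bsub>H\<^esub>"
  by (simp add: represents_def cauchy_const H_sel)

lemma represents_add:
  "represents s f \<Longrightarrow> represents t g \<Longrightarrow> represents (\<lambda>n. s n @ t n) (f \<oplus>\<^bsub>H\<^esub> g)"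
  unfolding represents_def H_sel form_append_right
  by (auto intro: cauchy_add tendsto_add)

lemma represents_smul: "represents s f \<Longrightarrow> represents (\<lambda>n. smul_comb c (s n)) (c \<odot>\<^bsub>H\<^esub> f)"
  unfolding represents_def H_sel
  by (auto intro: cauchy_smul bounded_linear.tendsto[OF bounded_linear_scaleC]
      simp: B_smul_right cauchy_in)

lemma represents_act: "represents s f \<Longrightarrow> represents (\<lambda>n. act_comb (s n) a) (f \<cdot>\<^bsub>H\<^esub> a)"
  unfolding represents_def H_sel
  by (auto intro: cauchy_act tendsto_mult_right simp: B_act_right cauchy_in)

lemma H_closed:
  "f \<in> carrier H \<Longrightarrow> g \<in> carrier H \<Longrightarrow> f \<oplus>\<^bsub>H\<^esub> g \<in> carrier H" "\<zero>\<^bsub>H\<^esub> \<in> carrier H"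
  "f \<in> carrier H \<Longrightarrow> c \<odot>\<^bsub>H\<^esub> f \<in> carrier H" "f \<in> carrier H \<Longrightarrow> f \<cdot>\<^bsub>H\<^esub> a \<in> carrier H"
  unfolding H_sel(1) mem_Collect_eq
  using represents_add represents_zero represents_smul represents_act by blast+

lemma cstar_module_H: "cstar_module H"
proof -
  have "abelian_group H"
  proof (rule abelian_groupI)
    show "\<exists>g\<in>carrier H. g \<oplus>\<^bsub>H\<^esub> f = \<zero>\<^bsub>H\<^esub>" if "f \<in> carrier H" for f
    proof
      show "(-1) \<odot>\<^bsub>H\<^esub> f \<in> carrier H" using that by (rule H_closed)
      show "(-1) \<odot>\<^bsub>H\<^esub> f \<oplus>\<^bsub>H\<^esub> f = \<zero>\<^bsub>H\<^esub>" by (simp add: H_sel)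
    qed
  qed ((rule H_closed; assumption) | simp add: H_sel(2-6) algebra_simps)+
  then have "Module.module complex_ring H"
    by (rule module.intro[OF cring_complex_ring], unfold_locales)
      ((rule H_closed; assumption) |
        simp add: H_sel(2-6) scaleC_add_left scaleC_add_right scaleC_scaleC)+
  then show ?thesis
    by (rule cstar_module.intro, unfold_locales)
      ((rule H_closed; assumption) |
        simp add: H_sel(2-6) algebra_simps scaleC_mult_left scaleC_mult_right scaleC_add_right)+
qed

lemma inner_sesquilinear_H: "inner \<in> sesquilinear_forms H"
proof -
  have "inner f (g \<oplus>\<^bsub>H\<^esub> h) = inner f g + inner f h" "inner (f \<oplus>\<^bsub>H\<^esub> g) h = inner f h + inner g h"
    if "f \<in> carrier H" "g \<in> carrier H" "h \<in> carrier H" for f g h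
  proof -
    from that obtain r s t where rst: "represents r f" "represents s g" "represents t h"
      by (auto simp: H_sel)
    have "(\<lambda>n. form (r n) (s n @ t n)) \<longlonglongrightarrow> inner f g + inner f h"
      unfolding form_append_right by (rule tendsto_add[OF form_tendsto_inner form_tendsto_inner]) fact+
    from LIMSEQ_unique[OF form_tendsto_inner[OF rst(1) represents_add[OF rst(2,3)]] this]
    show "inner f (g \<oplus>\<^bsub>H\<^esub> h) = inner f g + inner f h" .
    have "(\<lambda>n. form (r n @ s n) (t n)) \<longlonglongrightarrow> inner f h + inner g h"
      unfolding form_append_left by (rule tendsto_add[OF form_tendsto_inner form_tendsto_inner]) fact+
    from LIMSEQ_unique[OF form_tendsto_inner[OF represents_add[OF rst(1,2)] rst(3)] this]
    show "inner (f \<oplus>\<^bsub>H\<^esub> g) h = inner f h + inner g h" .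
  qed
  moreover have "inner f (c \<odot>\<^bsub>H\<^esub> g) = scaleC c (inner f g)" "inner (c \<odot>\<^bsub>H\<^esub> f) g = scaleC (cnj c) (inner f g)"
    "inner f (g \<cdot>\<^bsub>H\<^esub> a) = inner f g * a" "inner (f \<cdot>\<^bsub>H\<^esub> a) g = star a * inner f g"
    if "f \<in> carrier H" "g \<in> carrier H" for f g c a
  proof -
    from that obtain s t where st: "represents s f" "represents t g" by (auto simp: H_sel)
    note lim = form_tendsto_inner[OF st]
    note [simp] = representsD(5)[OF st(1)] representsD(5)[OF st(2)]
    have "(\<lambda>n. form (s n) (smul_comb c (t n))) \<longlonglongrightarrow> scaleC c (inner f g)"
      using bounded_linear.tendsto[OF bounded_linear_scaleC lim] by (simp add: B_smul_right)
    from LIMSEQ_unique[OF form_tendsto_inner[OF st(1) represents_smul[OF st(2)]] this]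
    show "inner f (c \<odot>\<^bsub>H\<^esub> g) = scaleC c (inner f g)" .
    have "(\<lambda>n. form (smul_comb c (s n)) (t n)) \<longlonglongrightarrow> scaleC (cnj c) (inner f g)"
      using bounded_linear.tendsto[OF bounded_linear_scaleC lim] by (simp add: B_smul_left)
    from LIMSEQ_unique[OF form_tendsto_inner[OF represents_smul[OF st(1)] st(2)] this]
    show "inner (c \<odot>\<^bsub>H\<^esub> f) g = scaleC (cnj c) (inner f g)" .
    have "(\<lambda>n. form (s n) (act_comb (t n) a)) \<longlonglongrightarrow> inner f g * a"
      using tendsto_mult_right[OF lim] by (simp add: B_act_right)
    from LIMSEQ_unique[OF form_tendsto_inner[OF st(1) represents_act[OF st(2)]] this]
    show "inner f (g \<cdot>\<^bsub>H\<^esub> a) = inner f g * a" .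
    have "(\<lambda>n. form (act_comb (s n) a) (t n)) \<longlonglongrightarrow> star a * inner f g"
      using tendsto_mult_left[OF lim] by (simp add: B_act_left)
    from LIMSEQ_unique[OF form_tendsto_inner[OF represents_act[OF st(1)] st(2)] this]
    show "inner (f \<cdot>\<^bsub>H\<^esub> a) g = star a * inner f g" .
  qed
  ultimately show ?thesis by (simp add: sesquilinear_forms_def)
qed

lemma seminorm_tendsto:
  assumes "represents s f"
  shows "(\<lambda>n. seminorm (s n)) \<longlonglongrightarrow> hnorm H f"
  unfolding seminorm_def hnorm_def H_sel by (intro tendsto_intros form_tendsto_inner assms)

lemma pre_hilbert_H: "pre_hilbert_module H"
proof (rule pre_hilbert_module.intro[OF cstar_module_H], unfold_locales)
  show "inner_prod H \<in> sesquilinear_forms H" by (simp add: inner_sesquilinear_H H_sel(6))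
  fix f assume "f \<in> carrier H"
  then obtain s where s: "represents s f" by (auto simp: H_sel)
  show "cstar_positive (inner_prod H f f)"
    unfolding H_sel(6) by (rule cstar_positive_limit[OF _ form_tendsto_inner[OF s s]])
      (rule form_positive[OF representsD(5)[OF s]])
  assume "inner_prod H f f = 0"
  then have q0: "(\<lambda>n. seminorm (s n)) \<longlonglongrightarrow> 0" using seminorm_tendsto[OF s] by (simp add: hnorm_def)
  have "f x v = 0" if xv: "x \<in> X" "v \<in> carrier V" for x v
  proof -
    have "(\<lambda>n. seminorm [(x, v)] * seminorm (s n)) \<longlonglongrightarrow> 0" by (rule tendsto_mult_right_zero[OF q0])
    then have "(\<lambda>n. form [(x, v)] (s n)) \<longlonglongrightarrow> 0"
      by (rule Lim_null_comparison[rotated]) (simp add: xv norm_B_le representsD(5)[OF s])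
    then show ?thesis using representsD(2)[OF s xv] LIMSEQ_unique by blast
  qed
  then have "f x v = 0" for x v
    by (cases "x \<in> X \<and> v \<in> carrier V") (auto simp: representsD(3)[OF s] representsD(4)[OF s])
  then show "f = \<zero>\<^bsub>H\<^esub>" by (simp add: H_sel fun_eq_iff)
qed

sublocale H: pre_hilbert_module H by (rule pre_hilbert_H)

sublocale HM: Metric_space "carrier H" "hdist H" by (rule H.metric_space)

lemma represents_diff:
  "represents s f \<Longrightarrow> represents t g \<Longrightarrow> represents (\<lambda>n. diff (s n) (t n)) (H.diff f g)"
  unfolding diff_def H.diff_def by (intro represents_add represents_smul)

definition embed :: "('x \<times> 'v) list \<Rightarrow> 'x \<Rightarrow> 'v \<Rightarrow> 'a" where
  "embed L x v = (if x \<in> X \<and> v \<in> carrier V then form [(x, v)] L else 0)"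

lemma represents_embed: "L \<in> combs \<Longrightarrow> represents (\<lambda>_. L) (embed L)"
  by (auto simp: represents_def embed_def cauchy_const)

lemma embed_in [simp]: "L \<in> combs \<Longrightarrow> embed L \<in> carrier H"
  using represents_embed represents_in by blast

lemma inner_embed:
  assumes "L \<in> combs" "N \<in> combs"
  shows "inner (embed L) (embed N) = form L N"
  using form_tendsto_inner[OF represents_embed[OF assms(1)] represents_embed[OF assms(2)]]
  by (simp add: LIMSEQ_const_iff)

lemma hdist_embed:
  assumes "L \<in> combs" "N \<in> combs"
  shows "hdist H (embed L) (embed N) = seminorm (diff L N)"
  using seminorm_tendsto[OF represents_diff[OF represents_embed[OF assms(1)] represents_embed[OF assms(2)]]] assms
  by (simp add: H.hdist_eq H.hnorm_eq_seminorm LIMSEQ_const_iff)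

text \<open>
  The distance from \<open>s n\<close> to the limit is the limit of its distances from \<open>s m\<close>.
\<close>

lemma embed_tendsto:
  assumes s: "represents s f"
  shows "(\<lambda>n. hdist H (embed (s n)) f) \<longlonglongrightarrow> 0"
proof (rule LIMSEQ_I)
  fix e :: real assume "e > 0"
  then obtain N where N: "\<And>m n. m \<ge> N \<Longrightarrow> n \<ge> N \<Longrightarrow> seminorm (diff (s m) (s n)) < e / 2"
    using cauchyD[OF representsD(1)[OF s], of "e / 2"] by auto
  have "hdist H (embed (s n)) f \<le> e / 2" if n: "n \<ge> N" for n
  proof (rule LIMSEQ_le_const2)
    show "(\<lambda>m. seminorm (diff (s n) (s m))) \<longlonglongrightarrow> hdist H (embed (s n)) f"
      using seminorm_tendsto[OF represents_diff[OF represents_embed s], of "s n"] representsD(5)[OF s]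
      by (simp add: H.hdist_eq H.hnorm_eq_seminorm represents_in[OF s])
    show "\<exists>M. \<forall>m\<ge>M. seminorm (diff (s n) (s m)) \<le> e / 2" using N[OF n] less_imp_le by blast
  qed
  then show "\<exists>N. \<forall>n\<ge>N. norm (hdist H (embed (s n)) f - 0) < e"
    using \<open>e > 0\<close> by (intro exI[of _ N]) force
qed

lemma embed_dense:
  assumes "f \<in> carrier H" "e > 0"
  obtains L where "L \<in> combs" "hdist H (embed L) f < e"
proof -
  obtain s where s: "represents s f" using assms(1) by (auto simp: H_sel)
  then obtain n where "norm (hdist H (embed (s n)) f - 0) < e"
    using LIMSEQ_D[OF embed_tendsto[OF s] assms(2)] by blast
  then show ?thesis using that[of "s n"] representsD(5)[OF s] by simp
qed

text \<open>
  A Cauchy sequence \<open>\<sigma>\<close> is approximated by formal sums \<open>L k\<close> within \<open>1 / (k + 1)\<close>. These are Cauchy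
  too, and the function of their limiting coordinates is the limit of \<open>\<sigma>\<close>.
\<close>

lemma mcomplete_H: "HM.mcomplete"
  unfolding HM.mcomplete_def
proof (intro allI impI)
  fix \<sigma> assume \<sigma>: "HM.MCauchy \<sigma>"
  then have \<sigma>_in: "\<sigma> k \<in> carrier H" for k by (auto simp: HM.MCauchy_def)
  have "\<exists>L. L \<in> combs \<and> hdist H (embed L) (\<sigma> k) < inverse (real (Suc k))" for k
    using embed_dense[OF \<sigma>_in[of k], of "inverse (real (Suc k))"] by auto
  then obtain L where L: "\<And>k. L k \<in> combs" "\<And>k. hdist H (embed (L k)) (\<sigma> k) < inverse (real (Suc k))"
    by metis
  have "cauchy L"
  proof (rule cauchyI[OF L(1)])
    fix e :: real assume e: "e > 0"
    obtain N1 where N1: "\<And>m n. m \<ge> N1 \<Longrightarrow> n \<ge> N1 \<Longrightarrow> hdist H (\<sigma> m) (\<sigma> n) < e / 3"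
      using \<sigma> e unfolding HM.MCauchy_def by (meson divide_pos_pos zero_less_numeral)
    obtain N2 where N2: "inverse (real (Suc N2)) < e / 3"
      using reals_Archimedean[of "e / 3"] e by auto
    have "seminorm (diff (L m) (L n)) < e" if mn: "m \<ge> max N1 N2" "n \<ge> max N1 N2" for m n
    proof -
      have small: "hdist H (embed (L k)) (\<sigma> k) < e / 3" if "k \<ge> N2" for k
      proof -
        have "inverse (real (Suc k)) \<le> inverse (real (Suc N2))" using that by (simp add: le_imp_inverse_le)
        then show ?thesis using L(2)[of k] N2 by linarith
      qed
      have "seminorm (diff (L m) (L n)) = hdist H (embed (L m)) (embed (L n))" by (simp add: hdist_embed L)
      also have "\<dots> \<le> hdist H (embed (L m)) (\<sigma> m) + (hdist H (\<sigma> m) (\<sigma> n) + hdist H (\<sigma> n) (embed (L n)))"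
        using HM.triangle[of "embed (L m)" "\<sigma> m" "embed (L n)"] HM.triangle[of "\<sigma> m" "\<sigma> n" "embed (L n)"]
        by (simp add: L \<sigma>_in)
      also have "\<dots> < e"
        using small[of m] small[of n] N1[of m n] mn HM.commute[of "\<sigma> n" "embed (L n)"] by simp
      finally show ?thesis .
    qed
    then show "\<exists>N. \<forall>m\<ge>N. \<forall>n\<ge>N. seminorm (diff (L m) (L n)) < e" by blast
  qed
  define f where "f x v = (if x \<in> X \<and> v \<in> carrier V then lim (\<lambda>n. form [(x, v)] (L n)) else 0)" for x v
  have rep: "represents L f"
    unfolding represents_def
  proof (intro conjI ballI allI impI)
    fix x v assume "x \<in> X" "v \<in> carrier V"
    then have "convergent (\<lambda>n. form [(x, v)] (L n))"
      using convergent_B[OF cauchy_const \<open>cauchy L\<close>, of "[(x, v)]"] by simp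
    then show "(\<lambda>n. form [(x, v)] (L n)) \<longlonglongrightarrow> f x v"
      using \<open>x \<in> X\<close> \<open>v \<in> carrier V\<close> by (simp add: f_def convergent_LIMSEQ_iff)
  qed (use \<open>cauchy L\<close> in \<open>auto simp: f_def\<close>)
  have lim: "(\<lambda>k. inverse (real (Suc k)) + hdist H (embed (L k)) f) \<longlonglongrightarrow> 0"
    using tendsto_add[OF LIMSEQ_inverse_real_of_nat embed_tendsto[OF rep]] by simp
  have "norm (hdist H (\<sigma> k) f) \<le> inverse (real (Suc k)) + hdist H (embed (L k)) f" for k
    using HM.triangle[of "\<sigma> k" "embed (L k)" f] L(2)[of k] HM.commute[of "\<sigma> k" "embed (L k)"]
    by (simp add: L(1) \<sigma>_in represents_in[OF rep] del: of_nat_Suc)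
  then have "(\<lambda>k. hdist H (\<sigma> k) f) \<longlonglongrightarrow> 0"
    by (intro Lim_null_comparison[OF _ lim] always_eventually allI)
  then have "limitin HM.mtopology \<sigma> f sequentially"
    by (simp add: HM.limitin_metric_dist_null represents_in[OF rep] \<sigma>_in)
  then show "\<exists>f. limitin HM.mtopology \<sigma> f sequentially" by blast
qed

lemma hilbert_module_H: "hilbert_module H"
  by (simp add: hilbert_module_iff pre_hilbert_H mcomplete_H)

text \<open>
  The vector written \<open>R x v\<close> in the comments above.
\<close>

definition feature :: "'x \<Rightarrow> 'v \<Rightarrow> 'x \<Rightarrow> 'v \<Rightarrow> 'a" where
  "feature x v = embed [(x, v)]"

lemma feature_Lin:
  assumes "x \<in> X" shows "feature x \<in> Lin V H"
  unfolding Lin_def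
proof (intro CollectI conjI ballI allI)
  show "feature x \<in> carrier V \<rightarrow> carrier H" using assms by (auto simp: feature_def)
  show "feature x (v \<oplus> w) = feature x v \<oplus>\<^bsub>H\<^esub> feature x w" if "v \<in> carrier V" "w \<in> carrier V" for v w
    using assms that K_sesquilinear[of _ x]
    by (force simp: feature_def embed_def H_sel sesquilinear_forms_def fun_eq_iff)
  show "feature x (c \<odot> v) = c \<odot>\<^bsub>H\<^esub> feature x v" "feature x (v \<cdot> a) = feature x v \<cdot>\<^bsub>H\<^esub> a"
    if "v \<in> carrier V" for c v a
    using assms that by (auto simp: feature_def embed_def H_sel fun_eq_iff K_smul)
qed

lemma inner_feature:
  "x \<in> X \<Longrightarrow> y \<in> X \<Longrightarrow> v \<in> carrier V \<Longrightarrow> w \<in> carrier V \<Longrightarrow>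
    inner_prod H (feature x v) (feature y w) = K x y v w"
  by (simp add: feature_def inner_embed H_sel)

lemma hdense_feature: "hdense H (lin_span H {feature x v | x v. x \<in> X \<and> v \<in> carrier V})"
proof -
  have span: "embed L \<in> lin_span H {feature x v | x v. x \<in> X \<and> v \<in> carrier V}" if "L \<in> combs" for L
    unfolding lin_span_def hull_def
  proof (intro InterI, clarify)
    fix S assume S: "submodule S complex_ring H" "{feature x v | x v. x \<in> X \<and> v \<in> carrier V} \<subseteq> S"
    from that show "embed L \<in> S"
    proof (induction L rule: combs_induct)
      case Nil
      have "embed [] = \<zero>\<^bsub>H\<^esub>" by (simp add: embed_def H_sel fun_eq_iff)
      then show ?case using S(1) subgroup.one_closed submodule.axioms(1) by fastforce
    next
      case (Cons x v L)
      have "embed ((x, v) # L) = feature x v \<oplus>\<^bsub>H\<^esub> embed L"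
        by (simp add: embed_def feature_def H_sel fun_eq_iff form_Cons_right[of _ _ L])
      moreover have "feature x v \<in> S" using Cons S(2) by blast
      ultimately show ?case
        using subgroup.m_closed[OF submodule.axioms(1)[OF S(1)]] Cons by fastforce
    qed
  qed
  show ?thesis
    unfolding hdense_def HM.metric_closure_of
  proof (intro equalityI subsetI)
    fix f assume f: "f \<in> carrier H"
    have "\<exists>g\<in>lin_span H {feature x v | x v. x \<in> X \<and> v \<in> carrier V}. g \<in> HM.mball f r" if r: "r > 0" for r
    proof -
      obtain L where L: "L \<in> combs" "hdist H (embed L) f < r" using embed_dense[OF f r] by blast
      then have "embed L \<in> HM.mball f r" using f HM.commute[of f "embed L"] by simp
      then show ?thesis using span[OF L(1)] by blast
    qed
    with f show "f \<in> {f \<in> carrier H. \<forall>r>0. \<exists>g\<in>lin_span H {feature x v | x v. x \<in> X \<and> v \<in> carrier V}.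
        g \<in> HM.mball f r}" by blast
  qed blast
qed

end

section \<open>Uniqueness of the minimal decomposition\<close>

text \<open>
  By density an element \<open>m\<close> is determined by its coordinates \<open>\<langle>R x v, m\<rangle>\<close>. Taking coordinates is a unitary
  map onto the module \<open>H\<close> of functions, which depends on the kernel alone; this is the reason
  for uniqueness.
\<close>

locale minimal_realization = positive_kernel V X K + M: hilbert_module M
  for V :: "('a::cstar_algebra, 'v, 'm1) amodule_scheme" (structure)
    and X :: "'x set" and K :: "'x \<Rightarrow> 'x \<Rightarrow> 'v \<Rightarrow> 'v \<Rightarrow> 'a"
    and M :: "('a, 'w, 'm2) hmodule_scheme" +
  fixes R :: "'x \<Rightarrow> 'v \<Rightarrow> 'w"
  assumes R_Lin: "x \<in> X \<Longrightarrow> R x \<in> Lin V M"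
    and R_kernel: "x \<in> X \<Longrightarrow> y \<in> X \<Longrightarrow> v \<in> carrier V \<Longrightarrow> w \<in> carrier V \<Longrightarrow>
      inner_prod M (R x v) (R y w) = K x y v w"
    and R_dense: "hdense M (lin_span M {R x v | x v. x \<in> X \<and> v \<in> carrier V})"
begin

sublocale M: pre_hilbert_module M
  using M.hilbert_module_axioms by (simp add: hilbert_module_iff)

sublocale MM: Metric_space "carrier M" "hdist M" by (rule M.metric_space)

lemma R_closed [simp]: "x \<in> X \<Longrightarrow> v \<in> carrier V \<Longrightarrow> R x v \<in> carrier M"
  by (rule Lin_closed[OF R_Lin])

fun comb_sum :: "('x \<times> 'v) list \<Rightarrow> 'w" where
  "comb_sum [] = \<zero>\<^bsub>M\<^esub>"
| "comb_sum ((x, v) # L) = R x v \<oplus>\<^bsub>M\<^esub> comb_sum L"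

lemma comb_sum_closed [simp]: "L \<in> combs \<Longrightarrow> comb_sum L \<in> carrier M"
  by (induction L rule: combs_induct) auto

lemma inner_R_comb_sum:
  assumes "x \<in> X" "v \<in> carrier V" "L \<in> combs"
  shows "inner_prod M (R x v) (comb_sum L) = form [(x, v)] L"
  using assms(3)
proof (induction L rule: combs_induct)
  case (Cons y w L)
  then show ?case using assms(1,2) by (subst form_Cons_right) (simp add: M.B_add_right R_kernel)
qed (use assms in simp)

lemma inner_comb_sum:
  assumes "L \<in> combs" "N \<in> combs"
  shows "inner_prod M (comb_sum L) (comb_sum N) = form L N"
  using assms(1)
proof (induction L rule: combs_induct)
  case (Cons y w L)
  then show ?case using assms(2) by (subst form_Cons_left) (simp add: M.B_add_left inner_R_comb_sum)
qed (use assms in simp)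

lemma seminorm_diff_comb_sum:
  assumes "L \<in> combs" "N \<in> combs"
  shows "M.seminorm (M.diff (comb_sum L) (comb_sum N)) = seminorm (diff L N)"
  using assms by (simp add: M.seminorm_def seminorm_def M.B_diff_left M.B_diff_right B_diff_left B_diff_right inner_comb_sum)

lemma cauchy_comb_sum:
  assumes "\<And>n. L n \<in> combs"
  shows "M.cauchy (\<lambda>n. comb_sum (L n)) \<longleftrightarrow> cauchy L"
  using assms by (simp add: M.cauchy_def cauchy_def seminorm_diff_comb_sum)

lemma comb_sum_append: "L \<in> combs \<Longrightarrow> N \<in> combs \<Longrightarrow> comb_sum (L @ N) = comb_sum L \<oplus>\<^bsub>M\<^esub> comb_sum N"
  by (induction L rule: combs_induct) (simp_all add: M.a_assoc)

lemma comb_sum_smul: "L \<in> combs \<Longrightarrow> comb_sum (smul_comb c L) = c \<odot>\<^bsub>M\<^esub> comb_sum L"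
proof (induction L rule: combs_induct)
  case (Cons x v L)
  moreover have "R x (c \<odot> v) = c \<odot>\<^bsub>M\<^esub> R x v" using R_Lin[of x] Cons by (simp add: Lin_def)
  ultimately show ?case by (simp add: M.smult_r_distr)
qed simp

lemma lin_span_subset: "lin_span M {R x v | x v. x \<in> X \<and> v \<in> carrier V} \<subseteq> comb_sum ` combs"
proof -
  have "submodule (comb_sum ` combs) complex_ring M"
  proof (rule M.submoduleI)
    show "comb_sum ` combs \<subseteq> carrier M" by auto
    show "\<zero>\<^bsub>M\<^esub> \<in> comb_sum ` combs" by (rule image_eqI[of _ _ "[]"]) simp_all
    fix a b assume "a \<in> comb_sum ` combs" "b \<in> comb_sum ` combs"
    then obtain L N where L: "L \<in> combs" "a = comb_sum L" and N: "N \<in> combs" "b = comb_sum N" by auto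
    have smul: "c \<odot>\<^bsub>M\<^esub> a \<in> comb_sum ` combs" for c
      by (rule image_eqI[of _ _ "smul_comb c L"]) (simp_all add: L comb_sum_smul)
    then show "c \<odot>\<^bsub>M\<^esub> a \<in> comb_sum ` combs" for c by blast
    show "\<ominus>\<^bsub>M\<^esub> a \<in> comb_sum ` combs" using smul[of "-1"] L by (simp add: M.smult_minus_one)
    show "a \<oplus>\<^bsub>M\<^esub> b \<in> comb_sum ` combs"
      by (rule image_eqI[of _ _ "L @ N"]) (simp_all add: L N comb_sum_append)
  qed
  moreover have "{R x v | x v. x \<in> X \<and> v \<in> carrier V} \<subseteq> comb_sum ` combs"
  proof clarify
    fix x v assume "x \<in> X" "v \<in> carrier V"
    then show "R x v \<in> comb_sum ` combs"
      by (intro image_eqI[of _ _ "[(x, v)]"]) simp_all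
  qed
  ultimately show ?thesis unfolding lin_span_def by (intro hull_minimal)
qed

lemma approximation:
  assumes m: "m \<in> carrier M"
  obtains L where "\<And>n. L n \<in> combs" "(\<lambda>n. hdist M (comb_sum (L n)) m) \<longlonglongrightarrow> 0"
proof -
  have "\<exists>L\<in>combs. hdist M (comb_sum L) m < inverse (real (Suc n))" for n
  proof -
    have "inverse (real (Suc n)) > 0" by simp
    moreover have "m \<in> MM.mtopology closure_of lin_span M {R x v | x v. x \<in> X \<and> v \<in> carrier V}"
      using R_dense m unfolding hdense_def by simp
    ultimately obtain y where y: "y \<in> lin_span M {R x v | x v. x \<in> X \<and> v \<in> carrier V}"
      "y \<in> MM.mball m (inverse (real (Suc n)))"
      unfolding MM.metric_closure_of by blast
    from y(1) obtain L where "L \<in> combs" "y = comb_sum L" using lin_span_subset by blast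
    with y(2) show ?thesis using MM.commute[of y m] by (intro bexI[of _ L]) simp_all
  qed
  then obtain L where L: "\<And>n. L n \<in> combs" "\<And>n. hdist M (comb_sum (L n)) m < inverse (real (Suc n))"
    by metis
  have "(\<lambda>n. hdist M (comb_sum (L n)) m) \<longlonglongrightarrow> 0"
  proof (rule Lim_null_comparison[OF _ LIMSEQ_inverse_real_of_nat])
    show "\<forall>\<^sub>F n in sequentially. norm (hdist M (comb_sum (L n)) m) \<le> inverse (real (Suc n))"
      using L(2) by (intro always_eventually allI) (simp add: less_imp_le del: of_nat_Suc)
  qed
  then show ?thesis using that L(1) by blast
qed

definition coord :: "'w \<Rightarrow> 'x \<Rightarrow> 'v \<Rightarrow> 'a" where
  "coord m x v = (if x \<in> X \<and> v \<in> carrier V then inner_prod M (R x v) m else 0)"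

lemma cauchy_if_tendsto:
  assumes "\<And>n. s n \<in> carrier M" "m \<in> carrier M" "(\<lambda>n. hdist M (s n) m) \<longlonglongrightarrow> 0"
  shows "M.cauchy s"
proof -
  have "limitin MM.mtopology s m sequentially"
    using assms by (simp add: MM.limitin_metric_dist_null)
  then have "MM.MCauchy s" using assms(1) by (intro MM.convergent_imp_MCauchy) auto
  then show ?thesis using assms(1) by (simp add: M.cauchy_def MM.MCauchy_def M.hdist_eq)
qed

lemma inner_tendsto:
  assumes "\<And>n. s n \<in> carrier M" "\<And>n. t n \<in> carrier M" "m \<in> carrier M" "m' \<in> carrier M"
    "(\<lambda>n. hdist M (s n) m) \<longlonglongrightarrow> 0" "(\<lambda>n. hdist M (t n) m') \<longlonglongrightarrow> 0"
  shows "(\<lambda>n. inner_prod M (s n) (t n)) \<longlonglongrightarrow> inner_prod M m m'"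
proof (rule M.B_limit_cong[of s "\<lambda>_. m" t "\<lambda>_. m'"])
  show "M.cauchy s" "M.cauchy t"
    by (rule cauchy_if_tendsto[OF assms(1,3,5)], rule cauchy_if_tendsto[OF assms(2,4,6)])
qed (use assms in \<open>simp_all add: M.cauchy_const M.hdist_eq\<close>)

lemma represents_coord:
  assumes "m \<in> carrier M" "\<And>n. L n \<in> combs" "(\<lambda>n. hdist M (comb_sum (L n)) m) \<longlonglongrightarrow> 0"
  shows "represents L (coord m)"
  unfolding represents_def
proof (intro conjI ballI allI impI)
  have "M.cauchy (\<lambda>n. comb_sum (L n))"
    by (rule cauchy_if_tendsto[OF _ assms(1,3)]) (simp add: assms(2))
  then show "cauchy L" using cauchy_comb_sum[OF assms(2)] by simp
  fix x v assume xv: "x \<in> X" "v \<in> carrier V"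
  have "(\<lambda>n. inner_prod M (R x v) (comb_sum (L n))) \<longlonglongrightarrow> inner_prod M (R x v) m"
    by (rule inner_tendsto) (use assms xv in simp_all)
  then show "(\<lambda>n. form [(x, v)] (L n)) \<longlonglongrightarrow> coord m x v"
    using xv assms(2) by (simp add: coord_def inner_R_comb_sum)
qed (auto simp: coord_def)

lemma coord_in: "m \<in> carrier M \<Longrightarrow> coord m \<in> carrier H"
  using approximation represents_coord represents_in by metis

lemma inner_coord:
  assumes "m \<in> carrier M" "m' \<in> carrier M"
  shows "inner (coord m) (coord m') = inner_prod M m m'"
proof -
  obtain L where L: "\<And>n. L n \<in> combs" "(\<lambda>n. hdist M (comb_sum (L n)) m) \<longlonglongrightarrow> 0"
    using approximation[OF assms(1)] by blast
  obtain N where N: "\<And>n. N n \<in> combs" "(\<lambda>n. hdist M (comb_sum (N n)) m') \<longlonglongrightarrow> 0"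
    using approximation[OF assms(2)] by blast
  have "(\<lambda>n. inner_prod M (comb_sum (L n)) (comb_sum (N n))) \<longlonglongrightarrow> inner_prod M m m'"
    by (rule inner_tendsto) (use L N assms in simp_all)
  then have "(\<lambda>n. form (L n) (N n)) \<longlonglongrightarrow> inner_prod M m m'"
    using L(1) N(1) by (simp add: inner_comb_sum)
  from LIMSEQ_unique[OF form_tendsto_inner[OF represents_coord[OF assms(1) L] represents_coord[OF assms(2) N]] this]
  show ?thesis .
qed

lemma coord_inject:
  assumes "m \<in> carrier M" "m' \<in> carrier M" "coord m = coord m'"
  shows "m = m'"
proof (rule M.inner_eq_imp_eq[OF assms(1,2)])
  fix w assume w: "w \<in> carrier M"
  show "inner_prod M w m = inner_prod M w m'"
    using inner_coord[OF w assms(1)] inner_coord[OF w assms(2)] assms(3) by simp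
qed

text \<open>
  The formal sums that represent \<open>f\<close> are realised in \<open>M\<close> by a Cauchy sequence, whose limit has the
  coordinates \<open>f\<close>.
\<close>

lemma coord_surj:
  assumes "f \<in> carrier H"
  obtains m where "m \<in> carrier M" "coord m = f"
proof -
  obtain L where L: "represents L f" using assms by (auto simp: H_sel)
  note Lc = representsD(5)[OF L]
  have "M.cauchy (\<lambda>n. comb_sum (L n))" using cauchy_comb_sum[of L] Lc representsD(1)[OF L] by simp
  then have "MM.MCauchy (\<lambda>n. comb_sum (L n))"
    using Lc by (simp add: M.cauchy_def MM.MCauchy_def M.hdist_eq image_subset_iff)
  then obtain m where "limitin MM.mtopology (\<lambda>n. comb_sum (L n)) m sequentially"
    using M.complete unfolding MM.mcomplete_def by blast
  then have m: "m \<in> carrier M" "(\<lambda>n. hdist M (comb_sum (L n)) m) \<longlonglongrightarrow> 0"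
    by (simp_all add: MM.limitin_metric_dist_null)
  have rep: "represents L (coord m)" by (rule represents_coord[OF m(1) Lc m(2)])
  have "coord m x v = f x v" for x v
  proof (cases "x \<in> X \<and> v \<in> carrier V")
    case True
    then show ?thesis using LIMSEQ_unique[OF representsD(2)[OF rep] representsD(2)[OF L]] by blast
  next
    case False
    then show ?thesis using representsD(3,4)[OF L] by (auto simp: coord_def)
  qed
  then show ?thesis using that[of m] m(1) by blast
qed

lemma coord_linear:
  "m \<in> carrier M \<Longrightarrow> m' \<in> carrier M \<Longrightarrow> coord (m \<oplus>\<^bsub>M\<^esub> m') = coord m \<oplus>\<^bsub>H\<^esub> coord m'"
  "m \<in> carrier M \<Longrightarrow> coord (c \<odot>\<^bsub>M\<^esub> m) = c \<odot>\<^bsub>H\<^esub> coord m"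
  "m \<in> carrier M \<Longrightarrow> coord (m \<cdot>\<^bsub>M\<^esub> a) = coord m \<cdot>\<^bsub>H\<^esub> a"
  by (auto simp: coord_def H_sel fun_eq_iff M.B_add_right M.B_smul_right M.B_act_right)

lemma coord_R: "x \<in> X \<Longrightarrow> v \<in> carrier V \<Longrightarrow> coord (R x v) = feature x v"
  by (auto simp: coord_def feature_def embed_def fun_eq_iff R_kernel)

end

lemma minimal_realizations_equivalent:
  assumes "minimal_realization V X K M R" "minimal_realization V X K M' R'"
  obtains W where "W \<in> unitary_between M M'"
    "\<And>x v. x \<in> X \<Longrightarrow> v \<in> carrier V \<Longrightarrow> W (R x v) = R' x v"
proof -
  interpret M: minimal_realization V X K M R by (rule assms(1))
  interpret M': minimal_realization V X K M' R' by (rule assms(2))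
  have "\<exists>m'\<in>carrier M'. M'.coord m' = M.coord m" if "m \<in> carrier M" for m
    using M'.coord_surj[OF M.coord_in[OF that]] by blast
  then obtain W where W: "\<And>m. m \<in> carrier M \<Longrightarrow> W m \<in> carrier M'"
    "\<And>m. m \<in> carrier M \<Longrightarrow> M'.coord (W m) = M.coord m"
    by metis
  have unique: "W m = m'" if "m \<in> carrier M" "m' \<in> carrier M'" "M'.coord m' = M.coord m" for m m'
    using that W by (intro M'.coord_inject) simp_all
  note cl = M.M.a_closed M.M.smult_closed M.M.ract_closed M'.M.a_closed M'.M.smult_closed M'.M.ract_closed
  have "W \<in> Lin M M'"
    unfolding Lin_def
    by (auto intro!: unique simp: W cl M.coord_linear M'.coord_linear)
  moreover have "W ` carrier M = carrier M'"
  proof (intro equalityI subsetI)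
    fix m' assume m': "m' \<in> carrier M'"
    then obtain m where "m \<in> carrier M" "M.coord m = M'.coord m'"
      using M.coord_surj[OF M'.coord_in] by metis
    then show "m' \<in> W ` carrier M" using unique m' by (metis image_eqI)
  qed (auto simp: W)
  moreover have "inner_prod M' (W v) (W w) = inner_prod M v w" if "v \<in> carrier M" "w \<in> carrier M" for v w
    using that M.inner_coord[OF that] M'.inner_coord[of "W v" "W w"] by (simp add: W)
  ultimately have "W \<in> unitary_between M M'" by (simp add: unitary_between_def)
  moreover have "W (R x v) = R' x v" if "x \<in> X" "v \<in> carrier V" for x v
    by (rule unique) (use that in \<open>simp_all add: M.coord_R M'.coord_R\<close>)
  ultimately show ?thesis by (rule that)
qed

section \<open>The action of the unitization\<close>

text \<open>
  The algebra is an ideal of its unitization. The functions \<open>rmul\<close> and \<open>lstar\<close> are the products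
  \<open>x \<alpha>\<close> and \<open>\<alpha>* x\<close> in it.
\<close>

definition rmul :: "'a::cstar_algebra \<Rightarrow> 'a \<times> complex \<Rightarrow> 'a" where
  "rmul x \<alpha> = x * fst \<alpha> + scaleC (snd \<alpha>) x"

definition lstar :: "'a::cstar_algebra \<times> complex \<Rightarrow> 'a \<Rightarrow> 'a" where
  "lstar \<alpha> x = star (rmul (star x) \<alpha>)"

lemma unitization_mult: "\<alpha> \<otimes>\<^bsub>unitization\<^esub> \<beta> =
    (fst \<alpha> * fst \<beta> + scaleC (snd \<beta>) (fst \<alpha>) + scaleC (snd \<alpha>) (fst \<beta>), snd \<alpha> * snd \<beta>)"
  by (cases \<alpha>; cases \<beta>) (simp add: unitization_def)

lemma lstar_eq: "lstar \<alpha> x = star (fst \<alpha>) * x + scaleC (cnj (snd \<alpha>)) x"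
  by (simp add: lstar_def rmul_def star_add star_mult star_scaleC)

lemma star_mult_incl_mult: "unitization_star \<alpha> \<otimes>\<^bsub>unitization\<^esub> unitization_incl x \<otimes>\<^bsub>unitization\<^esub> \<beta>
    = unitization_incl (rmul (lstar \<alpha> x) \<beta>)"
  by (cases \<alpha>) (simp add: unitization_mult unitization_incl_def unitization_star_def lstar_eq rmul_def)

lemma unitization_incl_inject [simp]: "unitization_incl x = unitization_incl y \<longleftrightarrow> x = y"
  by (simp add: unitization_incl_def)

lemma rmul_rmul: "rmul (rmul x \<alpha>) \<beta> = rmul x (\<alpha> \<otimes>\<^bsub>unitization\<^esub> \<beta>)"
  by (simp add: rmul_def unitization_mult algebra_simps scaleC_mult_left scaleC_mult_right
      scaleC_add_right scaleC_scaleC)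

lemma lstar_lstar: "lstar \<beta> (lstar \<alpha> x) = lstar (\<alpha> \<otimes>\<^bsub>unitization\<^esub> \<beta>) x"
  by (simp add: lstar_def rmul_rmul)

lemma rmul_lstar: "rmul (lstar \<alpha> x) \<beta> = lstar \<alpha> (rmul x \<beta>)"
  by (simp add: rmul_def lstar_eq algebra_simps scaleC_mult_left scaleC_mult_right
      scaleC_add_right scaleC_scaleC)

lemma rmul_one [simp]: "rmul x \<one>\<^bsub>unitization\<^esub> = x"
proof (cases "\<exists>u::'a. is_algebra_unit u")
  case True
  then obtain u :: 'a where u: "is_algebra_unit u" by blast
  have the: "(THE u::'a. is_algebra_unit u) = u"
    by (rule the_equality[where P = is_algebra_unit, OF u]) (metis is_algebra_unit_def u)
  have "x * u = x" using u by (simp add: is_algebra_unit_def)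
  with True show ?thesis by (simp add: rmul_def unitization_def the)
qed (simp add: rmul_def unitization_def)

lemma lstar_one [simp]: "lstar \<one>\<^bsub>unitization\<^esub> x = x"
  by (simp add: lstar_def)

lemma rmul_linear:
  "rmul (x + y) \<alpha> = rmul x \<alpha> + rmul y \<alpha>" "rmul (scaleC c x) \<alpha> = scaleC c (rmul x \<alpha>)" "rmul 0 \<alpha> = 0"
  by (simp_all add: rmul_def algebra_simps scaleC_add_right scaleC_scaleC scaleC_mult_left)

lemma lstar_linear:
  "lstar \<alpha> (x + y) = lstar \<alpha> x + lstar \<alpha> y" "lstar \<alpha> (scaleC c x) = scaleC c (lstar \<alpha> x)"
  "lstar \<alpha> (x * a) = lstar \<alpha> x * a" "lstar \<alpha> 0 = 0"
  by (simp_all add: lstar_eq algebra_simps scaleC_add_right scaleC_scaleC scaleC_mult_left scaleC_mult_right)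

lemma bounded_linear_lstar: "bounded_linear (lstar \<alpha>)"
  unfolding lstar_eq[abs_def]
  by (intro bounded_linear_add bounded_linear_mult_right bounded_linear_scaleC)

lemma unitization_incl_carrier: "unitization_incl x \<in> carrier unitization"
  by (simp add: unitization_def unitization_incl_def)

lemma center_commute:
  assumes "\<alpha> \<in> center"
  shows "fst \<alpha> * x + scaleC (snd \<alpha>) x = rmul x \<alpha>"
proof -
  have "\<alpha> \<otimes>\<^bsub>unitization\<^esub> unitization_incl x = unitization_incl x \<otimes>\<^bsub>unitization\<^esub> \<alpha>"
    using assms unitization_incl_carrier by (auto simp: center_def)
  then show ?thesis by (simp add: unitization_mult unitization_incl_def rmul_def)
qed

lemma center_lstar:
  assumes "\<alpha> \<in> center"
  shows "lstar \<alpha> x = rmul x (unitization_star \<alpha>)"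
  unfolding lstar_def center_commute[OF assms, symmetric]
  by (simp add: rmul_def unitization_star_def case_prod_unfold star_add star_mult star_scaleC)

text \<open>
  By centrality \<open>\<alpha>* x \<alpha> = x \<alpha>* \<alpha>\<close>.
\<close>

lemma unitary_center_cancel:
  assumes "\<alpha> \<in> unitary_elements \<inter> center"
  shows "lstar \<alpha> (rmul x \<alpha>) = x"
proof -
  have "lstar \<alpha> (rmul x \<alpha>) = rmul (rmul x (unitization_star \<alpha>)) \<alpha>"
    using assms center_lstar[of \<alpha> x] by (simp flip: rmul_lstar)
  also have "\<dots> = x" using assms by (simp add: rmul_rmul unitary_elements_def)
  finally show ?thesis .
qed

lemma uract_eq: "uract V v \<alpha> = (v \<cdot>\<^bsub>V\<^esub> fst \<alpha>) \<oplus>\<^bsub>V\<^esub> (snd \<alpha> \<odot>\<^bsub>V\<^esub> v)"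
  by (simp add: uract_def case_prod_unfold)

lemma (in cstar_module) uract_closed: "v \<in> carrier V \<Longrightarrow> uract V v \<alpha> \<in> carrier V"
  by (simp add: uract_eq ract_closed)

lemma sesquilinear_uract:
  assumes "s \<in> sesquilinear_forms V" "cstar_module V" "u \<in> carrier V" "v \<in> carrier V"
  shows "s u (uract V v \<alpha>) = rmul (s u v) \<alpha>" "s (uract V u \<alpha>) v = lstar \<alpha> (s u v)"
proof -
  interpret cstar_module V by (rule assms(2))
  have "v \<cdot>\<^bsub>V\<^esub> fst \<alpha> \<in> carrier V" "u \<cdot>\<^bsub>V\<^esub> fst \<alpha> \<in> carrier V"
    "snd \<alpha> \<odot>\<^bsub>V\<^esub> v \<in> carrier V" "snd \<alpha> \<odot>\<^bsub>V\<^esub> u \<in> carrier V"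
    using assms(3,4) by (simp_all add: ract_closed)
  then show "s u (uract V v \<alpha>) = rmul (s u v) \<alpha>" "s (uract V u \<alpha>) v = lstar \<alpha> (s u v)"
    using assms(1,3,4) by (simp_all add: uract_eq sesquilinear_forms_def rmul_def lstar_eq)
qed

section \<open>Covariant kernels from covariant triples\<close>


lemma unitary_operators_inner:
  assumes "B \<in> unitary_operators M" "v \<in> carrier M" "w \<in> carrier M"
  shows "inner_prod M (B v) (B w) = inner_prod M v w"
proof -
  obtain C where C: "\<And>v w. v \<in> carrier M \<Longrightarrow> w \<in> carrier M \<Longrightarrow> inner_prod M (B v) w = inner_prod M v (C w)"
    "\<And>v. v \<in> carrier M \<Longrightarrow> C (B v) = v"
    using assms(1) by (auto simp: unitary_operators_def)
  have "B w \<in> carrier M" using assms by (auto simp: unitary_operators_def Lin_def)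
  then show ?thesis using C assms(2,3) by simp
qed

lemma unitary_operators_closed: "B \<in> unitary_operators M \<Longrightarrow> v \<in> carrier M \<Longrightarrow> B v \<in> carrier M"
  by (auto simp: unitary_operators_def Lin_def)

locale covariance_data =
  fixes V :: "('a::cstar_algebra, 'v) amodule"
    and G :: "'g monoid"
    and X :: "'x set"
    and \<phi> :: "'g \<Rightarrow> 'x \<Rightarrow> 'x"
    and U :: "'g \<Rightarrow> 'v \<Rightarrow> 'v"
    and \<alpha> :: "'g \<Rightarrow> 'x \<Rightarrow> 'a \<times> complex"
    and \<sigma> :: "'g \<Rightarrow> 'g \<Rightarrow> 'a \<times> complex"
  assumes V: "cstar_module V"
    and G: "group G"
    and action: "group_action G X \<phi>"
    and U: "U \<in> hom G (GL V)"
    and \<alpha>_range: "\<And>g x. g \<in> carrier G \<Longrightarrow> x \<in> X \<Longrightarrow> \<alpha> g x \<in> invertible_elements \<inter> center"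
    and \<sigma>: "two_cocycle G \<sigma>"
    and \<alpha>_one: "\<And>x. x \<in> X \<Longrightarrow> \<alpha> \<one>\<^bsub>G\<^esub> x = \<one>\<^bsub>unitization\<^esub>"
    and \<alpha>_mult: "\<And>g h x. g \<in> carrier G \<Longrightarrow> h \<in> carrier G \<Longrightarrow> x \<in> X \<Longrightarrow>
      \<alpha> (g \<otimes>\<^bsub>G\<^esub> h) x =
        \<sigma> g h \<otimes>\<^bsub>unitization\<^esub> \<alpha> h x \<otimes>\<^bsub>unitization\<^esub> \<alpha> g (\<phi> h x)"
begin

sublocale V: cstar_module V by (rule V)
sublocale G: group G by (rule G)

lemma act_closed [simp]: "g \<in> carrier G \<Longrightarrow> x \<in> X \<Longrightarrow> \<phi> g x \<in> X"
  using group_action.element_image[OF action] by blast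

lemma act_mult: "g \<in> carrier G \<Longrightarrow> h \<in> carrier G \<Longrightarrow> x \<in> X \<Longrightarrow> \<phi> (g \<otimes>\<^bsub>G\<^esub> h) x = \<phi> g (\<phi> h x)"
  using group_action.composition_rule[OF action] by simp

lemma act_one [simp]: "x \<in> X \<Longrightarrow> \<phi> \<one>\<^bsub>G\<^esub> x = x"
  using group_action.id_eq_one[OF action] by (metis restrict_apply')

lemma act_inv [simp]:
  "g \<in> carrier G \<Longrightarrow> x \<in> X \<Longrightarrow> \<phi> g (\<phi> (inv\<^bsub>G\<^esub> g) x) = x"
  "g \<in> carrier G \<Longrightarrow> x \<in> X \<Longrightarrow> \<phi> (inv\<^bsub>G\<^esub> g) (\<phi> g x) = x"
  by (simp_all flip: act_mult)

lemma U_GL: "g \<in> carrier G \<Longrightarrow> U g \<in> Bij (carrier V) \<inter> Lin V V"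
  using U by (auto simp: hom_def GL_def)

lemma U_closed [simp]: "g \<in> carrier G \<Longrightarrow> v \<in> carrier V \<Longrightarrow> U g v \<in> carrier V"
  using U_GL[of g] by (auto simp: Lin_def)

lemma U_mult: "g \<in> carrier G \<Longrightarrow> h \<in> carrier G \<Longrightarrow> v \<in> carrier V \<Longrightarrow> U (g \<otimes>\<^bsub>G\<^esub> h) v = U g (U h v)"
  using U U_GL[of g] U_GL[of h] by (auto simp: hom_def GL_def BijGroup_def compose_def)

lemma U_one [simp]: "v \<in> carrier V \<Longrightarrow> U \<one>\<^bsub>G\<^esub> v = v"
proof -
  assume v: "v \<in> carrier V"
  have "U \<one>\<^bsub>G\<^esub> (U \<one>\<^bsub>G\<^esub> v) = U \<one>\<^bsub>G\<^esub> v" using U_mult[of "\<one>\<^bsub>G\<^esub>" "\<one>\<^bsub>G\<^esub>" v] v by simp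
  moreover have "inj_on (U \<one>\<^bsub>G\<^esub>) (carrier V)" using U_GL[of "\<one>\<^bsub>G\<^esub>"] by (auto simp: Bij_def bij_betw_def)
  ultimately show ?thesis using v by (simp add: inj_on_eq_iff)
qed

lemma U_inv [simp]:
  "g \<in> carrier G \<Longrightarrow> v \<in> carrier V \<Longrightarrow> U g (U (inv\<^bsub>G\<^esub> g) v) = v"
  "g \<in> carrier G \<Longrightarrow> v \<in> carrier V \<Longrightarrow> U (inv\<^bsub>G\<^esub> g) (U g v) = v"
  by (simp_all flip: U_mult)

lemma triple_intertwine:
  assumes "covariant_triple G X \<phi> V \<alpha> \<sigma> U M R T" "g \<in> carrier G" "x \<in> X" "v \<in> carrier V"
  shows "R (\<phi> g x) (U g v) = uract M (T g (R x v)) (\<alpha> g x)"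
  using assms by (simp add: covariant_triple_def)

text \<open>
  By the intertwining relation the first inner product is that of \<open>\<alpha>.T(g) R(x) v\<close> and \<open>T(g) m\<close>, where
  \<open>T(g)\<close> is unitary. The second identity is covariance of the kernel. The first one describes the
  coordinates of \<open>T(g) m\<close> by those of \<open>m\<close> and yields uniqueness of the representation.
\<close>

lemma triple_covariant:
  assumes t: "covariant_triple G X \<phi> V \<alpha> \<sigma> U M R T" and g: "g \<in> carrier G"
    and xv: "x \<in> X" "v \<in> carrier V"
  shows "m \<in> carrier M \<Longrightarrow> inner_prod M (R (\<phi> g x) (U g v)) (T g m) = lstar (\<alpha> g x) (inner_prod M (R x v) m)"
    and "y \<in> X \<Longrightarrow> w \<in> carrier V \<Longrightarrow> inner_prod M (R (\<phi> g x) (U g v)) (R (\<phi> g y) (U g w))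
      = rmul (lstar (\<alpha> g x) (inner_prod M (R x v) (R y w))) (\<alpha> g y)"
proof -
  interpret M: hilbert_module M using t by (simp add: covariant_triple_def)
  have Tg: "T g \<in> unitary_operators M" using t g by (simp add: covariant_triple_def)
  have Lin: "R z \<in> Lin V M" if "z \<in> X" for z using t that by (simp add: covariant_triple_def)
  have R: "R z u \<in> carrier M" if "z \<in> X" "u \<in> carrier V" for z u
    by (rule Lin_closed[OF Lin[OF that(1)] that(2)])
  note s = sesquilinear_uract[OF M.inner_sesquilinear M.cstar_module_axioms]
  show *: "inner_prod M (R (\<phi> g x) (U g v)) (T g m) = lstar (\<alpha> g x) (inner_prod M (R x v) m)"
    if "m \<in> carrier M" for m
    using that by (simp add: triple_intertwine[OF t g xv] s unitary_operators_inner[OF Tg] unitary_operators_closed[OF Tg] R xv)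
  assume yw: "y \<in> X" "w \<in> carrier V"
  show "inner_prod M (R (\<phi> g x) (U g v)) (R (\<phi> g y) (U g w))
      = rmul (lstar (\<alpha> g x) (inner_prod M (R x v) (R y w))) (\<alpha> g y)"
    unfolding triple_intertwine[OF t g yw]
    by (simp add: s unitary_operators_inner[OF Tg] unitary_operators_closed[OF Tg] R xv yw g *)
qed

lemma positive_covariant_kernel_of_triple:
  assumes t: "covariant_triple G X \<phi> V \<alpha> \<sigma> U M R T"
    and nz: "\<exists>x\<in>X. \<exists>v\<in>carrier V. R x v \<noteq> \<zero>\<^bsub>M\<^esub>"
  shows "positive_covariant_kernel G X \<phi> V \<alpha> U (\<lambda>x y v w. inner_prod M (R x v) (R y w))"
proof -
  interpret M: hilbert_module M using t by (simp add: covariant_triple_def)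
  interpret M: pre_hilbert_module M using M.hilbert_module_axioms by (simp add: hilbert_module_iff)
  have Lin: "R x \<in> Lin V M" if "x \<in> X" for x using t that by (simp add: covariant_triple_def)
  have R: "R x v \<in> carrier M" if "x \<in> X" "v \<in> carrier V" for x v
    by (rule Lin_closed[OF Lin[OF that(1)] that(2)])
  show ?thesis
    unfolding positive_covariant_kernel_def
  proof (intro conjI ballI allI impI)
    fix x y assume "x \<in> X" "y \<in> X"
    then show "(\<lambda>v w. inner_prod M (R x v) (R y w)) \<in> sesquilinear_forms V"
      using Lin[of x] Lin[of y] R
      by (simp add: sesquilinear_forms_def Lin_def M.B_add_left M.B_add_right M.B_smul_left
          M.B_smul_right M.B_act_left M.B_act_right)
  next
    show "\<exists>x\<in>X. \<exists>y\<in>X. \<exists>v\<in>carrier V. \<exists>w\<in>carrier V. inner_prod M (R x v) (R y w) \<noteq> 0"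
      using nz R M.inner_definite by blast
  next
    fix n :: nat and x :: "nat \<Rightarrow> 'x" and v :: "nat \<Rightarrow> 'v"
    assume xv: "\<forall>j<n. x j \<in> X \<and> v j \<in> carrier V"
    \<comment> \<open>For \<open>k = n\<close> the vector \<open>m\<close> is the sum of the \<open>R (x j) (v j)\<close>, and the double sum
        is its inner product with itself.\<close>
    have "\<exists>m\<in>carrier M. \<forall>w\<in>carrier M. inner_prod M m w = (\<Sum>j<k. inner_prod M (R (x j) (v j)) w)
        \<and> inner_prod M w m = (\<Sum>j<k. inner_prod M w (R (x j) (v j)))" if "k \<le> n" for k
      using that
    proof (induction k)
      case 0
      show ?case by (intro bexI[of _ "\<zero>\<^bsub>M\<^esub>"]) auto
    next
      case (Suc k)
      then obtain m where m: "m \<in> carrier M" "\<And>w. w \<in> carrier M \<Longrightarrow>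
          inner_prod M m w = (\<Sum>j<k. inner_prod M (R (x j) (v j)) w)
          \<and> inner_prod M w m = (\<Sum>j<k. inner_prod M w (R (x j) (v j)))" by auto
      have "R (x k) (v k) \<in> carrier M" using R xv Suc.prems by simp
      then show ?case
        by (intro bexI[of _ "m \<oplus>\<^bsub>M\<^esub> R (x k) (v k)"]) (auto simp: m M.B_add_left M.B_add_right)
    qed
    from this[of n] obtain m where m: "m \<in> carrier M" "\<And>w. w \<in> carrier M \<Longrightarrow>
          inner_prod M m w = (\<Sum>j<n. inner_prod M (R (x j) (v j)) w)
          \<and> inner_prod M w m = (\<Sum>j<n. inner_prod M w (R (x j) (v j)))" by auto
    have "inner_prod M m m = (\<Sum>j<n. inner_prod M (R (x j) (v j)) m)" using m by blast
    also have "\<dots> = (\<Sum>j<n. \<Sum>k<n. inner_prod M (R (x j) (v j)) (R (x k) (v k)))"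
      using m R xv by (intro sum.cong) auto
    finally show "cstar_positive (\<Sum>j<n. \<Sum>k<n. inner_prod M (R (x j) (v j)) (R (x k) (v k)))"
      using M.inner_positive[OF m(1)] by simp
  next
    fix g x y v w assume *: "g \<in> carrier G" "x \<in> X" "y \<in> X" "v \<in> carrier V" "w \<in> carrier V"
    then show "unitization_incl (inner_prod M (R (\<phi> g x) v) (R (\<phi> g y) w)) =
        unitization_star (\<alpha> g x) \<otimes>\<^bsub>unitization\<^esub>
        unitization_incl (inner_prod M (R x (U (inv\<^bsub>G\<^esub> g) v)) (R y (U (inv\<^bsub>G\<^esub> g) w))) \<otimes>\<^bsub>unitization\<^esub> \<alpha> g y"
      using triple_covariant(2)[OF t *(1,2), of "U (inv\<^bsub>G\<^esub> g) v" y "U (inv\<^bsub>G\<^esub> g) w"]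
      by (simp add: star_mult_incl_mult)
  qed
qed

end

section \<open>The projective unitary representation on the Kolmogorov module\<close>

locale covariant_kernel = covariance_data V G X \<phi> U \<alpha> \<sigma>
  for V :: "('a::cstar_algebra, 'v) amodule"
    and G :: "'g monoid"
    and X :: "'x set"
    and \<phi> :: "'g \<Rightarrow> 'x \<Rightarrow> 'x"
    and U :: "'g \<Rightarrow> 'v \<Rightarrow> 'v"
    and \<alpha> :: "'g \<Rightarrow> 'x \<Rightarrow> 'a \<times> complex"
    and \<sigma> :: "'g \<Rightarrow> 'g \<Rightarrow> 'a \<times> complex" +
  fixes K :: "'x \<Rightarrow> 'x \<Rightarrow> 'v \<Rightarrow> 'v \<Rightarrow> 'a"
  assumes kernel: "positive_covariant_kernel G X \<phi> V \<alpha> U K"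
begin

sublocale positive_kernel V X K
  by unfold_locales (use kernel in \<open>simp_all add: positive_covariant_kernel_def\<close>)

lemma K_covariant:
  assumes "g \<in> carrier G" "x \<in> X" "y \<in> X" "v \<in> carrier V" "w \<in> carrier V"
  shows "K (\<phi> g x) (\<phi> g y) (U g v) (U g w) = rmul (lstar (\<alpha> g x) (K x y v w)) (\<alpha> g y)"
proof -
  have "unitization_incl (K (\<phi> g x) (\<phi> g y) (U g v) (U g w)) = unitization_star (\<alpha> g x) \<otimes>\<^bsub>unitization\<^esub>
      unitization_incl (K x y (U (inv\<^bsub>G\<^esub> g) (U g v)) (U (inv\<^bsub>G\<^esub> g) (U g w))) \<otimes>\<^bsub>unitization\<^esub> \<alpha> g y"
    using kernel assms by (simp add: positive_covariant_kernel_def del: U_inv)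
  then show ?thesis using assms by (simp add: star_mult_incl_mult)
qed

definition \<alpha>_inv :: "'g \<Rightarrow> 'x \<Rightarrow> 'a \<times> complex" where
  "\<alpha>_inv g x = (SOME b. \<alpha> g x \<otimes>\<^bsub>unitization\<^esub> b = \<one>\<^bsub>unitization\<^esub>)"

lemma \<alpha>_mult_inv:
  assumes "g \<in> carrier G" "x \<in> X"
  shows "\<alpha> g x \<otimes>\<^bsub>unitization\<^esub> \<alpha>_inv g x = \<one>\<^bsub>unitization\<^esub>"
proof -
  have "\<exists>b. \<alpha> g x \<otimes>\<^bsub>unitization\<^esub> b = \<one>\<^bsub>unitization\<^esub>"
    using \<alpha>_range[OF assms] by (auto simp: invertible_elements_def Units_def)
  then show ?thesis unfolding \<alpha>_inv_def by (rule someI_ex)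
qed

text \<open>
  The relation \<open>R(g x) U(g) v = \<alpha>(g, x).T(g) R(x) v\<close> forces the value of \<open>T(g)\<close> at \<open>R(x) v\<close>, and
  therefore its action on formal sums.
\<close>

definition translate :: "'g \<Rightarrow> ('x \<times> 'v) list \<Rightarrow> ('x \<times> 'v) list" where
  "translate g = map (\<lambda>(x, v). (\<phi> g x, uract V (U g v) (\<alpha>_inv g x)))"

lemma translate_simps [simp]:
  "translate g [] = []" "translate g ((x, v) # L) = (\<phi> g x, uract V (U g v) (\<alpha>_inv g x)) # translate g L"
  by (simp_all add: translate_def)

lemma translate_in [simp]: "g \<in> carrier G \<Longrightarrow> L \<in> combs \<Longrightarrow> translate g L \<in> combs"
  by (rotate_tac, induction L rule: combs_induct) (simp_all add: V.uract_closed)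

lemma form_translate_single:
  assumes "g \<in> carrier G" "x \<in> X" "v \<in> carrier V" "L \<in> combs"
  shows "form [(\<phi> g x, U g v)] (translate g L) = lstar (\<alpha> g x) (form [(x, v)] L)"
  using assms(4)
proof (induction L rule: combs_induct)
  case (Cons y w L)
  have "K (\<phi> g x) (\<phi> g y) (U g v) (uract V (U g w) (\<alpha>_inv g y)) = rmul (K (\<phi> g x) (\<phi> g y) (U g v) (U g w)) (\<alpha>_inv g y)"
    by (rule sesquilinear_uract[OF K_sesquilinear V]) (use assms Cons in simp_all)
  also have "\<dots> = lstar (\<alpha> g x) (K x y v w)"
    using assms Cons by (simp add: K_covariant rmul_rmul \<alpha>_mult_inv)
  finally show ?case
    unfolding translate_simps using Cons by (subst (1 2) form_Cons_right) (simp add: lstar_linear)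
qed (simp add: lstar_linear)

text \<open>
  Covariance of the kernel produces the factors \<open>\<alpha>(g, x)*\<close> on the left and \<open>\<alpha>(g, y)\<close> on the right,
  which the inverses in the translated vectors cancel.
\<close>

lemma form_translate:
  assumes g: "g \<in> carrier G" and L: "L \<in> combs" and N: "N \<in> combs"
  shows "form (translate g L) (translate g N) = form L N"
  using L
proof (induction L rule: combs_induct)
  case (Cons x v L)
  have gN: "translate g N \<in> combs" using g N by simp
  have "form [(\<phi> g x, uract V (U g v) (\<alpha>_inv g x))] (translate g N)
      = lstar (\<alpha>_inv g x) (form [(\<phi> g x, U g v)] (translate g N))"
  proof -
    have uv: "U g v \<in> carrier V" "\<phi> g x \<in> X" using g Cons by simp_all
    have "form [(\<phi> g x, uract V (U g v) (\<alpha>_inv g x))] N' = lstar (\<alpha>_inv g x) (form [(\<phi> g x, U g v)] N')"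
      if "N' \<in> combs" for N'
      using that
    proof (induction N' rule: combs_induct)
      case (Cons y w N')
      have "K (\<phi> g x) y (uract V (U g v) (\<alpha>_inv g x)) w = lstar (\<alpha>_inv g x) (K (\<phi> g x) y (U g v) w)"
        by (rule sesquilinear_uract[OF K_sesquilinear V]) (use uv Cons in simp_all)
      then show ?case using Cons by (subst (1 2) form_Cons_right) (simp add: lstar_linear)
    qed (simp add: lstar_linear)
    then show ?thesis using gN by blast
  qed
  also have "\<dots> = form [(x, v)] N"
    using g Cons N by (simp add: form_translate_single lstar_lstar \<alpha>_mult_inv)
  finally show ?case
    unfolding translate_simps using Cons by (subst (1 2) form_Cons_left) simp
qed simp

text \<open>
  The coordinate of \<open>T(g) m\<close> at \<open>(g x, U(g) v)\<close> is \<open>\<alpha>(g, x)*\<close> times that of \<open>m\<close> at \<open>(x, v)\<close>.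
\<close>

definition T :: "'g \<Rightarrow> ('x \<Rightarrow> 'v \<Rightarrow> 'a) \<Rightarrow> 'x \<Rightarrow> 'v \<Rightarrow> 'a" where
  "T g f y w = (if y \<in> X \<and> w \<in> carrier V
    then lstar (\<alpha> g (\<phi> (inv\<^bsub>G\<^esub> g) y)) (f (\<phi> (inv\<^bsub>G\<^esub> g) y) (U (inv\<^bsub>G\<^esub> g) w)) else 0)"

lemma represents_T:
  assumes g: "g \<in> carrier G" and s: "represents s f"
  shows "represents (\<lambda>n. translate g (s n)) (T g f)"
  unfolding represents_def
proof (intro conjI ballI allI impI)
  note [simp] = representsD(5)[OF s] g
  show "cauchy (\<lambda>n. translate g (s n))"
  proof (rule cauchy_by_dominated[OF representsD(1)[OF s], where C = 1])
    fix m n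
    show "seminorm (diff (translate g (s m)) (translate g (s n))) \<le> 1 * seminorm (diff (s m) (s n))"
      by (simp add: seminorm_def B_diff_left B_diff_right form_translate)
  qed simp_all
  fix y w assume yw: "y \<in> X" "w \<in> carrier V"
  define x where "x = \<phi> (inv\<^bsub>G\<^esub> g) y"
  define v where "v = U (inv\<^bsub>G\<^esub> g) w"
  have xv: "x \<in> X" "v \<in> carrier V" "y = \<phi> g x" "w = U g v" using yw by (simp_all add: x_def v_def)
  have "(\<lambda>n. lstar (\<alpha> g x) (form [(x, v)] (s n))) \<longlonglongrightarrow> lstar (\<alpha> g x) (f x v)"
    by (rule bounded_linear.tendsto[OF bounded_linear_lstar representsD(2)[OF s xv(1,2)]])
  then show "(\<lambda>n. form [(y, w)] (translate g (s n))) \<longlonglongrightarrow> T g f y w"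
    using yw xv by (simp add: form_translate_single T_def flip: x_def v_def)
qed (auto simp: T_def)

lemma T_closed [simp]: "g \<in> carrier G \<Longrightarrow> f \<in> carrier H \<Longrightarrow> T g f \<in> carrier H"
  using represents_T represents_in by (auto simp: H_sel(1))

lemma T_inner:
  assumes g: "g \<in> carrier G" and "f \<in> carrier H" "f' \<in> carrier H"
  shows "inner (T g f) (T g f') = inner f f'"
proof -
  obtain s t where s: "represents s f" and t: "represents t f'" using assms by (auto simp: H_sel(1))
  have "(\<lambda>n. form (translate g (s n)) (translate g (t n))) \<longlonglongrightarrow> inner f f'"
    using form_tendsto_inner[OF s t] g by (simp add: form_translate representsD(5)[OF s] representsD(5)[OF t])
  from LIMSEQ_unique[OF form_tendsto_inner[OF represents_T[OF g s] represents_T[OF g t]] this]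
  show ?thesis .
qed

lemma T_Lin: "g \<in> carrier G \<Longrightarrow> T g \<in> Lin H H"
  unfolding Lin_def
proof (intro CollectI conjI ballI allI)
  assume "g \<in> carrier G"
  then show "T g \<in> carrier H \<rightarrow> carrier H" by simp
qed (simp_all add: T_def H_sel(3-5) fun_eq_iff lstar_linear)

lemma H_supp: "f \<in> carrier H \<Longrightarrow> x \<notin> X \<or> v \<notin> carrier V \<Longrightarrow> f x v = 0"
  using representsD(3,4) by (auto simp: H_sel(1))

lemma T_one: "f \<in> carrier H \<Longrightarrow> T \<one>\<^bsub>G\<^esub> f = f"
  by (auto simp: T_def fun_eq_iff \<alpha>_one H_supp)

lemma uract_H: "uract H f a = (\<lambda>x v. rmul (f x v) a)"
  by (simp add: uract_eq H_sel rmul_def)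

lemma \<sigma>_range: "g \<in> carrier G \<Longrightarrow> h \<in> carrier G \<Longrightarrow> \<sigma> g h \<in> unitary_elements \<inter> center"
  using \<sigma> by (simp add: two_cocycle_def)

text \<open>
  The identity for \<open>\<alpha>\<close> splits \<open>\<alpha>(g h, z)*\<close> into three factors; the factor \<open>\<sigma>(g, h)*\<close> cancels
  \<open>\<sigma>(g, h)\<close>, which is unitary and central.
\<close>

lemma T_mult:
  assumes g: "g \<in> carrier G" and h: "h \<in> carrier G"
  shows "T g (T h f) = uract H (T (g \<otimes>\<^bsub>G\<^esub> h) f) (\<sigma> g h)"
proof (intro ext)
  fix y w
  show "T g (T h f) y w = uract H (T (g \<otimes>\<^bsub>G\<^esub> h) f) (\<sigma> g h) y w"
  proof (cases "y \<in> X \<and> w \<in> carrier V")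
    case True
    define z where "z = \<phi> (inv\<^bsub>G\<^esub> h) (\<phi> (inv\<^bsub>G\<^esub> g) y)"
    define u where "u = U (inv\<^bsub>G\<^esub> h) (U (inv\<^bsub>G\<^esub> g) w)"
    have z: "z \<in> X" "\<phi> (inv\<^bsub>G\<^esub> (g \<otimes>\<^bsub>G\<^esub> h)) y = z" "\<phi> h z = \<phi> (inv\<^bsub>G\<^esub> g) y"
      "U (inv\<^bsub>G\<^esub> (g \<otimes>\<^bsub>G\<^esub> h)) w = u"
      using True g h by (simp_all add: z_def u_def G.inv_mult_group act_mult U_mult)
    have "uract H (T (g \<otimes>\<^bsub>G\<^esub> h) f) (\<sigma> g h) y w = rmul (lstar (\<alpha> (g \<otimes>\<^bsub>G\<^esub> h) z) (f z u)) (\<sigma> g h)"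
      using True by (simp add: uract_H T_def z)
    also have "\<dots> = lstar (\<alpha> g (\<phi> h z)) (lstar (\<alpha> h z) (lstar (\<sigma> g h) (rmul (f z u) (\<sigma> g h))))"
      by (simp add: rmul_lstar lstar_lstar \<alpha>_mult[OF g h z(1)])
    also have "\<dots> = T g (T h f) y w"
      using True g h by (simp add: unitary_center_cancel[OF \<sigma>_range] T_def z(3) flip: z_def u_def)
    finally show ?thesis by simp
  qed (auto simp: T_def uract_H rmul_linear)
qed

text \<open>
  A surjective isometry has its inverse as adjoint. Surjectivity holds because
  \<open>T(g) T(g\<^sup>-\<^sup>1)\<close> is multiplication by the unitary element \<open>\<sigma>(g, g\<^sup>-\<^sup>1)\<close>.
\<close>

lemma T_unitary:
  assumes g: "g \<in> carrier G"
  shows "T g \<in> unitary_operators H"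
proof -
  define s where "s = \<sigma> g (inv\<^bsub>G\<^esub> g)"
  have ss: "unitization_star s \<otimes>\<^bsub>unitization\<^esub> s = \<one>\<^bsub>unitization\<^esub>"
    using \<sigma>_range[of g "inv\<^bsub>G\<^esub> g"] g by (simp add: s_def unitary_elements_def)
  have surj: "\<exists>f'\<in>carrier H. T g f' = f" if f: "f \<in> carrier H" for f
  proof
    have f0: "uract H f (unitization_star s) \<in> carrier H" using f by (rule H.uract_closed)
    then show "T (inv\<^bsub>G\<^esub> g) (uract H f (unitization_star s)) \<in> carrier H" using g by simp
    show "T g (T (inv\<^bsub>G\<^esub> g) (uract H f (unitization_star s))) = f"
      using g f0 by (simp add: T_mult T_one flip: s_def) (simp add: uract_H rmul_rmul ss)
  qed
  then obtain C where C: "\<And>f. f \<in> carrier H \<Longrightarrow> C f \<in> carrier H" "\<And>f. f \<in> carrier H \<Longrightarrow> T g (C f) = f"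
    by metis
  have inj: "f = f'" if "f \<in> carrier H" "f' \<in> carrier H" "T g f = T g f'" for f f'
  proof (rule H.inner_eq_imp_eq[OF that(1,2)])
    fix k assume k: "k \<in> carrier H"
    show "inner_prod H k f = inner_prod H k f'"
      using T_inner[OF g k that(1)] T_inner[OF g k that(2)] that(3) by (simp add: H_sel(6))
  qed
  have "inner (T g f) k = inner f (C k)" if "f \<in> carrier H" "k \<in> carrier H" for f k
    using T_inner[OF g that(1) C(1)[OF that(2)]] C(2)[OF that(2)] by simp
  moreover have "C (T g f) = f" if "f \<in> carrier H" for f
    by (rule inj) (use that g C in simp_all)
  ultimately show ?thesis
    unfolding unitary_operators_def using T_Lin[OF g] C by (auto simp: H_sel(6) intro!: bexI[of _ C])
qed

lemma feature_intertwine: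
  assumes x: "x \<in> X" and g: "g \<in> carrier G" and v: "v \<in> carrier V"
  shows "feature x (U g v) = uract H (T g (feature (\<phi> (inv\<^bsub>G\<^esub> g) x) v)) (\<alpha> g (\<phi> (inv\<^bsub>G\<^esub> g) x))"
proof (intro ext)
  fix y w
  show "feature x (U g v) y w = uract H (T g (feature (\<phi> (inv\<^bsub>G\<^esub> g) x) v)) (\<alpha> g (\<phi> (inv\<^bsub>G\<^esub> g) x)) y w"
  proof (cases "y \<in> X \<and> w \<in> carrier V")
    case True
    then show ?thesis
      using K_covariant[of g "\<phi> (inv\<^bsub>G\<^esub> g) y" "\<phi> (inv\<^bsub>G\<^esub> g) x" "U (inv\<^bsub>G\<^esub> g) w" v] assms
      by (simp add: feature_def embed_def T_def uract_H)
  qed (auto simp: feature_def embed_def T_def uract_H rmul_linear)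
qed

lemma minimal_dilation_H: "minimal_dilation G X \<phi> V \<alpha> \<sigma> U K H feature T"
  unfolding minimal_dilation_def covariant_triple_def
  using hilbert_module_H feature_Lin T_unitary T_one T_mult feature_intertwine inner_feature hdense_feature
  by simp

lemma minimal_dilation_imp_realization:
  assumes "minimal_dilation G X \<phi> V \<alpha> \<sigma> U K M R T'"
  shows "minimal_realization V X K M R"
  using assms positive_kernel_axioms
  by (simp add: minimal_realization_def minimal_realization_axioms_def minimal_dilation_def
      covariant_triple_def)

text \<open>
  The vectors \<open>W (S g m)\<close> and \<open>S' g (W m)\<close> have the same coordinates: at \<open>(g x, U(g) v)\<close> both are
  \<open>\<alpha>(g, x)* \<langle>R(x) v, m\<rangle>\<close>.
\<close>

lemma minimal_dilations_equivalent:
  assumes M: "minimal_dilation G X \<phi> V \<alpha> \<sigma> U K M R S"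
    and M': "minimal_dilation G X \<phi> V \<alpha> \<sigma> U K M' R' S'"
  obtains W where "W \<in> unitary_between M M'"
    "\<And>x v. x \<in> X \<Longrightarrow> v \<in> carrier V \<Longrightarrow> W (R x v) = R' x v"
    "\<And>g m. g \<in> carrier G \<Longrightarrow> m \<in> carrier M \<Longrightarrow> W (S g m) = S' g (W m)"
proof -
  interpret M: minimal_realization V X K M R by (rule minimal_dilation_imp_realization[OF M])
  interpret M': minimal_realization V X K M' R' by (rule minimal_dilation_imp_realization[OF M'])
  have t: "covariant_triple G X \<phi> V \<alpha> \<sigma> U M R S" and t': "covariant_triple G X \<phi> V \<alpha> \<sigma> U M' R' S'"
    using M M' by (simp_all add: minimal_dilation_def)
  obtain W where W: "W \<in> unitary_between M M'" "\<And>x v. x \<in> X \<Longrightarrow> v \<in> carrier V \<Longrightarrow> W (R x v) = R' x v"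
    using minimal_realizations_equivalent[OF M.minimal_realization_axioms M'.minimal_realization_axioms]
    by blast
  have W_closed: "W m \<in> carrier M'" if "m \<in> carrier M" for m
    using W(1) that by (auto simp: unitary_between_def)
  have W_inner: "inner_prod M' (R' x v) (W m) = inner_prod M (R x v) m"
    if "x \<in> X" "v \<in> carrier V" "m \<in> carrier M" for x v m
    using W that by (simp add: unitary_between_def flip: W(2))
  have S: "S g m \<in> carrier M" if "g \<in> carrier G" "m \<in> carrier M" for g m
    by (rule unitary_operators_closed) (use t that in \<open>simp_all add: covariant_triple_def\<close>)
  have S': "S' g m \<in> carrier M'" if "g \<in> carrier G" "m \<in> carrier M'" for g m
    by (rule unitary_operators_closed) (use t' that in \<open>simp_all add: covariant_triple_def\<close>)
  have "W (S g m) = S' g (W m)" if g: "g \<in> carrier G" and m: "m \<in> carrier M" for g m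
  proof (rule M'.coord_inject)
    have "inner_prod M' (R' y w) (W (S g m)) = inner_prod M' (R' y w) (S' g (W m))"
      if yw: "y \<in> X" "w \<in> carrier V" for y w
    proof -
      define x where "x = \<phi> (inv\<^bsub>G\<^esub> g) y"
      define v where "v = U (inv\<^bsub>G\<^esub> g) w"
      have xv: "x \<in> X" "v \<in> carrier V" and y: "y = \<phi> g x" and w: "w = U g v"
        using yw g by (simp_all add: x_def v_def)
      have "inner_prod M' (R' y w) (W (S g m)) = inner_prod M (R y w) (S g m)"
        by (rule W_inner[OF yw S[OF g m]])
      also have "\<dots> = lstar (\<alpha> g x) (inner_prod M (R x v) m)"
        unfolding y w by (rule triple_covariant(1)[OF t g xv m])
      also have "\<dots> = lstar (\<alpha> g x) (inner_prod M' (R' x v) (W m))"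
        by (simp only: W_inner[OF xv m])
      also have "\<dots> = inner_prod M' (R' y w) (S' g (W m))"
        unfolding y w by (rule triple_covariant(1)[OF t' g xv W_closed[OF m], symmetric])
      finally show ?thesis .
    qed
    then show "M'.coord (W (S g m)) = M'.coord (S' g (W m))" by (simp add: M'.coord_def fun_eq_iff)
  qed (simp_all add: S S' W_closed g m)
  then show ?thesis using that W by blast
qed

end

theorem theorem1:
  fixes V :: "('a::cstar_algebra, 'v) amodule"
    and G :: "'g monoid"
    and X :: "'x set"
    and \<phi> :: "'g \<Rightarrow> 'x \<Rightarrow> 'x"
    and U :: "'g \<Rightarrow> 'v \<Rightarrow> 'v"
    and \<alpha> :: "'g \<Rightarrow> 'x \<Rightarrow> 'a \<times> complex"
    and \<sigma> :: "'g \<Rightarrow> 'g \<Rightarrow> 'a \<times> complex"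
  assumes V: "cstar_module V"
    and G: "group G"
    and X: "X \<noteq> {}"
    and action: "group_action G X \<phi>"
    and U: "U \<in> hom G (GL V)"
    and \<alpha>_range: "\<And>g x. g \<in> carrier G \<Longrightarrow> x \<in> X \<Longrightarrow> \<alpha> g x \<in> invertible_elements \<inter> center"
    and \<sigma>: "two_cocycle G \<sigma>"
    and \<alpha>_one: "\<And>x. x \<in> X \<Longrightarrow> \<alpha> \<one>\<^bsub>G\<^esub> x = \<one>\<^bsub>unitization\<^esub>"
    and \<alpha>_mult: "\<And>g h x. g \<in> carrier G \<Longrightarrow> h \<in> carrier G \<Longrightarrow> x \<in> X \<Longrightarrow>
      \<alpha> (g \<otimes>\<^bsub>G\<^esub> h) x =
        \<sigma> g h \<otimes>\<^bsub>unitization\<^esub> \<alpha> h x \<otimes>\<^bsub>unitization\<^esub> \<alpha> g (\<phi> h x)"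
  shows
    "(\<forall>K. positive_covariant_kernel G X \<phi> V \<alpha> U K \<longrightarrow>
        (\<exists>(M :: ('a, 'x \<Rightarrow> 'v \<Rightarrow> 'a) hmodule) R T. minimal_dilation G X \<phi> V \<alpha> \<sigma> U K M R T)) \<and>
     (\<forall>K (M :: ('a, 'm) hmodule) R T (M' :: ('a, 'n) hmodule) R' T'.
        positive_covariant_kernel G X \<phi> V \<alpha> U K \<longrightarrow>
        minimal_dilation G X \<phi> V \<alpha> \<sigma> U K M R T \<longrightarrow>
        minimal_dilation G X \<phi> V \<alpha> \<sigma> U K M' R' T' \<longrightarrow>
        (\<exists>W \<in> unitary_between M M'.
           (\<forall>x\<in>X. \<forall>v\<in>carrier V. W (R x v) = R' x v) \<and>
           (\<forall>g\<in>carrier G. \<forall>m\<in>carrier M. W (T g m) = T' g (W m)))) \<and>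
     (\<forall>(M :: ('a, 'm) hmodule) R T.
        covariant_triple G X \<phi> V \<alpha> \<sigma> U M R T \<longrightarrow>
        (\<exists>x\<in>X. \<exists>v\<in>carrier V. R x v \<noteq> \<zero>\<^bsub>M\<^esub>) \<longrightarrow>
        positive_covariant_kernel G X \<phi> V \<alpha> U (\<lambda>x y v w. inner_prod M (R x v) (R y w)))"
proof -
  interpret covariance_data V G X \<phi> U \<alpha> \<sigma>
    by (rule covariance_data.intro[OF V G action U \<alpha>_range \<sigma> \<alpha>_one \<alpha>_mult])
  show ?thesis
  proof (intro conjI allI impI)
    fix K assume "positive_covariant_kernel G X \<phi> V \<alpha> U K"
    then interpret covariant_kernel V G X \<phi> U \<alpha> \<sigma> K
      by (intro covariant_kernel.intro covariance_data_axioms covariant_kernel_axioms.intro)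
    show "\<exists>(M :: ('a, 'x \<Rightarrow> 'v \<Rightarrow> 'a) hmodule) R T. minimal_dilation G X \<phi> V \<alpha> \<sigma> U K M R T"
      using minimal_dilation_H by blast
  next
    fix K and M :: "('a, 'm) hmodule" and R T and M' :: "('a, 'n) hmodule" and R' T'
    assume "positive_covariant_kernel G X \<phi> V \<alpha> U K"
      and *: "minimal_dilation G X \<phi> V \<alpha> \<sigma> U K M R T" "minimal_dilation G X \<phi> V \<alpha> \<sigma> U K M' R' T'"
    then interpret covariant_kernel V G X \<phi> U \<alpha> \<sigma> K
      by (intro covariant_kernel.intro covariance_data_axioms covariant_kernel_axioms.intro)
    show "\<exists>W \<in> unitary_between M M'. (\<forall>x\<in>X. \<forall>v\<in>carrier V. W (R x v) = R' x v) \<and>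
        (\<forall>g\<in>carrier G. \<forall>m\<in>carrier M. W (T g m) = T' g (W m))"
      using minimal_dilations_equivalent[OF *] by metis
  qed (rule positive_covariant_kernel_of_triple)
qed

end
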